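(* Let $G=(G_1\rightrightarrows G_0)$ be a Lie groupoid with source $s$, target $t$ and quotient map $\pi_G\colon G_0\to G_0/G_1$ to its orbit space, and consider the sequence $$0\longrightarrow \Omega^*(G_0/G_1)\xrightarrow{\ \pi_G^*\ }\Omega^*(G_0)\xrightarrow{\ s^*-t^*\ }\Omega^*(G_1).$$ Then: (i) for any Lie groupoid $G$, the sequence is exact at $\Omega^*(G_0/G_1)$; (ii) if $G$ is proper, then the sequence is also exact at $\Omega^*(G_0)$.
   Context: **Lie groupoids.** All Lie groupoids $G=(G_1\rightrightarrows G_0)$ are finite dimensional, paracompact and Hausdorff, with source and target $s,t\colon G_1\to G_0$. $G$ is proper if $(s,t)\colon G_1\to G_0\times G_0$ is a proper map. The orbit of $x\in G_0$ is $\{t(g)\mid g\in G_1,\ s(g)=x\}$; the orbit space $G_0/G_1$ is the set of orbits, and $\pi_G$ is the quotient map. **Diffeology.** A parametrisation of a set $X$ is a map of sets $p\colon U\to X$ with $U$ an open subset of some Euclidean space (of any dimension). A diffeology on $X$ is a family $\mathcal D$ of parametrisations (called plots) such that: (1) all constant parametrisations are in $\mathcal D$; (2) if $p\colon U\to X$ is a parametrisation and $U$ has an open cover $\{U_\alpha\}$ with every $p|_{U_\alpha}\in\mathcal D$, then $p\in\mathcal D$; (3) if $(p\colon U\to X)\in\mathcal D$ and $f\colon V\to U$ is a smooth map from an open subset $V$ of a Euclidean space, then $p\circ f\in\mathcal D$. A map between diffeological spaces is smooth if its composition with every plot is a plot. A manifold carries the standard diffeology, consisting of all smooth parametrisations.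 If $\sim$ is an equivalence relation on a diffeological space $X$ with quotient map $\pi$, the quotient diffeology on $X/\!\sim$ consists of all parametrisations $p\colon U\to X/\!\sim$ such that each $u\in U$ has an open neighbourhood $V$ on which $p|_V=\pi\circ q$ for some plot $q\colon V\to X$. The orbit space $G_0/G_1$ carries the quotient diffeology induced by the standard diffeology of $G_0$. **Forms on diffeological spaces.** A differential $k$-form $\alpha$ on a diffeological space $X$ assigns to each plot $p\colon U\to X$ a form $\alpha_p\in\Omega^k(U)$ with $\alpha_{p\circ f}=f^*\alpha_p$ for every smooth parametrisation $f\colon V\to U$ of $U$. The exterior derivative is $(d\alpha)_p=d(\alpha_p)$; $\Omega^*(X)$ is the resulting de Rham complex. A smooth map $\varphi\colon X\to Y$ induces $\varphi^*\colon\Omega^*(Y)\to\Omega^*(X)$, $(\varphi^*\alpha)_p=\alpha_{\varphi\circ p}$. On manifolds this agrees with the usual de Rham complex. *)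

theory Defs
  imports "HOL-Analysis.Analysis" "HOL-Library.FuncSet" "HOL-Library.Function_Algebras"
begin

section \<open>Smooth functions on open subsets of Euclidean spaces of varying dimension\<close>

text \<open>
  Plots have domains in Euclidean spaces of arbitrary dimension, so the dimension has to be a
  number rather than a type.  The n-dimensional Euclidean space is the library's
  \<^const>\<open>Euclidean_space\<close> n, whose points are the functions \<^typ>\<open>nat \<Rightarrow> real\<close> vanishing
  from index n on.
\<close>

type_synonym vec = "nat \<Rightarrow> real"

definition partial :: "nat \<Rightarrow> (vec \<Rightarrow> real) \<Rightarrow> vec \<Rightarrow> real" where
  "partial i h x = deriv (\<lambda>t. h (x(i := t))) (x i)"

text \<open>
  For D open in the n-dimensional Euclidean space: all iterated partial derivatives of h exist and
  are continuous on D.  Only the values of h on D matter.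
\<close>

definition smooth_fun :: "nat \<Rightarrow> vec set \<Rightarrow> (vec \<Rightarrow> real) \<Rightarrow> bool" where
  "smooth_fun n D h \<longleftrightarrow>
     (\<forall>is. set is \<subseteq> {..<n} \<longrightarrow>
        continuous_map (subtopology (Euclidean_space n) D) euclideanreal (foldr partial is h) \<and>
        (\<forall>i<n. \<forall>x\<in>D. (\<lambda>t. foldr partial is h (x(i := t))) field_differentiable at (x i)))"

lemma eventually_coord_in:
  assumes "openin (Euclidean_space n) D" "x \<in> D" "i < n"
  shows "eventually (\<lambda>t. x(i := t) \<in> D) (nhds (x i))"
proof -
  have x: "x \<in> topspace (Euclidean_space n)"
    using assms openin_subset by blast
  have "continuous_map euclideanreal (Euclidean_space n) (\<lambda>t. x(i := t))"
    using x assms(3)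
    by (auto simp: Euclidean_space_def continuous_map_in_subtopology continuous_map_componentwise_UNIV
        continuous_map_iff_continuous2)
  then have "openin euclideanreal {t \<in> topspace euclideanreal. x(i := t) \<in> D}"
    using assms(1) openin_continuous_map_preimage by blast
  then have "open {t. x(i := t) \<in> D}" by simp
  then show ?thesis
    unfolding eventually_nhds using assms(2) by (intro exI[of _ "{t. x(i := t) \<in> D}"]) simp
qed

lemma foldr_partial_cong:
  assumes D: "openin (Euclidean_space n) D" and eq: "\<And>x. x \<in> D \<Longrightarrow> h x = h' x"
    and sis: "set is \<subseteq> {..<n}" and x: "x \<in> D"
  shows "foldr partial is h x = foldr partial is h' x"
  using sis x
proof (induction "is" arbitrary: x)
  case (Cons i js)
  have "eventually (\<lambda>t. foldr partial js h (x(i := t)) = foldr partial js h' (x(i := t))) (nhds (x i))"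
    using eventually_coord_in[OF D, of x i] Cons by (auto elim!: eventually_mono)
  then show ?case
    by (simp add: partial_def[of i] deriv_cong_ev)
qed (simp add: eq)

lemma smooth_fun_cong_mono:
  assumes h: "smooth_fun n D h" and D: "openin (Euclidean_space n) D"
    and D': "openin (Euclidean_space n) D'" and sub: "D' \<subseteq> D"
    and eq: "\<And>x. x \<in> D' \<Longrightarrow> h x = h' x"
  shows "smooth_fun n D' h'"
  unfolding smooth_fun_def
proof (intro allI impI conjI ballI)
  fix "is" assume sis: "set is \<subseteq> {..<n}"
  note c = foldr_partial_cong[OF D' eq sis]
  have "continuous_map (subtopology (Euclidean_space n) D') euclideanreal (foldr partial is h)"
    by (rule continuous_map_from_subtopology_mono[OF _ sub]) (use h sis in \<open>simp add: smooth_fun_def\<close>)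
  then show "continuous_map (subtopology (Euclidean_space n) D') euclideanreal (foldr partial is h')"
    by (rule continuous_map_eq) (auto simp: c)
  fix i x assume i: "i < n" and x: "x \<in> D'"
  have "(\<lambda>t. foldr partial is h (x(i := t))) field_differentiable at (x i)"
    using h sis i subsetD[OF sub x] by (simp add: smooth_fun_def)
  moreover have "eventually (\<lambda>t. foldr partial is h (x(i := t)) = foldr partial is h' (x(i := t))) (nhds (x i))"
    using eventually_coord_in[OF D' x i] by (auto elim!: eventually_mono simp: c)
  ultimately show "(\<lambda>t. foldr partial is h' (x(i := t))) field_differentiable at (x i)"
    unfolding field_differentiable_def by (simp add: DERIV_cong_ev[OF refl _ refl])
qed

definition smooth_vfun :: "nat \<Rightarrow> nat \<Rightarrow> vec set \<Rightarrow> (vec \<Rightarrow> vec) \<Rightarrow> bool" where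
  "smooth_vfun m n D f \<longleftrightarrow> (\<forall>j<n. smooth_fun m D (\<lambda>x. f x j))"

definition tangent_map :: "nat \<Rightarrow> (vec \<Rightarrow> vec) \<Rightarrow> vec \<Rightarrow> vec \<Rightarrow> vec" where
  "tangent_map m f x w = (\<lambda>j. \<Sum>i<m. partial i (\<lambda>z. f z j) x * w i)"


section \<open>Manifolds\<close>

text \<open>
  A chart is a triple of its domain, its dimension and its coordinate map.
  Dimensions are recorded per chart, so a manifold may have components of different dimensions.
\<close>

type_synonym 'a chart = "'a set \<times> nat \<times> ('a \<Rightarrow> vec)"

record 'a mfd =
  mtop :: "'a topology"
  charts :: "'a chart set"

definition local_rep :: "'a chart \<Rightarrow> 'b chart \<Rightarrow> ('a \<Rightarrow> 'b) \<Rightarrow> vec \<Rightarrow> vec" where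
  "local_rep = (\<lambda>(U, m, \<phi>) (V, n, \<psi>) f. \<psi> \<circ> f \<circ> inv_into U \<phi>)"

definition paracompact_space :: "'a topology \<Rightarrow> bool" where
  "paracompact_space X \<longleftrightarrow>
     (\<forall>\<U>. (\<forall>U\<in>\<U>. openin X U) \<and> \<Union>\<U> = topspace X \<longrightarrow>
        (\<exists>\<V>. (\<forall>V\<in>\<V>. openin X V \<and> (\<exists>U\<in>\<U>. V \<subseteq> U)) \<and> \<Union>\<V> = topspace X \<and>
             locally_finite_in X \<V>))"

definition manifold :: "'a mfd \<Rightarrow> bool" where
  "manifold M \<longleftrightarrow>
     Hausdorff_space (mtop M) \<and> paracompact_space (mtop M) \<and>
     (\<forall>x\<in>topspace (mtop M). \<exists>(U, n, \<phi>)\<in>charts M. x \<in> U) \<and>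
     (\<forall>(U, n, \<phi>)\<in>charts M.
        openin (mtop M) U \<and> openin (Euclidean_space n) (\<phi> ` U) \<and>
        homeomorphic_map (subtopology (mtop M) U) (subtopology (Euclidean_space n) (\<phi> ` U)) \<phi>) \<and>
     (\<forall>(U, m, \<phi>)\<in>charts M. \<forall>(V, n, \<psi>)\<in>charts M.
        smooth_vfun m n (\<phi> ` (U \<inter> V)) (local_rep (U, m, \<phi>) (V, n, \<psi>) (\<lambda>x. x)))"

definition smooth_map :: "'a mfd \<Rightarrow> 'b mfd \<Rightarrow> ('a \<Rightarrow> 'b) \<Rightarrow> bool" where
  "smooth_map M N f \<longleftrightarrow>
     continuous_map (mtop M) (mtop N) f \<and>
     (\<forall>(U, m, \<phi>)\<in>charts M. \<forall>(V, n, \<psi>)\<in>charts N.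
        smooth_vfun m n (\<phi> ` {x\<in>U. f x \<in> V}) (local_rep (U, m, \<phi>) (V, n, \<psi>) f))"

definition submersion :: "'a mfd \<Rightarrow> 'b mfd \<Rightarrow> ('a \<Rightarrow> 'b) \<Rightarrow> bool" where
  "submersion M N f \<longleftrightarrow>
     smooth_map M N f \<and>
     (\<forall>(U, m, \<phi>)\<in>charts M. \<forall>(V, n, \<psi>)\<in>charts N. \<forall>x\<in>U. f x \<in> V \<longrightarrow>
        tangent_map m (local_rep (U, m, \<phi>) (V, n, \<psi>) f) (\<phi> x) ` topspace (Euclidean_space m)
          = topspace (Euclidean_space n))"

definition euclidean_open :: "nat \<Rightarrow> vec set \<Rightarrow> vec mfd" where
  "euclidean_open n U =
     \<lparr>mtop = subtopology (Euclidean_space n) U, charts = {(U, n, \<lambda>x. x)}\<rparr>"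


section \<open>Diffeological spaces\<close>

text \<open>
  A parametrisation is a triple of the dimension of the ambient Euclidean space, the domain and the
  map; the map is normalised to be \<^const>\<open>undefined\<close> outside the domain, so that parametrisations
  are equal as triples iff they are equal as maps.
\<close>

type_synonym 'x param = "nat \<times> vec set \<times> (vec \<Rightarrow> 'x)"

definition parametrisations :: "'x set \<Rightarrow> 'x param set" where
  "parametrisations X = {(n, U, p). openin (Euclidean_space n) U \<and> p \<in> U \<rightarrow>\<^sub>E X}"

record 'x dspace =
  points :: "'x set"
  plots :: "'x param set"

definition diffeology :: "'x dspace \<Rightarrow> bool" where
  "diffeology X \<longleftrightarrow>
     plots X \<subseteq> parametrisations (points X) \<and>
     (\<forall>n U. \<forall>x\<in>points X. openin (Euclidean_space n) U \<longrightarrow> (n, U, \<lambda>u\<in>U. x) \<in> plots X) \<and>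
     (\<forall>(n, U, p)\<in>parametrisations (points X).
        (\<forall>u\<in>U. \<exists>V. openin (Euclidean_space n) V \<and> u \<in> V \<and> V \<subseteq> U \<and>
                    (n, V, restrict p V) \<in> plots X) \<longrightarrow> (n, U, p) \<in> plots X) \<and>
     (\<forall>(n, U, p)\<in>plots X. \<forall>m V f.
        openin (Euclidean_space m) V \<and> smooth_map (euclidean_open m V) (euclidean_open n U) f
        \<longrightarrow> (m, V, restrict (p \<circ> f) V) \<in> plots X)"

definition dsmooth :: "'x dspace \<Rightarrow> 'y dspace \<Rightarrow> ('x \<Rightarrow> 'y) \<Rightarrow> bool" where
  "dsmooth X Y f \<longleftrightarrow>
     f \<in> points X \<rightarrow> points Y \<and>
     (\<forall>(n, U, p)\<in>plots X. (n, U, restrict (f \<circ> p) U) \<in> plots Y)"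

definition manifold_dspace :: "'a mfd \<Rightarrow> 'a dspace" where
  "manifold_dspace M =
     \<lparr>points = topspace (mtop M),
      plots = {(n, U, p). (n, U, p) \<in> parametrisations (topspace (mtop M)) \<and>
                          smooth_map (euclidean_open n U) M p}\<rparr>"

definition quotient_dspace :: "'x dspace \<Rightarrow> ('x \<times> 'x) set \<Rightarrow> 'x set dspace" where
  "quotient_dspace X r =
     \<lparr>points = points X // r,
      plots = {(n, U, p). (n, U, p) \<in> parametrisations (points X // r) \<and>
                 (\<forall>u\<in>U. \<exists>V q. openin (Euclidean_space n) V \<and> u \<in> V \<and> V \<subseteq> U \<and>
                              (n, V, q) \<in> plots X \<and> (\<forall>v\<in>V. p v = r `` {q v}))}\<rparr>"

lemma smooth_map_euclidean_open_restrict: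
  assumes f: "smooth_map (euclidean_open m V) (euclidean_open n U) f"
    and V: "openin (Euclidean_space m) V" and V': "openin (Euclidean_space m) V'" "V' \<subseteq> V"
    and U': "f ` V' \<subseteq> U'" "U' \<subseteq> U" 
  shows "smooth_map (euclidean_open m V') (euclidean_open n U') f"
proof -
  have top: "topspace (Euclidean_space m) \<inter> V = V" "topspace (Euclidean_space m) \<inter> V' = V'"
    using V V' openin_subset by blast+
  have cont: "continuous_map (subtopology (Euclidean_space m) V) (subtopology (Euclidean_space n) U) f"
    using f by (simp add: smooth_map_def euclidean_open_def)
  have im: "f ` V \<subseteq> U"
    using cont top by (auto simp: continuous_map_in_subtopology)
  have "continuous_map (subtopology (Euclidean_space m) V') (subtopology (Euclidean_space n) U') f"
    using continuous_map_from_subtopology_mono[OF _ V'(2), of "Euclidean_space m" "Euclidean_space n" f] cont U' top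
    by (auto simp: continuous_map_in_subtopology)
  moreover have "smooth_vfun m n V' (\<lambda>x. f (inv_into V' (\<lambda>x. x) x))"
    unfolding smooth_vfun_def
  proof (intro allI impI)
    fix j assume "j < n"
    moreover have "{x \<in> V. f x \<in> U} = V" using im by auto
    ultimately have "smooth_fun m V (\<lambda>x. f (inv_into V (\<lambda>x. x) x) j)"
      using f by (simp add: smooth_map_def euclidean_open_def smooth_vfun_def local_rep_def)
    then show "smooth_fun m V' (\<lambda>x. f (inv_into V' (\<lambda>x. x) x) j)"
      by (rule smooth_fun_cong_mono)
        (use V V' in \<open>simp_all add: subsetD\<close>)
  qed
  moreover have "{x \<in> V'. f x \<in> U'} = V'" using U' by auto
  ultimately show ?thesis
    by (simp add: smooth_map_def euclidean_open_def local_rep_def comp_def)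
qed

lemma diffeologyI:
  assumes "plots X \<subseteq> parametrisations (points X)"
    and "\<And>n U x. \<lbrakk>openin (Euclidean_space n) U; x \<in> points X\<rbrakk> \<Longrightarrow> (n, U, \<lambda>u\<in>U. x) \<in> plots X"
    and "\<And>n U p. \<lbrakk>(n, U, p) \<in> parametrisations (points X);
           \<forall>u\<in>U. \<exists>V. openin (Euclidean_space n) V \<and> u \<in> V \<and> V \<subseteq> U \<and>
                (n, V, restrict p V) \<in> plots X\<rbrakk> \<Longrightarrow> (n, U, p) \<in> plots X"
    and "\<And>n U p m V f. \<lbrakk>(n, U, p) \<in> plots X; openin (Euclidean_space m) V;
           smooth_map (euclidean_open m V) (euclidean_open n U) f\<rbrakk>
           \<Longrightarrow> (m, V, restrict (p \<circ> f) V) \<in> plots X"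
  shows "diffeology X"
  unfolding diffeology_def
proof (intro conjI allI ballI impI)
  show "case P of (n, U, p) \<Rightarrow>
          (\<forall>u\<in>U. \<exists>V. openin (Euclidean_space n) V \<and> u \<in> V \<and> V \<subseteq> U \<and>
              (n, V, restrict p V) \<in> plots X) \<longrightarrow> (n, U, p) \<in> plots X"
    if "P \<in> parametrisations (points X)" for P
    using assms(3) that by (cases P) simp
  show "case P of (n, U, p) \<Rightarrow> \<forall>m V f.
          openin (Euclidean_space m) V \<and> smooth_map (euclidean_open m V) (euclidean_open n U) f
          \<longrightarrow> (m, V, restrict (p \<circ> f) V) \<in> plots X"
    if "P \<in> plots X" for P
    using assms(4) that by (cases P) simp
qed (use assms(1,2) in simp_all)

lemma diffeology_constD:
  assumes "diffeology X" "openin (Euclidean_space n) U" "x \<in> points X"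
  shows "(n, U, \<lambda>u\<in>U. x) \<in> plots X"
  using assms(1)[unfolded diffeology_def, THEN conjunct2, THEN conjunct1] assms(2,3) by simp

lemma diffeology_compD:
  assumes "diffeology X" "(n, U, p) \<in> plots X" "openin (Euclidean_space m) V"
    "smooth_map (euclidean_open m V) (euclidean_open n U) f"
  shows "(m, V, restrict (p \<circ> f) V) \<in> plots X"
  using assms(1)[unfolded diffeology_def, THEN conjunct2, THEN conjunct2, THEN conjunct2,
      THEN bspec, OF assms(2)] assms(3,4)
  by simp

lemma diffeology_quotient_dspace:
  assumes X: "diffeology X"
  shows "diffeology (quotient_dspace X r)"
proof (rule diffeologyI)
  show "plots (quotient_dspace X r) \<subseteq> parametrisations (points (quotient_dspace X r))"
    by (auto simp: quotient_dspace_def)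
next
  fix n U x assume U: "openin (Euclidean_space n) U" and "x \<in> points (quotient_dspace X r)"
  then obtain y where y: "y \<in> points X" "x = r `` {y}"
    by (auto simp: quotient_dspace_def quotient_def)
  have "(n, U, \<lambda>u\<in>U. y) \<in> plots X"
    by (rule diffeology_constD[OF X U y(1)])
  then show "(n, U, \<lambda>u\<in>U. x) \<in> plots (quotient_dspace X r)"
    using U y by (auto simp: quotient_dspace_def parametrisations_def quotientI intro!: exI[of _ U] exI[of _ "\<lambda>u\<in>U. y"])
next
  fix n U p
  assume p: "(n, U, p) \<in> parametrisations (points (quotient_dspace X r))"
    and loc: "\<forall>u\<in>U. \<exists>V. openin (Euclidean_space n) V \<and> u \<in> V \<and> V \<subseteq> U \<and>
                (n, V, restrict p V) \<in> plots (quotient_dspace X r)"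
  have "\<exists>V q. openin (Euclidean_space n) V \<and> u \<in> V \<and> V \<subseteq> U \<and>
                 (n, V, q) \<in> plots X \<and> (\<forall>v\<in>V. p v = r `` {q v})" if u: "u \<in> U" for u
  proof -
    obtain V where V: "u \<in> V" "V \<subseteq> U" "(n, V, restrict p V) \<in> plots (quotient_dspace X r)"
      using loc u by blast
    then obtain W q where "openin (Euclidean_space n) W" "u \<in> W" "W \<subseteq> V" "(n, W, q) \<in> plots X"
      "\<forall>v\<in>W. restrict p V v = r `` {q v}"
      by (auto simp: quotient_dspace_def)
    then show ?thesis
      using V by (intro exI[of _ W] exI[of _ q]) (auto simp: subset_iff)
  qed
  then show "(n, U, p) \<in> plots (quotient_dspace X r)"
    using p by (auto simp: quotient_dspace_def)
next
  fix n U p m V f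
  assume p: "(n, U, p) \<in> plots (quotient_dspace X r)" and V: "openin (Euclidean_space m) V"
    and f: "smooth_map (euclidean_open m V) (euclidean_open n U) f"
  have cont: "continuous_map (subtopology (Euclidean_space m) V) (Euclidean_space n) f"
    and fV: "f ` V \<subseteq> U"
    using f V openin_subset[OF V]
    by (auto simp: smooth_map_def euclidean_open_def continuous_map_in_subtopology)
  have "\<exists>W q. openin (Euclidean_space m) W \<and> v \<in> W \<and> W \<subseteq> V \<and>
                 (m, W, q) \<in> plots X \<and> (\<forall>w\<in>W. (restrict (p \<circ> f) V) w = r `` {q w})" if v: "v \<in> V" for v
  proof -
    have "f v \<in> U" using fV v by auto
    then obtain W q where W: "openin (Euclidean_space n) W" "f v \<in> W" "W \<subseteq> U" "(n, W, q) \<in> plots X"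
      "\<forall>w\<in>W. p w = r `` {q w}"
      using p by (auto simp: quotient_dspace_def)
    let ?W = "{w \<in> V. f w \<in> W}"
    have "openin (subtopology (Euclidean_space m) V) {w \<in> topspace (subtopology (Euclidean_space m) V). f w \<in> W}"
      using cont W(1) openin_continuous_map_preimage by blast
    moreover have "{w \<in> topspace (subtopology (Euclidean_space m) V). f w \<in> W} = ?W"
      using openin_subset[OF V] by auto
    ultimately have oW: "openin (Euclidean_space m) ?W"
      using V openin_trans_full by fastforce
    have "smooth_map (euclidean_open m ?W) (euclidean_open n W) f"
      by (rule smooth_map_euclidean_open_restrict[OF f V oW]) (use W in auto)
    then have "(m, ?W, restrict (q \<circ> f) ?W) \<in> plots X"
      by (rule diffeology_compD[OF X W(4) oW])
    then show ?thesis
      using oW v W by (intro exI[of _ ?W] exI[of _ "restrict (q \<circ> f) ?W"]) auto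
  qed
  moreover have "restrict (p \<circ> f) V \<in> V \<rightarrow>\<^sub>E points X // r"
    using p fV by (auto simp: quotient_dspace_def parametrisations_def PiE_iff)
  ultimately show "(m, V, restrict (p \<circ> f) V) \<in> plots (quotient_dspace X r)"
    using V by (auto simp: quotient_dspace_def parametrisations_def)
qed

text \<open>The subset diffeology of the product diffeology.\<close>

definition product_subdspace :: "'x dspace \<Rightarrow> 'y dspace \<Rightarrow> ('x \<times> 'y) set \<Rightarrow> ('x \<times> 'y) dspace" where
  "product_subdspace X Y S =
     \<lparr>points = (points X \<times> points Y) \<inter> S,
      plots = {(n, U, p). (n, U, p) \<in> parametrisations ((points X \<times> points Y) \<inter> S) \<and>
                          (n, U, restrict (fst \<circ> p) U) \<in> plots X \<and>
                          (n, U, restrict (snd \<circ> p) U) \<in> plots Y}\<rparr>"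


section \<open>Differential forms\<close>

text \<open>
  A k-form on an open set U maps a point and a list of k tangent vectors to a number.
  Forms vanish on arguments that are not meaningful (point outside U, list of the wrong length,
  entries outside the Euclidean space); thus equality of forms is equality of functions, and the
  pointwise operations of \<^theory>\<open>HOL-Library.Function_Algebras\<close> are those of the vector space of
  forms.
\<close>

type_synonym eform = "vec \<Rightarrow> vec list \<Rightarrow> real"

definition alternating_multilinear :: "nat \<Rightarrow> nat \<Rightarrow> (vec list \<Rightarrow> real) \<Rightarrow> bool" where
  "alternating_multilinear k n \<eta> \<longleftrightarrow>
     (\<forall>vs. length vs = k \<and> set vs \<subseteq> topspace (Euclidean_space n) \<longrightarrow>
        (\<forall>i<k. \<forall>v\<in>topspace (Euclidean_space n). \<forall>w\<in>topspace (Euclidean_space n). \<forall>a b.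
           \<eta> (vs[i := (\<lambda>j. a * v j + b * w j)]) = a * \<eta> (vs[i := v]) + b * \<eta> (vs[i := w])) \<and>
        (\<forall>i j. i < j \<and> j < k \<and> vs ! i = vs ! j \<longrightarrow> \<eta> vs = 0))"

definition eforms :: "nat \<Rightarrow> nat \<Rightarrow> vec set \<Rightarrow> eform set" where
  "eforms k n U =
     {\<omega>. (\<forall>x vs. \<not> (x \<in> U \<and> length vs = k \<and> set vs \<subseteq> topspace (Euclidean_space n)) \<longrightarrow> \<omega> x vs = 0) \<and>
         (\<forall>x\<in>U. alternating_multilinear k n (\<omega> x)) \<and>
         (\<forall>vs. length vs = k \<and> set vs \<subseteq> topspace (Euclidean_space n) \<longrightarrow>
               smooth_fun n U (\<lambda>x. \<omega> x vs))}"

definition eform_pullback :: "nat \<Rightarrow> vec set \<Rightarrow> (vec \<Rightarrow> vec) \<Rightarrow> eform \<Rightarrow> eform" where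
  "eform_pullback m V f \<omega> =
     (\<lambda>y ws. if y \<in> V \<and> set ws \<subseteq> topspace (Euclidean_space m)
             then \<omega> (f y) (map (tangent_map m f y) ws) else 0)"

text \<open>The value on triples that are not plots is normalised to 0, for the same reason as above.\<close>

type_synonym 'x dform = "'x param \<Rightarrow> eform"

definition dforms :: "nat \<Rightarrow> 'x dspace \<Rightarrow> 'x dform set" where
  "dforms k X =
     {\<alpha>. (\<forall>P. P \<notin> plots X \<longrightarrow> \<alpha> P = 0) \<and>
         (\<forall>(n, U, p)\<in>plots X.
            \<alpha> (n, U, p) \<in> eforms k n U \<and>
            (\<forall>m V f. openin (Euclidean_space m) V \<and>
                     smooth_map (euclidean_open m V) (euclidean_open n U) f \<longrightarrow>
               \<alpha> (m, V, restrict (p \<circ> f) V) = eform_pullback m V f (\<alpha> (n, U, p))))}"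

definition dform_pullback :: "'x dspace \<Rightarrow> ('x \<Rightarrow> 'y) \<Rightarrow> 'y dform \<Rightarrow> 'x dform" where
  "dform_pullback X \<phi> \<beta> =
     (\<lambda>(n, U, p). if (n, U, p) \<in> plots X then \<beta> (n, U, restrict (\<phi> \<circ> p) U) else 0)"


section \<open>Lie groupoids\<close>

record ('o, 'm) groupoid =
  objs :: "'o mfd"
  arrs :: "'m mfd"
  src :: "'m \<Rightarrow> 'o"
  tgt :: "'m \<Rightarrow> 'o"
  gunit :: "'o \<Rightarrow> 'm"
  gmult :: "'m \<Rightarrow> 'm \<Rightarrow> 'm"
  ginv :: "'m \<Rightarrow> 'm"

abbreviation Obj :: "('o, 'm) groupoid \<Rightarrow> 'o set" where
  "Obj G \<equiv> topspace (mtop (objs G))"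

abbreviation Arr :: "('o, 'm) groupoid \<Rightarrow> 'm set" where
  "Arr G \<equiv> topspace (mtop (arrs G))"

text \<open>
  The product of g and h is defined when the source of g is the target of h.
  Since source and target are submersions, the set of composable pairs is an embedded submanifold
  of the product of the manifold of arrows with itself; its standard diffeology is the subset
  diffeology of the product diffeology, and a map between manifolds is smooth iff it is smooth for
  the standard diffeologies.  The smoothness of the multiplication is expressed in this way.
\<close>

locale lie_groupoid =
  fixes G :: "('o, 'm) groupoid"
  assumes manifold_objs: "manifold (objs G)"
    and manifold_arrs: "manifold (arrs G)"
    and submersion_src: "submersion (arrs G) (objs G) (src G)"
    and submersion_tgt: "submersion (arrs G) (objs G) (tgt G)"
    and smooth_unit: "smooth_map (objs G) (arrs G) (gunit G)"
    and smooth_inv: "smooth_map (arrs G) (arrs G) (ginv G)"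
    and smooth_mult:
      "dsmooth (product_subdspace (manifold_dspace (arrs G)) (manifold_dspace (arrs G))
                  {(g, h). src G g = tgt G h})
               (manifold_dspace (arrs G)) (\<lambda>(g, h). gmult G g h)"
    and src_unit: "x \<in> Obj G \<Longrightarrow> src G (gunit G x) = x"
    and tgt_unit: "x \<in> Obj G \<Longrightarrow> tgt G (gunit G x) = x"
    and src_mult: "\<lbrakk>g \<in> Arr G; h \<in> Arr G; src G g = tgt G h\<rbrakk> \<Longrightarrow> src G (gmult G g h) = src G h"
    and tgt_mult: "\<lbrakk>g \<in> Arr G; h \<in> Arr G; src G g = tgt G h\<rbrakk> \<Longrightarrow> tgt G (gmult G g h) = tgt G g"
    and mult_assoc:
      "\<lbrakk>g \<in> Arr G; h \<in> Arr G; k \<in> Arr G; src G g = tgt G h; src G h = tgt G k\<rbrakk>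
        \<Longrightarrow> gmult G (gmult G g h) k = gmult G g (gmult G h k)"
    and mult_unit_right: "g \<in> Arr G \<Longrightarrow> gmult G g (gunit G (src G g)) = g"
    and mult_unit_left: "g \<in> Arr G \<Longrightarrow> gmult G (gunit G (tgt G g)) g = g"
    and src_inv: "g \<in> Arr G \<Longrightarrow> src G (ginv G g) = tgt G g"
    and tgt_inv: "g \<in> Arr G \<Longrightarrow> tgt G (ginv G g) = src G g"
    and mult_inv_right: "g \<in> Arr G \<Longrightarrow> gmult G g (ginv G g) = gunit G (tgt G g)"
    and mult_inv_left: "g \<in> Arr G \<Longrightarrow> gmult G (ginv G g) g = gunit G (src G g)"

definition proper_groupoid :: "('o, 'm) groupoid \<Rightarrow> bool" where
  "proper_groupoid G \<longleftrightarrow>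
     proper_map (mtop (arrs G)) (prod_topology (mtop (objs G)) (mtop (objs G)))
       (\<lambda>g. (src G g, tgt G g))"

definition orbit_rel :: "('o, 'm) groupoid \<Rightarrow> ('o \<times> 'o) set" where
  "orbit_rel G = {(src G g, tgt G g) | g. g \<in> Arr G}"

definition orbit :: "('o, 'm) groupoid \<Rightarrow> 'o \<Rightarrow> 'o set" where
  "orbit G x = {tgt G g | g. g \<in> Arr G \<and> src G g = x}"

lemma orbit_eq_Image: "orbit G x = orbit_rel G `` {x}"
  by (auto simp: orbit_def orbit_rel_def)

lemma (in lie_groupoid) src_in: "g \<in> Arr G \<Longrightarrow> src G g \<in> Obj G"
  and tgt_in: "g \<in> Arr G \<Longrightarrow> tgt G g \<in> Obj G"
  using submersion_src submersion_tgt
  by (auto simp: submersion_def smooth_map_def continuous_map_def Pi_iff)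

lemma (in lie_groupoid) unit_in: "x \<in> Obj G \<Longrightarrow> gunit G x \<in> Arr G"
  and inv_in: "g \<in> Arr G \<Longrightarrow> ginv G g \<in> Arr G"
  using smooth_unit smooth_inv by (auto simp: smooth_map_def continuous_map_def Pi_iff)

lemma (in lie_groupoid) mult_in:
  "\<lbrakk>g \<in> Arr G; h \<in> Arr G; src G g = tgt G h\<rbrakk> \<Longrightarrow> gmult G g h \<in> Arr G"
  using smooth_mult
  by (auto simp: dsmooth_def product_subdspace_def manifold_dspace_def Pi_def split: prod.splits)

lemma (in lie_groupoid) equiv_orbit_rel: "equiv (Obj G) (orbit_rel G)"
proof (rule equivI)
  show "orbit_rel G \<subseteq> Obj G \<times> Obj G"
    by (auto simp: orbit_rel_def src_in tgt_in)
  show "refl_on (Obj G) (orbit_rel G)"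
    unfolding refl_on_def orbit_rel_def
    by (auto simp: src_in tgt_in) (metis src_unit tgt_unit unit_in)
  show "sym (orbit_rel G)"
    unfolding sym_def orbit_rel_def
    by clarsimp (metis src_inv tgt_inv inv_in)
  show "trans (orbit_rel G)"
  proof (rule transI)
    fix x y z assume "(x, y) \<in> orbit_rel G" "(y, z) \<in> orbit_rel G"
    then obtain g h where "g \<in> Arr G" "h \<in> Arr G" "x = src G g" "y = tgt G g" "y = src G h" "z = tgt G h"
      by (auto simp: orbit_rel_def)
    then show "(x, z) \<in> orbit_rel G"
      unfolding orbit_rel_def
      by clarsimp (metis src_mult tgt_mult mult_in)
  qed
qed

abbreviation obj_space :: "('o, 'm) groupoid \<Rightarrow> 'o dspace" where
  "obj_space G \<equiv> manifold_dspace (objs G)"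

abbreviation arr_space :: "('o, 'm) groupoid \<Rightarrow> 'm dspace" where
  "arr_space G \<equiv> manifold_dspace (arrs G)"

definition orbit_space :: "('o, 'm) groupoid \<Rightarrow> 'o set dspace" where
  "orbit_space G = quotient_dspace (obj_space G) (orbit_rel G)"

lemma points_orbit_space: "points (orbit_space G) = orbit G ` Obj G"
  by (auto simp: orbit_space_def quotient_dspace_def manifold_dspace_def quotient_def orbit_eq_Image)

end

theory Submission
  imports Defs
begin

text \<open>
  The difficulty is that a form whose pullbacks along source and target agree must have equal pullbacks
  along two plots q1, q2 that hit the same orbits, although no smooth family of arrows from q1 u to
  q2 u need exist.  It suffices to find, for a dense set of parameters u, one arrow g from q1 u to
  q2 u such that all vectors (dq1 v, dq2 v) lie in the image of d(s, t) at g.  If the p-th coordinate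
  vector fails to lift at (u, g), the Fredholm alternative gives a Lagrange multiplier: the function
  u_p, restricted to the solutions of (s, t)(g) = (q1 u, q2 u) with the other parameters fixed, is
  critical there.  By a Morse-Sard argument the bad parameters then have null slices in direction p.
  For bounded multipliers and arrows in a compact piece of a chart they form a compact set.  Properness
  makes finitely many such pieces suffice near a given parameter, so that Baire's theorem yields a good
  parameter.  Multiplication and inversion enter only in that orbits partition the objects.
\<close>

section \<open>Calculus in finitely many coordinates\<close>

text \<open>One arrow g decides the matter because a form on a manifold is a pointwise object: if
  vectors at g lift the given ones, the value along q1 is that of the source pullback on the lifts,
  hence that of the target pullback, hence the value along q2. A dense set of good parameters is
  enough because both values depend continuously on u. Multipliers are used since (s, t) need not
  have constant rank: its solution sets can be singular, so there is no manifold of solutions on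
  which to apply Sard's theorem, whereas a multiplier relation at a single point survives the
  substitution of a graph. Null slices serve only to exclude interior points, since an open set
  contains an interval in direction p. The multipliers admit no common bound, so the bad set is
  exhausted by countably many closed pieces, and excluding interior from each of them leaves Baire's
  theorem to treat the union.\<close>

text \<open>
  Coordinates are indexed by an arbitrary set, so that eliminating a coordinate by an implicit function
  needs no renumbering.
\<close>

definition coord_space :: "nat set \<Rightarrow> vec set" where
  "coord_space J = {x. \<forall>i. i \<notin> J \<longrightarrow> x i = 0}"

abbreviation open_in_coords :: "nat set \<Rightarrow> vec set \<Rightarrow> bool" where
  "open_in_coords J S \<equiv> openin (top_of_set (coord_space J)) S"

lemma coord_space_upd: "x \<in> coord_space J \<Longrightarrow> i \<in> J \<Longrightarrow> x(i := t) \<in> coord_space J"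
  by (auto simp: coord_space_def)

lemma continuous_on_coord [continuous_intros]: "continuous_on S (\<lambda>x::vec. x i)"
  by (rule continuous_on_subset[OF continuous_on_product_coordinates]) auto

lemma continuous_on_vecI:
  fixes G :: "'a::topological_space \<Rightarrow> vec"
  assumes "\<And>j. continuous_on S (\<lambda>x. G x j)" shows "continuous_on S G"
  using continuous_on_coordinatewise_then_product[of S G] assms by blast

lemma open_in_coords_box:
  assumes J: "finite J" and S: "open_in_coords J S" and a: "a \<in> S"
  obtains e where "e > 0" "\<And>y. y \<in> coord_space J \<Longrightarrow> (\<And>i. i \<in> J \<Longrightarrow> \<bar>y i - a i\<bar> < e) \<Longrightarrow> y \<in> S"
proof -
  obtain T where T: "open T" "S = coord_space J \<inter> T"
    using S by (auto simp: openin_open)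
  have "openin (product_topology (\<lambda>i. euclideanreal) UNIV) T"
    using T(1) by (simp add: euclidean_product_topology)
  then obtain X where X: "a \<in> Pi\<^sub>E UNIV X" "\<And>i. open (X i)" "Pi\<^sub>E UNIV X \<subseteq> T"
    using product_topology_open_contains_basis[of "\<lambda>i. euclideanreal" UNIV T a] a T by auto
  have "\<forall>i. \<exists>e>0. \<forall>t. \<bar>t - a i\<bar> < e \<longrightarrow> t \<in> X i"
  proof
    fix i
    have "a i \<in> X i" using X by (auto simp: PiE_iff)
    then show "\<exists>e>0. \<forall>t. \<bar>t - a i\<bar> < e \<longrightarrow> t \<in> X i"
      using X(2)[of i] by (auto simp: open_dist dist_real_def)
  qed
  then obtain e where e: "\<And>i. e i > 0" "\<And>i t. \<bar>t - a i\<bar> < e i \<Longrightarrow> t \<in> X i" by metis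
  \<comment> \<open>Only the coordinates in \<open>J\<close> constrain, those outside being 0 for
    both points; the extra 1 keeps the minimum defined for empty \<open>J\<close>.\<close>
  define d where "d = Min (insert 1 (e ` J))"
  have d: "d > 0" "\<And>i. i \<in> J \<Longrightarrow> d \<le> e i"
    using J e unfolding d_def by (auto simp: Min_gr_iff)
  show ?thesis
  proof (rule that[OF d(1)])
    fix y assume y: "y \<in> coord_space J" "\<And>i. i \<in> J \<Longrightarrow> \<bar>y i - a i\<bar> < d"
    have "y i \<in> X i" for i
    proof (cases "i \<in> J")
      case True then show ?thesis using y(2)[OF True] d(2)[OF True] by (intro e(2)) linarith
    next
      case False
      then have "y i = a i" using y a T by (auto simp: coord_space_def)
      then show ?thesis using e(1)[of i] by (intro e(2)) auto
    qed
    then have "y \<in> T" using X by (auto simp: PiE_iff)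
    then show "y \<in> S" using T y by auto
  qed
qed

lemma open_in_coords_cube:
  assumes "finite J" "finite K"
  shows "open_in_coords J {y \<in> coord_space J. \<forall>i\<in>K. \<bar>y i - a i\<bar> < e}"
proof -
  have "open {y::vec. \<bar>y i - a i\<bar> < e}" for i
    by (intro open_Collect_less continuous_intros)
  then have "open (\<Inter>i\<in>K. {y::vec. \<bar>y i - a i\<bar> < e})"
    using assms by blast
  moreover have "{y \<in> coord_space J. \<forall>i\<in>K. \<bar>y i - a i\<bar> < e} = coord_space J \<inter> (\<Inter>i\<in>K. {y::vec. \<bar>y i - a i\<bar> < e})"
    by auto
  ultimately show ?thesis by (auto simp: openin_open)
qed

lemma open_in_coords_subset: "open_in_coords J S \<Longrightarrow> S \<subseteq> coord_space J"
  by (auto dest: openin_imp_subset)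

lemma eventually_upd_in:
  assumes "open_in_coords J S" "x \<in> S" "i \<in> J"
  shows "eventually (\<lambda>t. x(i := t) \<in> S) (nhds (x i))"
proof -
  obtain T where T: "open T" "S = coord_space J \<inter> T"
    using assms by (auto simp: openin_open)
  have "continuous_on UNIV (\<lambda>t. x(i := t))"
  proof (rule continuous_on_vecI)
    show "continuous_on UNIV (\<lambda>t. (x(i := t)) j)" for j by (cases "j = i") auto
  qed
  then have "open ((\<lambda>t. x(i := t)) -` T)"
    using T(1) by (simp add: open_vimage)
  then show ?thesis
    unfolding eventually_nhds using assms T
    by (intro exI[of _ "(\<lambda>t. x(i := t)) -` T"]) (auto simp: coord_space_upd)
qed

text \<open>Derivatives are taken along one coordinate at a time, so no norm on \<open>vec\<close>
  is involved; total differentiability is recovered from the continuity of the partial derivatives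
  in \<open>strong_differentiability\<close>. The recursion peels off the innermost derivative, as
  induction on the order requires for products and composites.\<close>

primrec Ck :: "nat \<Rightarrow> nat set \<Rightarrow> vec set \<Rightarrow> (vec \<Rightarrow> real) \<Rightarrow> bool" where
  "Ck 0 J S f \<longleftrightarrow> continuous_on S f"
| "Ck (Suc k) J S f \<longleftrightarrow> continuous_on S f \<and>
     (\<forall>i\<in>J. (\<forall>x\<in>S. (\<lambda>t. f (x(i := t))) field_differentiable at (x i)) \<and> Ck k J S (partial i f))"

lemma Ck_continuous: "Ck k J S f \<Longrightarrow> continuous_on S f"
  by (cases k) auto

lemma Ck_Suc_imp: "Ck (Suc k) J S f \<Longrightarrow> Ck k J S f"
  by (induction k arbitrary: f) auto

lemma has_partial:
  assumes "Ck (Suc k) J S f" "i \<in> J" "x \<in> S"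
  shows "((\<lambda>t. f (x(i := t))) has_real_derivative partial i f x) (at (x i))"
  using assms unfolding partial_def by (auto simp: field_differentiable_derivI)

lemma partial_eqI: "((\<lambda>t. f (x(i := t))) has_real_derivative d) (at (x i)) \<Longrightarrow> partial i f x = d"
  unfolding partial_def by (rule DERIV_imp_deriv)

lemma partial_cong:
  assumes "open_in_coords J S" "\<And>x. x \<in> S \<Longrightarrow> f x = g x" "x \<in> S" "i \<in> J"
  shows "partial i f x = partial i g x"
proof -
  have "eventually (\<lambda>t. f (x(i := t)) = g (x(i := t))) (nhds (x i))"
    using eventually_upd_in[OF assms(1,3,4)] by (rule eventually_mono) (use assms(2) in auto)
  then show ?thesis by (simp add: partial_def deriv_cong_ev)
qed

lemma Ck_cong_imp:
  assumes S: "open_in_coords J S" and eq: "\<And>x. x \<in> S \<Longrightarrow> f x = g x" and f: "Ck k J S f"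
  shows "Ck k J S g"
  using eq f
proof (induction k arbitrary: f g)
  case 0
  then show ?case by (simp cong: continuous_on_cong)
next
  case (Suc k)
  show ?case unfolding Ck.simps
  proof (intro conjI ballI)
    show "continuous_on S g" using Suc.prems Ck_continuous by (metis continuous_on_cong)
    fix i assume i: "i \<in> J"
    show "Ck k J S (partial i g)"
    proof (rule Suc.IH[of "partial i f"])
      show "partial i f x = partial i g x" if "x \<in> S" for x
        by (rule partial_cong[OF S _ that i]) (use Suc.prems in simp)
    qed (use Suc.prems i in simp)
    fix x assume x: "x \<in> S"
    have "eventually (\<lambda>t. f (x(i := t)) = g (x(i := t))) (nhds (x i))"
      using eventually_upd_in[OF S x i] by (rule eventually_mono) (use Suc.prems in auto)
    from has_partial[OF Suc.prems(2) i x] DERIV_cong_ev[OF refl this refl]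
    show "(\<lambda>t. g (x(i := t))) field_differentiable at (x i)"
      unfolding field_differentiable_def by blast
  qed
qed

lemma Ck_cong:
  assumes "open_in_coords J S" "\<And>x. x \<in> S \<Longrightarrow> f x = g x"
  shows "Ck k J S f \<longleftrightarrow> Ck k J S g"
  using Ck_cong_imp[OF assms(1)] assms(2) by metis

lemma Ck_SucI:
  assumes "open_in_coords J S" "continuous_on S f"
    and "\<And>i x. i \<in> J \<Longrightarrow> x \<in> S \<Longrightarrow> ((\<lambda>t. f (x(i := t))) has_real_derivative g i x) (at (x i))"
    and "\<And>i. i \<in> J \<Longrightarrow> Ck k J S (g i)"
  shows "Ck (Suc k) J S f"
  unfolding Ck.simps
proof (intro conjI ballI assms(2))
  fix i assume i: "i \<in> J"
  show "Ck k J S (partial i f)"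
    by (rule Ck_cong_imp[OF assms(1) _ assms(4)[OF i]]) (use partial_eqI assms(3) i in metis)
  fix x assume x: "x \<in> S"
  show "(\<lambda>t. f (x(i := t))) field_differentiable at (x i)"
    using assms(3)[OF i x] by (auto simp: field_differentiable_def)
qed

section \<open>Mean value estimates and the chain rule\<close>

lemma mvt_real:
  fixes g :: "real \<Rightarrow> real"
  assumes "\<And>t. t \<in> closed_segment a b \<Longrightarrow> (g has_real_derivative g' t) (at t)"
    and "\<And>t. t \<in> closed_segment a b \<Longrightarrow> \<bar>g' t - c\<bar> \<le> e"
  shows "\<bar>g b - g a - c * (b - a)\<bar> \<le> e * \<bar>b - a\<bar>"
proof -
  have "norm ((g b - c * b) - (g a - c * a)) \<le> e * norm (b - a)"
  proof (rule field_differentiable_bound[of "closed_segment a b" _ "\<lambda>t. g' t - c"])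
    fix t assume t: "t \<in> closed_segment a b"
    have "((\<lambda>t. g t - c * t) has_real_derivative (g' t - c * 1)) (at t)"
      by (intro DERIV_diff assms(1)[OF t] DERIV_cmult DERIV_ident)
    then show "((\<lambda>t. g t - c * t) has_real_derivative (g' t - c)) (at t within closed_segment a b)"
      by (simp add: has_field_derivative_at_within)
    show "norm (g' t - c) \<le> e" using assms(2)[OF t] by simp
  qed auto
  then show ?thesis by (simp add: algebra_simps)
qed

text \<open>The path from \<open>x\<close> to \<open>y\<close> moves one coordinate at a time. Its
  points have all coordinates between those of \<open>x\<close> and \<open>y\<close>, so hypotheses
  on that box are enough, and the one-variable errors add up to the l1 distance.\<close>

lemma mvt_box:
  assumes "finite K" and "\<And>i. i \<notin> K \<Longrightarrow> y i = x i"
    and "\<And>i z. i \<in> K \<Longrightarrow> (\<And>j. z j \<in> closed_segment (x j) (y j)) \<Longrightarrow>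
           ((\<lambda>t. f (z(i := t))) has_real_derivative d i z) (at (z i)) \<and> \<bar>d i z - c i\<bar> \<le> e"
  shows "\<bar>f y - f x - (\<Sum>i\<in>K. c i * (y i - x i))\<bar> \<le> e * (\<Sum>i\<in>K. \<bar>y i - x i\<bar>)"
  using assms
proof (induction K arbitrary: y rule: finite_induct)
  case empty
  then have "y = x" by auto
  then show ?case by simp
next
  case (insert i K)
  let ?y = "y(i := x i)"
  have "\<bar>f ?y - f x - (\<Sum>j\<in>K. c j * (?y j - x j))\<bar> \<le> e * (\<Sum>j\<in>K. \<bar>?y j - x j\<bar>)"
  proof (rule insert.IH)
    show "?y j = x j" if "j \<notin> K" for j using insert.prems(1) that by auto
    fix j z assume jz: "j \<in> K" "\<And>l. z l \<in> closed_segment (x l) (?y l)"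
    have "z l \<in> closed_segment (x l) (y l)" for l
      using jz(2)[of l] by (cases "l = i") auto
    then show "((\<lambda>t. f (z(j := t))) has_real_derivative d j z) (at (z j)) \<and> \<bar>d j z - c j\<bar> \<le> e"
      using insert.prems(2)[of j z] jz(1) by blast
  qed
  moreover have "(\<Sum>j\<in>K. c j * (?y j - x j)) = (\<Sum>j\<in>K. c j * (y j - x j))"
    "(\<Sum>j\<in>K. \<bar>?y j - x j\<bar>) = (\<Sum>j\<in>K. \<bar>y j - x j\<bar>)"
    using insert.hyps by (auto intro!: sum.cong)
  moreover have "\<bar>f (y(i := y i)) - f (y(i := x i)) - c i * (y i - x i)\<bar> \<le> e * \<bar>y i - x i\<bar>"
  proof (rule mvt_real[where g' = "\<lambda>t. d i (y(i := t))"])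
    fix t assume t: "t \<in> closed_segment (x i) (y i)"
    have "((\<lambda>s. f ((y(i := t))(i := s))) has_real_derivative d i (y(i := t))) (at ((y(i := t)) i)) 
       \<and> \<bar>d i (y(i := t)) - c i\<bar> \<le> e"
      by (rule insert.prems(2)) (use t in auto)
    then show "((\<lambda>t. f (y(i := t))) has_real_derivative d i (y(i := t))) (at t)"
      "\<bar>d i (y(i := t)) - c i\<bar> \<le> e" by auto
  qed
  ultimately show ?case
    using insert.hyps by (simp add: algebra_simps)
qed

text \<open>On a small cube the partial derivatives stay within \<open>e\<close> of those at
  \<open>a\<close>, by continuity; \<open>mvt_box\<close> with the derivatives at \<open>a\<close>
  as slopes then gives the linear approximation, uniformly in both endpoints.\<close>

lemma strong_differentiability:
  assumes J: "finite J" and S: "open_in_coords J S" and f: "Ck (Suc k) J S f" and a: "a \<in> S" and e: "e > 0"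
  shows "\<exists>d>0. (\<forall>x\<in>coord_space J. (\<forall>i\<in>J. \<bar>x i - a i\<bar> < d) \<longrightarrow> x \<in> S) \<and>
    (\<forall>x\<in>coord_space J. \<forall>y\<in>coord_space J. (\<forall>i\<in>J. \<bar>x i - a i\<bar> < d) \<and> (\<forall>i\<in>J. \<bar>y i - a i\<bar> < d) \<longrightarrow>
       \<bar>f y - f x - (\<Sum>i\<in>J. partial i f a * (y i - x i))\<bar> \<le> e * (\<Sum>i\<in>J. \<bar>y i - x i\<bar>))"
proof -
  define S' where "S' = S \<inter> (\<Inter>i\<in>J. {x \<in> S. partial i f x \<in> ball (partial i f a) e})"
  have "open_in_coords J {x \<in> S. partial i f x \<in> ball (partial i f a) e}" if "i \<in> J" for i
  proof -
    have "continuous_on S (partial i f)" using f that by (auto dest: Ck_continuous)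
    then have "openin (top_of_set S) (S \<inter> partial i f -` ball (partial i f a) e)"
      by (rule continuous_openin_preimage_gen) auto
    then show ?thesis using S openin_trans by (auto simp: vimage_def Int_def)
  qed
  then have "open_in_coords J S'"
    unfolding S'_def using J S by (cases "J = {}") (auto intro!: openin_Int openin_INT)
  moreover have "a \<in> S'" using a e by (auto simp: S'_def)
  ultimately obtain d where d: "d > 0" 
    "\<And>y. y \<in> coord_space J \<Longrightarrow> (\<And>i. i \<in> J \<Longrightarrow> \<bar>y i - a i\<bar> < d) \<Longrightarrow> y \<in> S'"
    using open_in_coords_box[OF J] by blast
  show ?thesis
  proof (intro exI[of _ d] conjI ballI impI d(1))
    show "x \<in> S" if "x \<in> coord_space J" "\<forall>i\<in>J. \<bar>x i - a i\<bar> < d" for x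
      using d(2)[of x] that by (auto simp: S'_def)
    fix x y assume xy: "x \<in> coord_space J" "y \<in> coord_space J"
      "(\<forall>i\<in>J. \<bar>x i - a i\<bar> < d) \<and> (\<forall>i\<in>J. \<bar>y i - a i\<bar> < d)"
    show "\<bar>f y - f x - (\<Sum>i\<in>J. partial i f a * (y i - x i))\<bar> \<le> e * (\<Sum>i\<in>J. \<bar>y i - x i\<bar>)"
    proof (rule mvt_box[OF J, where d = "\<lambda>i. partial i f"])
      show "y i = x i" if "i \<notin> J" for i using xy(1,2) that by (auto simp: coord_space_def)
      fix i z assume i: "i \<in> J" and z: "\<And>j. z j \<in> closed_segment (x j) (y j)"
      have "z \<in> coord_space J"
        unfolding coord_space_def
      proof (intro CollectI allI impI)
        fix j assume "j \<notin> J" then show "z j = 0" using z[of j] xy(1,2) by (auto simp: coord_space_def)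
      qed
      moreover have "\<bar>z j - a j\<bar> < d" if "j \<in> J" for j
        using z[of j] bspec[OF conjunct1[OF xy(3)] that] bspec[OF conjunct2[OF xy(3)] that]
          by (auto simp: closed_segment_eq_real_ivl split: if_splits)
      ultimately have "z \<in> S'" by (rule d(2))
      then show "((\<lambda>t. f (z(i := t))) has_real_derivative partial i f z) (at (z i)) \<and>
           \<bar>partial i f z - partial i f a\<bar> \<le> e"
        using has_partial[OF f i, of z] i by (auto simp: S'_def dist_real_def)
    qed
  qed
qed

lemma chain_rule:
  fixes \<gamma> :: "real \<Rightarrow> vec"
  assumes J: "finite J" and T: "open_in_coords J T" and f: "Ck (Suc k) J T f"
    and g: "\<And>j. j \<in> J \<Longrightarrow> ((\<lambda>t. \<gamma> t j) has_real_derivative \<gamma>' j) (at t0)"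
    and in_T: "\<gamma> t0 \<in> T" and ev: "eventually (\<lambda>t. \<gamma> t \<in> coord_space J) (at t0)"
  shows "((\<lambda>t. f (\<gamma> t)) has_real_derivative (\<Sum>j\<in>J. partial j f (\<gamma> t0) * \<gamma>' j)) (at t0)"
proof -
  let ?a = "\<gamma> t0"
  let ?c = "\<lambda>j. partial j f ?a"
  define R where "R t = (f (\<gamma> t) - f ?a - (\<Sum>j\<in>J. ?c j * (\<gamma> t j - ?a j))) / (t - t0)" for t
  \<comment> \<open>\<open>B\<close> bounds the sum of the difference quotients of the components
    near \<open>t0\<close>, each of which is eventually below the absolute value of its limit plus
    1. The leading 1 makes \<open>B\<close> positive and the last estimate strict.\<close>
  define B where "B = 1 + (\<Sum>j\<in>J. \<bar>\<gamma>' j\<bar> + 1)"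
  have B: "B > 0" unfolding B_def by (intro add_pos_nonneg sum_nonneg) auto
  have q: "((\<lambda>t. (\<gamma> t j - ?a j) / (t - t0)) \<longlongrightarrow> \<gamma>' j) (at t0)" if "j \<in> J" for j
    using g[OF that] by (simp add: has_field_derivative_iff)
  have "(R \<longlongrightarrow> 0) (at t0)"
  proof (rule tendstoI)
    fix e :: real assume e: "e > 0"
    have eB: "e / B > 0" using e B by simp
    obtain d where d: "d > 0" 
      "\<forall>x\<in>coord_space J. \<forall>y\<in>coord_space J. (\<forall>i\<in>J. \<bar>x i - ?a i\<bar> < d) \<and> (\<forall>i\<in>J. \<bar>y i - ?a i\<bar> < d) \<longrightarrow>
         \<bar>f y - f x - (\<Sum>i\<in>J. ?c i * (y i - x i))\<bar> \<le> e / B * (\<Sum>i\<in>J. \<bar>y i - x i\<bar>)"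
      using strong_differentiability[OF J T f in_T eB] by blast
    have "eventually (\<lambda>t. \<bar>(\<gamma> t j - ?a j) / (t - t0)\<bar> < \<bar>\<gamma>' j\<bar> + 1) (at t0)" if "j \<in> J" for j
      using order_tendstoD(2)[OF tendsto_rabs[OF q[OF that]]] by simp
    then have 1: "eventually (\<lambda>t. \<forall>j\<in>J. \<bar>(\<gamma> t j - ?a j) / (t - t0)\<bar> < \<bar>\<gamma>' j\<bar> + 1) (at t0)"
      using J by (simp add: eventually_ball_finite)
    have "eventually (\<lambda>t. \<bar>\<gamma> t j - ?a j\<bar> < d) (at t0)" if "j \<in> J" for j
    proof -
      have "((\<lambda>t. \<gamma> t j) \<longlongrightarrow> ?a j) (at t0)"
        using DERIV_isCont[OF g[OF that]] by (simp add: isCont_def)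
      then show ?thesis using d(1) by (auto simp: tendsto_iff dist_real_def)
    qed
    then have 2: "eventually (\<lambda>t. \<forall>j\<in>J. \<bar>\<gamma> t j - ?a j\<bar> < d) (at t0)"
      using J by (simp add: eventually_ball_finite)
    have 3: "eventually (\<lambda>t. t \<noteq> t0) (at t0)" by (simp add: eventually_at_filter)
    from 1 2 3 ev show "eventually (\<lambda>t. dist (R t) 0 < e) (at t0)"
    proof eventually_elim
      case (elim t)
      have "?a \<in> coord_space J" using in_T T by (auto dest: open_in_coords_subset)
      then have "\<bar>f (\<gamma> t) - f ?a - (\<Sum>j\<in>J. ?c j * (\<gamma> t j - ?a j))\<bar> \<le> e / B * (\<Sum>j\<in>J. \<bar>\<gamma> t j - ?a j\<bar>)"
        using elim d by auto
      then have "\<bar>R t\<bar> \<le> e / B * (\<Sum>j\<in>J. \<bar>\<gamma> t j - ?a j\<bar>) / \<bar>t - t0\<bar>"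
        unfolding R_def abs_divide by (intro divide_right_mono) auto
      also have "\<dots> = e / B * (\<Sum>j\<in>J. \<bar>(\<gamma> t j - ?a j) / (t - t0)\<bar>)"
        by (simp only: abs_divide sum_divide_distrib[symmetric] times_divide_eq_right)
      also have "\<dots> \<le> e / B * (\<Sum>j\<in>J. \<bar>\<gamma>' j\<bar> + 1)"
        using e B elim by (intro mult_left_mono sum_mono) (auto intro: less_imp_le)
      also have "\<dots> < e / B * B"
        using e B by (intro mult_strict_left_mono) (auto simp: B_def)
      finally show ?case using B by simp
    qed
  qed
  then have "((\<lambda>t. R t + (\<Sum>j\<in>J. ?c j * ((\<gamma> t j - ?a j) / (t - t0)))) \<longlongrightarrow> 0 + (\<Sum>j\<in>J. ?c j * \<gamma>' j)) (at t0)"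
    by (intro tendsto_add tendsto_sum tendsto_mult tendsto_const q)
  moreover have "R t + (\<Sum>j\<in>J. ?c j * ((\<gamma> t j - ?a j) / (t - t0))) = (f (\<gamma> t) - f ?a) / (t - t0)" for t
    unfolding R_def by (simp add: sum_divide_distrib[symmetric] add_divide_distrib[symmetric])
  ultimately show ?thesis by (simp add: has_field_derivative_iff)
qed

section \<open>Algebra and composition of functions of class C^k\<close>

lemma Ck_partial: "Ck (Suc k) J S f \<Longrightarrow> i \<in> J \<Longrightarrow> Ck k J S (partial i f)"
  by simp

lemma Ck_const: "open_in_coords J S \<Longrightarrow> Ck k J S (\<lambda>x. c)"
proof (induction k arbitrary: c)
  case (Suc k)
  show ?case by (rule Ck_SucI[OF Suc.prems, where g = "\<lambda>i x. 0"]) (auto simp: Suc)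
qed simp

lemma Ck_coord:
  assumes "open_in_coords J S" shows "Ck k J S (\<lambda>x. x j)"
proof (cases k)
  case 0
  then show ?thesis by (simp add: continuous_on_coord)
next
  case (Suc l)
  show ?thesis unfolding Suc
  proof (rule Ck_SucI[OF assms continuous_on_coord, where g = "\<lambda>i x. if i = j then 1 else 0"])
    show "((\<lambda>t. (x(i := t)) j) has_real_derivative (if i = j then 1 else 0)) (at (x i))" for i x
      by (cases "i = j") auto
    show "Ck l J S (\<lambda>x. if i = j then 1 else 0)" for i by (rule Ck_const[OF assms])
  qed
qed

lemma Ck_add:
  assumes "open_in_coords J S" "Ck k J S f" "Ck k J S g" shows "Ck k J S (\<lambda>x. f x + g x)"
  using assms(2,3)
proof (induction k arbitrary: f g)
  case 0 then show ?case by (auto intro: continuous_intros)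
next
  case (Suc k)
  show ?case
  proof (rule Ck_SucI[OF assms(1), where g = "\<lambda>i x. partial i f x + partial i g x"])
    show "continuous_on S (\<lambda>x. f x + g x)"
      using Suc.prems by (auto intro: continuous_intros)
    show "((\<lambda>t. f (x(i := t)) + g (x(i := t))) has_real_derivative partial i f x + partial i g x) (at (x i))"
      if "i \<in> J" "x \<in> S" for i x
      by (intro DERIV_add has_partial[OF Suc.prems(1) that] has_partial[OF Suc.prems(2) that])
    show "Ck k J S (\<lambda>x. partial i f x + partial i g x)" if "i \<in> J" for i
      using Suc.IH Suc.prems that by auto
  qed
qed

lemma Ck_mult:
  assumes "open_in_coords J S" "Ck k J S f" "Ck k J S g" shows "Ck k J S (\<lambda>x. f x * g x)"
  using assms(2,3)
proof (induction k arbitrary: f g)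
  case 0 then show ?case by (auto intro: continuous_intros)
next
  case (Suc k)
  show ?case
  proof (rule Ck_SucI[OF assms(1), where g = "\<lambda>i x. partial i f x * g x + partial i g x * f x"])
    show "continuous_on S (\<lambda>x. f x * g x)"
      using Suc.prems by (auto intro: continuous_intros)
    show "((\<lambda>t. f (x(i := t)) * g (x(i := t))) has_real_derivative partial i f x * g x + partial i g x * f x) (at (x i))"
      if "i \<in> J" "x \<in> S" for i x
      by (rule DERIV_cong[OF DERIV_mult[OF has_partial[OF Suc.prems(1) that] has_partial[OF Suc.prems(2) that]]]) simp
    show "Ck k J S (\<lambda>x. partial i f x * g x + partial i g x * f x)" if "i \<in> J" for i
      using Suc.prems that Suc.prems[THEN Ck_Suc_imp] by (intro Ck_add[OF assms(1)] Suc.IH) auto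
  qed
qed

lemma Ck_sum:
  assumes "open_in_coords J S" "\<And>l. l \<in> L \<Longrightarrow> Ck k J S (f l)" shows "Ck k J S (\<lambda>x. \<Sum>l\<in>L. f l x)"
  using assms(2)
proof (induction L rule: infinite_finite_induct)
  case (insert l L)
  then show ?case by (simp add: Ck_add[OF assms(1)])
qed (simp_all add: Ck_const[OF assms(1)])

lemma Ck_minus:
  assumes "open_in_coords J S" "Ck k J S f" shows "Ck k J S (\<lambda>x. - f x)"
  using Ck_mult[OF assms(1) Ck_const[OF assms(1), of k "-1"] assms(2)] by simp

lemma Ck_diff:
  assumes "open_in_coords J S" "Ck k J S f" "Ck k J S g" shows "Ck k J S (\<lambda>x. f x - g x)"
  using Ck_add[OF assms(1,2) Ck_minus[OF assms(1,3)]] by simp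

lemma Ck_inverse:
  assumes "open_in_coords J S" "Ck k J S f" "\<And>x. x \<in> S \<Longrightarrow> f x \<noteq> 0"
  shows "Ck k J S (\<lambda>x. inverse (f x))"
  using assms(2)
proof (induction k)
  case 0 then show ?case using assms(3) by (auto intro: continuous_intros)
next
  case (Suc k)
  note inv = Suc.IH[OF Ck_Suc_imp[OF Suc.prems]]
  show ?case
  proof (rule Ck_SucI[OF assms(1), where g = "\<lambda>i x. - (inverse (f x) * partial i f x * inverse (f x))"])
    show "continuous_on S (\<lambda>x. inverse (f x))"
      using Suc.prems assms(3) by (auto intro: continuous_intros)
    show "((\<lambda>t. inverse (f (x(i := t)))) has_real_derivative - (inverse (f x) * partial i f x * inverse (f x))) (at (x i))"
      if "i \<in> J" "x \<in> S" for i x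
      by (rule DERIV_cong[OF DERIV_inverse'[OF has_partial[OF Suc.prems that]]]) (use assms(3)[OF that(2)] in auto)
    show "Ck k J S (\<lambda>x. - (inverse (f x) * partial i f x * inverse (f x)))" if "i \<in> J" for i
      using Suc.prems that by (intro Ck_minus[OF assms(1)] Ck_mult[OF assms(1)] inv) auto
  qed
qed

lemma Ck_divide:
  assumes "open_in_coords J S" "Ck k J S f" "Ck k J S g" "\<And>x. x \<in> S \<Longrightarrow> g x \<noteq> 0"
  shows "Ck k J S (\<lambda>x. f x / g x)"
  using Ck_mult[OF assms(1,2) Ck_inverse[OF assms(1,3,4)]] by (simp add: divide_inverse)

lemma has_partial_compose:
  fixes G :: "vec \<Rightarrow> vec"
  assumes J': "finite J'" and S: "open_in_coords J S" and T: "open_in_coords J' T"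
    and f: "Ck (Suc k) J' T f" and G: "\<And>j. j \<in> J' \<Longrightarrow> Ck (Suc l) J S (\<lambda>x. G x j)" and GS: "G ` S \<subseteq> T"
    and i: "i \<in> J" and x: "x \<in> S"
  shows "((\<lambda>t. f (G (x(i := t)))) has_real_derivative
           (\<Sum>j\<in>J'. partial j f (G x) * partial i (\<lambda>z. G z j) x)) (at (x i))"
proof -
  have "((\<lambda>t. f (G (x(i := t)))) has_real_derivative
           (\<Sum>j\<in>J'. partial j f (G (x(i := x i))) * partial i (\<lambda>z. G z j) x)) (at (x i))"
  proof (rule chain_rule[OF J' T f])
    show "((\<lambda>t. G (x(i := t)) j) has_real_derivative partial i (\<lambda>z. G z j) x) (at (x i))" if "j \<in> J'" for j
      by (rule has_partial[OF G[OF that] i x])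
    show "G (x(i := x i)) \<in> T" using GS x by auto
    have "eventually (\<lambda>t. x(i := t) \<in> S) (at (x i))"
      using eventually_upd_in[OF S x i] by (auto simp: eventually_nhds_conv_at)
    then show "eventually (\<lambda>t. G (x(i := t)) \<in> coord_space J') (at (x i))"
      by (rule eventually_mono) (use GS T open_in_coords_subset in blast)
  qed
  then show ?thesis by simp
qed

lemma continuous_on_from_coords:
  fixes G :: "vec \<Rightarrow> vec"
  assumes "\<And>j. j \<in> J' \<Longrightarrow> continuous_on S (\<lambda>x. G x j)" "G ` S \<subseteq> coord_space J'"
  shows "continuous_on S G"
proof (rule continuous_on_vecI)
  fix j
  show "continuous_on S (\<lambda>x. G x j)"
  proof (cases "j \<in> J'")
    case False
    have "G x j = 0" if "x \<in> S" for x
    proof -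
      have "G x \<in> coord_space J'" using assms(2) that by blast
      then show ?thesis using False by (simp add: coord_space_def)
    qed
    then show ?thesis by (simp cong: continuous_on_cong)
  qed (rule assms(1))
qed

lemma Ck_compose:
  fixes G :: "vec \<Rightarrow> vec"
  assumes J': "finite J'" and S: "open_in_coords J S" and T: "open_in_coords J' T"
    and f: "Ck k J' T f" and G: "\<And>j. j \<in> J' \<Longrightarrow> Ck k J S (\<lambda>x. G x j)" and GS: "G ` S \<subseteq> T"
  shows "Ck k J S (\<lambda>x. f (G x))"
  using f G
proof (induction k arbitrary: f)
  case 0
  have "continuous_on S G"
    using 0(2) GS open_in_coords_subset[OF T] by (intro continuous_on_from_coords[of J']) auto
  then show ?case using continuous_on_compose2[OF _ _ GS, of f] 0(1) by simp
next
  case (Suc k)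
  have cG: "continuous_on S G"
    using Suc.prems(2)[THEN Ck_continuous] GS open_in_coords_subset[OF T]
    by (intro continuous_on_from_coords[of J']) auto
  show ?case
  proof (rule Ck_SucI[OF S, where g = "\<lambda>i x. \<Sum>j\<in>J'. partial j f (G x) * partial i (\<lambda>z. G z j) x"])
    show "continuous_on S (\<lambda>x. f (G x))"
      using continuous_on_compose2[OF _ cG GS, of f] Suc.prems(1) by simp
    show "((\<lambda>t. f (G (x(i := t)))) has_real_derivative
           (\<Sum>j\<in>J'. partial j f (G x) * partial i (\<lambda>z. G z j) x)) (at (x i))" if "i \<in> J" "x \<in> S" for i x
      by (rule has_partial_compose[OF J' S T Suc.prems GS that])
    show "Ck k J S (\<lambda>x. \<Sum>j\<in>J'. partial j f (G x) * partial i (\<lambda>z. G z j) x)" if "i \<in> J" for i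
    proof (intro Ck_sum[OF S] Ck_mult[OF S])
      fix j assume j: "j \<in> J'"
      show "Ck k J S (partial i (\<lambda>z. G z j))"
        by (rule Ck_partial[OF Suc.prems(2)[OF j] \<open>i \<in> J\<close>])
      show "Ck k J S (\<lambda>x. partial j f (G x))"
        by (rule Suc.IH[OF Ck_partial[OF Suc.prems(1) j] Ck_Suc_imp[OF Suc.prems(2)]])
    qed
  qed
qed

definition smooth_on :: "nat set \<Rightarrow> vec set \<Rightarrow> (vec \<Rightarrow> real) \<Rightarrow> bool" where
  "smooth_on J S f \<longleftrightarrow> (\<forall>k. Ck k J S f)"

lemma smooth_on_partial: "smooth_on J S f \<Longrightarrow> i \<in> J \<Longrightarrow> smooth_on J S (partial i f)"
  unfolding smooth_on_def by (blast intro: Ck_partial)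

lemma Ck_subset:
  "Ck k J S f \<Longrightarrow> S' \<subseteq> S \<Longrightarrow> Ck k J S' f"
proof (induction k arbitrary: f)
  case (Suc k)
  then show ?case unfolding Ck.simps by (meson continuous_on_subset subsetD)
qed (auto intro: continuous_on_subset)

section \<open>The implicit function theorem for hypersurfaces\<close>

lemma open_in_coords_Collect:
  assumes S: "open_in_coords J S" and f: "continuous_on S f" and U: "open U"
  shows "open_in_coords J {x \<in> S. f x \<in> U}"
proof -
  have "openin (top_of_set S) (S \<inter> f -` U)"
    by (rule continuous_openin_preimage_gen[OF f U])
  moreover have "S \<inter> f -` U = {x \<in> S. f x \<in> U}" by auto
  ultimately show ?thesis using S openin_trans by metis
qed

text \<open>Near \<open>a\<close> the function \<open>w\<close> strictly increases in coordinate
  \<open>i\<close>, so within a small cube each slice contains exactly one zero, at height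
  \<open>\<phi> y\<close>; existence is the intermediate value theorem. The parameters keep the
  value 0 in slot \<open>i\<close>, which \<open>y(i := \<phi> y)\<close> fills. The conclusion
  records what the elimination of a coordinate needs: zeros of \<open>w\<close> near
  \<open>a\<close> lie on the graph, and the graph stays inside \<open>S\<close>.\<close>

lemma implicit_graph_pos:
  assumes J: "finite J" and S: "open_in_coords J S" and w: "smooth_on J S w" and a: "a \<in> S"
    and i: "i \<in> J" and wa: "w a = 0" and pos: "partial i w a > 0"
  shows "\<exists>T \<phi> W. open_in_coords (J - {i}) T \<and> smooth_on (J - {i}) T \<phi> \<and> (\<forall>y\<in>T. y(i := \<phi> y) \<in> S) \<and>
    open_in_coords J W \<and> a \<in> W \<and> (\<forall>x\<in>W. w x = 0 \<longrightarrow> x(i := 0) \<in> T \<and> \<phi> (x(i := 0)) = x i)"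
proof -
  have Ckw: "Ck k J S w" for k using w by (simp add: smooth_on_def)
  have cw: "continuous_on S w" using Ckw Ck_continuous by blast
  define S1 where "S1 = {x \<in> S. partial i w x \<in> {0<..}}"
  have S1: "open_in_coords J S1" unfolding S1_def
    by (intro open_in_coords_Collect[OF S] Ck_continuous[OF Ck_partial[OF Ckw i]] open_greaterThan)
  have S1S: "S1 \<subseteq> S" by (auto simp: S1_def)
  obtain e where e: "e > 0" "\<And>y. y \<in> coord_space J \<Longrightarrow> (\<And>j. j \<in> J \<Longrightarrow> \<bar>y j - a j\<bar> < e) \<Longrightarrow> y \<in> S1"
    using open_in_coords_box[OF J S1, of a] a pos by (auto simp: S1_def)
  have aJ: "a \<in> coord_space J" using a open_in_coords_subset[OF S] by auto
  define r where "r = e / 2"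
  have r: "0 < r" "r < e" using e(1) by (auto simp: r_def)
  have box: "y(i := t) \<in> S1"
    if "y \<in> coord_space (J - {i})" "\<And>j. j \<in> J - {i} \<Longrightarrow> \<bar>y j - a j\<bar> < e" "\<bar>t - a i\<bar> < e" for y t
    using that i by (intro e(2)) (auto simp: coord_space_def)
  have incr: "w (y(i := s)) < w (y(i := t))"
    if y: "y \<in> coord_space (J - {i})" "\<And>j. j \<in> J - {i} \<Longrightarrow> \<bar>y j - a j\<bar> < e"
      and st: "\<bar>s - a i\<bar> < e" "\<bar>t - a i\<bar> < e" "s < t" for y s t
  proof (rule DERIV_pos_imp_increasing[OF st(3)])
    fix x assume x: "s \<le> x" "x \<le> t"
    have z: "y(i := x) \<in> S1" by (rule box[OF y]) (use st x in auto)
    have "((\<lambda>t. w ((y(i := x))(i := t))) has_real_derivative partial i w (y(i := x))) (at ((y(i := x)) i))"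
      using z S1S by (intro has_partial[OF Ckw i]) auto
    then show "\<exists>d. ((\<lambda>x. w (y(i := x))) has_real_derivative d) (at x) \<and> 0 < d"
      using z by (auto simp: S1_def)
  qed
  have "a(i := 0) \<in> coord_space (J - {i})" using aJ by (auto simp: coord_space_def)
  then have "w ((a(i := 0))(i := a i - r)) < w ((a(i := 0))(i := a i))"
     "w ((a(i := 0))(i := a i)) < w ((a(i := 0))(i := a i + r))"
    by (rule incr; use r e(1) in simp)+
  then have lohi: "w (a(i := a i - r)) < 0" "0 < w (a(i := a i + r))" using wa by auto
  have mem: "a(i := a i - r) \<in> S" "a(i := a i + r) \<in> S"
    using aJ i r e(1) S1S by (auto intro!: subsetD[OF S1S] e(2) simp: coord_space_upd)
  have "open_in_coords J {x \<in> S. w x \<in> {..<0}}" "open_in_coords J {x \<in> S. w x \<in> {0<..}}"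
    by (rule open_in_coords_Collect[OF S cw]; simp)+
  then obtain d1 d2 where d1: "d1 > 0"
     "\<And>y. y \<in> coord_space J \<Longrightarrow> (\<And>j. j \<in> J \<Longrightarrow> \<bar>y j - (a(i := a i - r)) j\<bar> < d1) \<Longrightarrow> y \<in> {x \<in> S. w x \<in> {..<0}}"
   and d2: "d2 > 0"
     "\<And>y. y \<in> coord_space J \<Longrightarrow> (\<And>j. j \<in> J \<Longrightarrow> \<bar>y j - (a(i := a i + r)) j\<bar> < d2) \<Longrightarrow> y \<in> {x \<in> S. w x \<in> {0<..}}"
    using open_in_coords_box[OF J, of "{x \<in> S. w x \<in> {..<0}}" "a(i := a i - r)"]
      open_in_coords_box[OF J, of "{x \<in> S. w x \<in> {0<..}}" "a(i := a i + r)"] lohi mem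
    by (metis (no_types, lifting) greaterThan_iff lessThan_iff mem_Collect_eq)
  \<comment> \<open>\<open>d1\<close> and \<open>d2\<close> are the sizes of neighbourhoods of the
    lower and the upper end of the slice through \<open>a\<close> on which \<open>w\<close> keeps
    its sign, so over \<open>T\<close> every slice still changes sign.\<close>
  define d where "d = min e (min d1 d2)"
  have d: "d > 0" "d \<le> e" "d \<le> d1" "d \<le> d2" using e(1) d1(1) d2(1) by (auto simp: d_def)
  define T where "T = {y \<in> coord_space (J - {i}). \<forall>j\<in>J - {i}. \<bar>y j - a j\<bar> < d}"
  have T: "open_in_coords (J - {i}) T"
    unfolding T_def using J by (intro open_in_coords_cube) auto
  have Te: "y \<in> coord_space (J - {i})" "\<And>j. j \<in> J - {i} \<Longrightarrow> \<bar>y j - a j\<bar> < e" if "y \<in> T" for y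
    using that d unfolding T_def by (auto intro: less_le_trans)
  have ends: "w (y(i := a i - r)) < 0" "w (y(i := a i + r)) > 0" if "y \<in> T" for y
  proof -
    have "y(i := a i - r) \<in> {x \<in> S. w x \<in> {..<0}}"
      using that d i by (intro d1(2)) (auto simp: T_def coord_space_def intro: less_le_trans)
    moreover have "y(i := a i + r) \<in> {x \<in> S. w x \<in> {0<..}}"
      using that d i by (intro d2(2)) (auto simp: T_def coord_space_def intro: less_le_trans)
    ultimately show "w (y(i := a i - r)) < 0" "w (y(i := a i + r)) > 0" by auto
  qed
  have cslice: "continuous_on {a i - r..a i + r} (\<lambda>t. w (y(i := t)))" if "y \<in> T" for y
  proof (rule continuous_on_compose2[OF cw])
    show "continuous_on {a i - r..a i + r} (\<lambda>t. y(i := t))"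
    proof (rule continuous_on_vecI)
      show "continuous_on {a i - r..a i + r} (\<lambda>t. (y(i := t)) j)" for j by (cases "j = i") auto
    qed
    show "(\<lambda>t. y(i := t)) ` {a i - r..a i + r} \<subseteq> S"
      using r by (auto intro!: subsetD[OF S1S] box[OF Te[OF that]])
  qed
  have "\<exists>t. a i - r < t \<and> t < a i + r \<and> w (y(i := t)) = 0" if "y \<in> T" for y
  proof -
    note y = that
    obtain t where "a i - r \<le> t" "t \<le> a i + r" "w (y(i := t)) = 0"
      using IVT'[of "\<lambda>t. w (y(i := t))" "a i - r" 0 "a i + r"] cslice[OF y] ends[OF y] r by auto
    then show ?thesis using ends[OF that] by (intro exI[of _ t]) (auto simp: less_le)
  qed
  then obtain \<phi> where \<phi>: "\<And>y. y \<in> T \<Longrightarrow> a i - r < \<phi> y" "\<And>y. y \<in> T \<Longrightarrow> \<phi> y < a i + r"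
     "\<And>y. y \<in> T \<Longrightarrow> w (y(i := \<phi> y)) = 0" by metis
  have \<phi>e: "\<bar>\<phi> y - a i\<bar> < e" if "y \<in> T" for y using \<phi>(1,2)[OF that] r by linarith
  \<comment> \<open>Monotonicity along the slice turns comparisons with \<open>\<phi> y\<close> into
    signs of \<open>w\<close>, and thereby reduces continuity of \<open>\<phi>\<close> to continuity
    of \<open>w\<close> at a fixed height \<open>t\<close>.\<close>
  have less: "t < \<phi> y \<longleftrightarrow> w (y(i := t)) < 0" "\<phi> y < t \<longleftrightarrow> w (y(i := t)) > 0" "\<phi> y = t \<longleftrightarrow> w (y(i := t)) = 0"
    if y: "y \<in> T" and t: "\<bar>t - a i\<bar> < e" for y t
    using incr[OF Te[OF y] t \<phi>e[OF y]] incr[OF Te[OF y] \<phi>e[OF y] t] \<phi>(3)[OF y]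
    by (cases t "\<phi> y" rule: linorder_cases; auto)+
  have GS1: "y(i := \<phi> y) \<in> S1" if "y \<in> T" for y
    by (rule box[OF Te[OF that] \<phi>e[OF that]])
  have chslice: "continuous_on T (\<lambda>y. w (y(i := t)))" if "\<bar>t - a i\<bar> < e" for t
  proof (rule continuous_on_compose2[OF cw])
    show "continuous_on T (\<lambda>y. y(i := t))"
    proof (rule continuous_on_vecI)
      show "continuous_on T (\<lambda>y. (y(i := t)) j)" for j by (cases "j = i") (auto intro: continuous_intros)
    qed
    show "(\<lambda>y. y(i := t)) ` T \<subseteq> S"
    proof
      fix z assume "z \<in> (\<lambda>y. y(i := t)) ` T"
      then obtain y where "y \<in> T" "z = y(i := t)" by auto
      then show "z \<in> S" using box[OF Te[OF \<open>y \<in> T\<close>] that] S1S by auto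
    qed
  qed
  have c\<phi>: "continuous_on T \<phi>"
    unfolding continuous_on_def
  proof
    fix y assume y: "y \<in> T"
    have inT: "eventually (\<lambda>z. z \<in> T) (at y within T)" by (simp add: eventually_at_filter)
    show "(\<phi> \<longlongrightarrow> \<phi> y) (at y within T)"
    proof (rule order_tendstoI)
      fix t assume t: "t < \<phi> y"
      show "eventually (\<lambda>z. t < \<phi> z) (at y within T)"
      proof (cases "t \<le> a i - r")
        case True
        show ?thesis using inT by (rule eventually_mono) (use True \<phi>(1) in fastforce)
      next
        case False
        then have te: "\<bar>t - a i\<bar> < e" using t \<phi>(2)[OF y] r by linarith
        have "((\<lambda>z. w (z(i := t))) \<longlongrightarrow> w (y(i := t))) (at y within T)"
          using chslice[OF te] y by (simp add: continuous_on_def)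
        from order_tendstoD(2)[OF this, of 0] have "eventually (\<lambda>z. w (z(i := t)) < 0) (at y within T)"
          using less(1)[OF y te] t by simp
        with inT show ?thesis by eventually_elim (simp add: less(1)[OF _ te])
      qed
    next
      fix t assume t: "\<phi> y < t"
      show "eventually (\<lambda>z. \<phi> z < t) (at y within T)"
      proof (cases "t \<ge> a i + r")
        case True
        show ?thesis using inT by (rule eventually_mono) (use True \<phi>(2) in fastforce)
      next
        case False
        then have te: "\<bar>t - a i\<bar> < e" using t \<phi>(1)[OF y] r by linarith
        have "((\<lambda>z. w (z(i := t))) \<longlongrightarrow> w (y(i := t))) (at y within T)"
          using chslice[OF te] y by (simp add: continuous_on_def)
        from order_tendstoD(1)[OF this, of 0] have "eventually (\<lambda>z. w (z(i := t)) > 0) (at y within T)"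
          using less(2)[OF y te] t by simp
        with inT show ?thesis by eventually_elim (simp add: less(2)[OF _ te])
      qed
    qed
  qed
  define D where "D j y = - (partial j w (y(i := \<phi> y))) / partial i w (y(i := \<phi> y))" for j y
  have deriv: "((\<lambda>t. \<phi> (y(j := t))) has_real_derivative D j y) (at (y j))" if j: "j \<in> J - {i}" and y: "y \<in> T" for j y
  proof -
    let ?x = "y(i := \<phi> y)"
    let ?c = "partial i w ?x" and ?b = "partial j w ?x"
    have x: "?x \<in> S" using GS1[OF y] S1S by auto
    have c: "?c > 0" using GS1[OF y] by (simp add: S1_def)
    have evT: "eventually (\<lambda>t. y(j := t) \<in> T) (nhds (y j))"
      by (rule eventually_upd_in[OF T y j])
    have "continuous_on UNIV (\<lambda>t. y(j := t))"
    proof (rule continuous_on_vecI)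
      show "continuous_on UNIV (\<lambda>t. (y(j := t)) l)" for l by (cases "l = j") auto
    qed
    then have "((\<lambda>t. y(j := t)) \<longlongrightarrow> y(j := y j)) (at (y j))"
      unfolding continuous_on_def by blast
    then have "((\<lambda>t. y(j := t)) \<longlongrightarrow> y) (at (y j))" by simp
    then have lim: "((\<lambda>t. \<phi> (y(j := t))) \<longlongrightarrow> \<phi> y) (at (y j))"
      using evT y c\<phi> by (intro continuous_on_tendsto_compose[OF c\<phi>]) (auto simp: eventually_nhds_conv_at)
    show ?thesis unfolding has_field_derivative_iff
    proof (rule tendstoI)
      fix \<eta> :: real assume \<eta>: "\<eta> > 0"
      \<comment> \<open>With \<open>p\<close> and \<open>q\<close> the increments of the variable
        and of \<open>\<phi>\<close>, the linear approximation becomes |q + b/c p| \<le> \<epsilon>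
        (|q| + |p|). The bound 1/2 lets the |q| on the right be absorbed and yields |q| \<le>
        (2|b/c| + 1)|p|; the other bound then pushes the error below \<eta> |p|, with 3 in place of
        2 for strictness.\<close>
      define \<epsilon> where "\<epsilon> = min (1/2) (\<eta> / (2 * \<bar>?b / ?c\<bar> + 3))"
      have den: "2 * \<bar>?b / ?c\<bar> + 3 > 0" using abs_ge_zero[of "?b / ?c"] by linarith
      have \<epsilon>: "\<epsilon> > 0" "\<epsilon> \<le> 1/2" "\<epsilon> \<le> \<eta> / (2 * \<bar>?b / ?c\<bar> + 3)" 
        using \<eta> den unfolding \<epsilon>_def by (simp_all only: min_less_iff_conj min.cobounded1 min.cobounded2) simp
      have "\<epsilon> * ?c > 0" using \<epsilon> c by simp
      from strong_differentiability[OF J S Ckw x this] obtain \<delta> where \<delta>: "\<delta> > 0"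
        "\<forall>x\<in>coord_space J. \<forall>y\<in>coord_space J. (\<forall>l\<in>J. \<bar>x l - ?x l\<bar> < \<delta>) \<and> (\<forall>l\<in>J. \<bar>y l - ?x l\<bar> < \<delta>) \<longrightarrow>
          \<bar>w y - w x - (\<Sum>l\<in>J. partial l w ?x * (y l - x l))\<bar> \<le> \<epsilon> * ?c * (\<Sum>l\<in>J. \<bar>y l - x l\<bar>)"
        by blast
      have evT': "eventually (\<lambda>t. y(j := t) \<in> T) (at (y j))"
        using evT by (simp only: eventually_nhds_conv_at)
      have ev1: "eventually (\<lambda>t. t \<noteq> y j) (at (y j))" by (simp add: eventually_at_filter)
      have ev2: "eventually (\<lambda>t. \<bar>\<phi> (y(j := t)) - \<phi> y\<bar> < \<delta>) (at (y j))"
        using lim \<delta>(1) by (auto simp: tendsto_iff dist_real_def)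
      have ev3: "eventually (\<lambda>t. \<bar>t - y j\<bar> < \<delta>) (at (y j))"
        using \<delta>(1) by (auto simp: eventually_at dist_real_def)
      from evT' ev1 ev2 ev3 show "eventually (\<lambda>t. dist ((\<phi> (y(j := t)) - \<phi> (y(j := y j))) / (t - y j)) (D j y) < \<eta>) (at (y j))"
      proof eventually_elim
        case (elim t)
        let ?y = "(y(j := t))(i := \<phi> (y(j := t)))"
        define p where "p = t - y j"
        define q where "q = \<phi> (y(j := t)) - \<phi> y"
        have aux: "\<bar>q\<bar> \<le> m * \<bar>p\<bar> + 1/2 * (\<bar>q\<bar> + \<bar>p\<bar>) \<Longrightarrow> \<bar>q\<bar> \<le> (2 * m + 1) * \<bar>p\<bar>" for m
        proof -
          have half: "X \<le> Y + 1/2 * (X + Z) \<Longrightarrow> X \<le> 2 * Y + Z" for X Y Z :: real by argo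
          assume "\<bar>q\<bar> \<le> m * \<bar>p\<bar> + 1/2 * (\<bar>q\<bar> + \<bar>p\<bar>)"
          from half[OF this] show ?thesis by (simp only: distrib_right mult.assoc mult_1)
        qed
        have pn: "p \<noteq> 0" using elim by (simp add: p_def)
        have yJ: "?y \<in> coord_space J" using GS1[OF elim(1)] S1S open_in_coords_subset[OF S] by auto
        have xJ: "?x \<in> coord_space J" using x open_in_coords_subset[OF S] by auto
        have "\<bar>w ?y - w ?x - (\<Sum>l\<in>J. partial l w ?x * (?y l - ?x l))\<bar> \<le> \<epsilon> * ?c * (\<Sum>l\<in>J. \<bar>?y l - ?x l\<bar>)"
          using \<delta>(2)[rule_format, OF xJ yJ] \<delta>(1) elim by auto
        moreover have "(\<Sum>l\<in>J. partial l w ?x * (?y l - ?x l)) = (\<Sum>l\<in>{i, j}. partial l w ?x * (?y l - ?x l))"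
          using i j J by (intro sum.mono_neutral_right) auto
        moreover have "(\<Sum>l\<in>J. \<bar>?y l - ?x l\<bar>) = (\<Sum>l\<in>{i, j}. \<bar>?y l - ?x l\<bar>)"
          using i j J by (intro sum.mono_neutral_right) auto
        ultimately have "\<bar>?c * q + ?b * p\<bar> \<le> \<epsilon> * ?c * (\<bar>q\<bar> + \<bar>p\<bar>)"
          using j \<phi>(3)[OF y] \<phi>(3)[OF elim(1)] by (simp add: p_def q_def)
        moreover have "?c * q + ?b * p = ?c * (q + ?b / ?c * p)" using c by (simp add: field_simps)
        ultimately have "?c * \<bar>q + ?b / ?c * p\<bar> \<le> ?c * (\<epsilon> * (\<bar>q\<bar> + \<bar>p\<bar>))"
          using c by (simp add: abs_mult mult_ac)
        then have 1: "\<bar>q + ?b / ?c * p\<bar> \<le> \<epsilon> * (\<bar>q\<bar> + \<bar>p\<bar>)" using c by simp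
        also have "\<dots> \<le> 1/2 * (\<bar>q\<bar> + \<bar>p\<bar>)" using \<epsilon> by (intro mult_right_mono) auto
        finally have "\<bar>q\<bar> \<le> \<bar>?b / ?c * p\<bar> + 1/2 * (\<bar>q\<bar> + \<bar>p\<bar>)" by linarith
        then have "\<bar>q\<bar> \<le> (2 * \<bar>?b / ?c\<bar> + 1) * \<bar>p\<bar>"
          using aux[of "\<bar>?b / ?c\<bar>"] by (simp only: abs_mult)
        then have "\<epsilon> * (\<bar>q\<bar> + \<bar>p\<bar>) \<le> \<epsilon> * ((2 * \<bar>?b / ?c\<bar> + 2) * \<bar>p\<bar>)"
          using \<epsilon> by (intro mult_left_mono) (auto simp: algebra_simps)
        also have "\<dots> < \<epsilon> * ((2 * \<bar>?b / ?c\<bar> + 3) * \<bar>p\<bar>)"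
          using \<epsilon> pn by (intro mult_strict_left_mono mult_strict_right_mono) auto
        also have "\<dots> \<le> \<eta> / (2 * \<bar>?b / ?c\<bar> + 3) * ((2 * \<bar>?b / ?c\<bar> + 3) * \<bar>p\<bar>)"
          using \<epsilon> den by (intro mult_right_mono) auto
        also have "\<dots> = \<eta> * \<bar>p\<bar>" using den by simp
        finally have "\<bar>q + ?b / ?c * p\<bar> < \<eta> * \<bar>p\<bar>" using 1 by linarith
        moreover have "q + ?b / ?c * p = (q / p + ?b / ?c) * p" using pn by (simp add: field_simps)
        ultimately have "\<bar>q / p + ?b / ?c\<bar> < \<eta>" using pn by (simp add: abs_mult)
        then show ?case by (simp add: p_def q_def D_def dist_real_def)
      qed
    qed
  qed
  \<comment> \<open>Bootstrapping: \<open>D j\<close> is a quotient of derivatives of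
    \<open>w\<close> composed with the graph map, so it inherits the class of \<open>\<phi>\<close>,
    and \<open>\<phi>\<close> gains one order.\<close>
  have "Ck k (J - {i}) T \<phi>" for k
  proof (induction k)
    case (Suc k)
    show ?case
    proof (rule Ck_SucI[OF T c\<phi> deriv])
      fix j assume j: "j \<in> J - {i}"
      have comp: "Ck k (J - {i}) T (\<lambda>y. partial l w (y(i := \<phi> y)))" if l: "l \<in> J" for l
      proof (rule Ck_compose[OF J T S1, where G = "\<lambda>y. y(i := \<phi> y)"])
        show "Ck k J S1 (partial l w)" by (rule Ck_subset[OF Ck_partial[OF Ckw l] S1S])
        show "Ck k (J - {i}) T (\<lambda>x. (x(i := \<phi> x)) m)" for m
          using Suc Ck_coord[OF T] by (cases "m = i") auto
        show "(\<lambda>y. y(i := \<phi> y)) ` T \<subseteq> S1" using GS1 by auto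
      qed
      have "partial i w (y(i := \<phi> y)) \<noteq> 0" if "y \<in> T" for y
        using GS1[OF that] by (simp add: S1_def)
      then show "Ck k (J - {i}) T (D j)"
        unfolding D_def using j i by (intro Ck_divide[OF T] Ck_minus[OF T] comp) auto
    qed auto
  qed (simp add: c\<phi>)
  then have sm: "smooth_on (J - {i}) T \<phi>" by (simp add: smooth_on_def)
  define W where "W = {x \<in> coord_space J. \<forall>j\<in>J. \<bar>x j - a j\<bar> < d}"
  have W: "open_in_coords J W" unfolding W_def by (rule open_in_coords_cube[OF J J])
  have "x(i := 0) \<in> T \<and> \<phi> (x(i := 0)) = x i" if x: "x \<in> W" "w x = 0" for x
  proof -
    have xT: "x(i := 0) \<in> T" using x(1) by (auto simp: W_def T_def coord_space_def)
    have "\<bar>x i - a i\<bar> < e" using x(1) i d(2) by (auto simp: W_def)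
    from less(3)[OF xT this] x(2) xT show ?thesis by simp
  qed
  moreover have "a \<in> W" using aJ d by (simp add: W_def)
  ultimately show ?thesis using T sm GS1 S1S W by blast
qed

lemma implicit_graph:
  assumes J: "finite J" and S: "open_in_coords J S" and w: "smooth_on J S w" and a: "a \<in> S"
    and i: "i \<in> J" and wa: "w a = 0" and nz: "partial i w a \<noteq> 0"
  shows "\<exists>T \<phi> W. open_in_coords (J - {i}) T \<and> smooth_on (J - {i}) T \<phi> \<and> (\<forall>y\<in>T. y(i := \<phi> y) \<in> S) \<and>
    open_in_coords J W \<and> a \<in> W \<and> (\<forall>x\<in>W. w x = 0 \<longrightarrow> x(i := 0) \<in> T \<and> \<phi> (x(i := 0)) = x i)"
proof (cases "partial i w a > 0")
  case True
  then show ?thesis using implicit_graph_pos[OF J S w a i wa] by blast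
next
  case False
  have "smooth_on J S (\<lambda>x. - w x)" using w by (auto simp: smooth_on_def intro: Ck_minus[OF S])
  moreover have "partial i (\<lambda>x. - w x) a = - partial i w a"
    using w has_partial[of 0 J S w i a] i a unfolding smooth_on_def by (intro partial_eqI DERIV_minus) auto
  ultimately show ?thesis using implicit_graph_pos[OF J S _ a i, of "\<lambda>x. - w x"] False nz wa by auto
qed

section \<open>A Morse-Sard theorem with Lagrange multipliers\<close>

lemma smooth_on_foldr_partial:
  "smooth_on J S f \<Longrightarrow> set is \<subseteq> J \<Longrightarrow> smooth_on J S (foldr partial is f)"
  by (induction "is") (auto intro: smooth_on_partial)

text \<open>Two cubes are involved: the one about \<open>a\<close> keeps the path inside
  \<open>S\<close>, while the derivative bound is asked only within distance \<open>r\<close> of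
  \<open>x\<close>. This is the inductive step for \<open>flat_bound\<close>, where the bound on the
  derivatives itself shrinks with \<open>r\<close>.\<close>

lemma box_mvt_bound:
  fixes f :: "vec \<Rightarrow> real" and r e :: real
  assumes J: "finite J" and f: "Ck (Suc k) J S f"
    and Q: "\<And>y. \<lbrakk>y \<in> coord_space J; \<And>i. i \<in> J \<Longrightarrow> \<bar>y i - a i\<bar> < d\<rbrakk> \<Longrightarrow> y \<in> S"
    and x: "x \<in> coord_space J" "\<And>i. i \<in> J \<Longrightarrow> \<bar>x i - a i\<bar> < d"
    and y: "y \<in> coord_space J" "\<And>i. i \<in> J \<Longrightarrow> \<bar>y i - a i\<bar> < d"
    and xy: "\<And>i. i \<in> J \<Longrightarrow> \<bar>y i - x i\<bar> \<le> r" and e: "e \<ge> 0"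
    and bd: "\<And>i z. \<lbrakk>i \<in> J; z \<in> coord_space J; \<And>j. j \<in> J \<Longrightarrow> \<bar>z j - a j\<bar> < d;
        \<And>j. j \<in> J \<Longrightarrow> \<bar>z j - x j\<bar> \<le> r\<rbrakk> \<Longrightarrow> \<bar>partial i f z\<bar> \<le> e"
  shows "\<bar>f y - f x\<bar> \<le> e * (card J * r)"
proof -
  have "\<bar>f y - f x - (\<Sum>i\<in>J. 0 * (y i - x i))\<bar> \<le> e * (\<Sum>i\<in>J. \<bar>y i - x i\<bar>)"
  proof (rule mvt_box[OF J, where d = "\<lambda>i. partial i f"])
    show "y i = x i" if "i \<notin> J" for i using x(1) y(1) that by (auto simp: coord_space_def)
    fix i z assume i: "i \<in> J" and z: "\<And>j. z j \<in> closed_segment (x j) (y j)"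
    have zJ: "z \<in> coord_space J"
      unfolding coord_space_def
    proof (intro CollectI allI impI)
      fix j assume "j \<notin> J" then show "z j = 0" using z[of j] x(1) y(1) by (auto simp: coord_space_def)
    qed
    have za: "\<bar>z j - a j\<bar> < d" if "j \<in> J" for j
      using z[of j] x(2)[OF that] y(2)[OF that] by (auto simp: closed_segment_eq_real_ivl split: if_splits)
    have zx: "\<bar>z j - x j\<bar> \<le> r" if "j \<in> J" for j
      using z[of j] xy[OF that] by (auto simp: closed_segment_eq_real_ivl split: if_splits)
    show "((\<lambda>t. f (z(i := t))) has_real_derivative partial i f z) (at (z i)) \<and> \<bar>partial i f z - 0\<bar> \<le> e"
      using has_partial[OF f i Q[OF zJ za]] bd[OF i zJ za zx] by simp
  qed
  also have "\<dots> \<le> e * (\<Sum>i\<in>J. r)" using e xy by (intro mult_left_mono sum_mono) auto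
  finally show ?thesis by simp
qed

text \<open>A Taylor estimate without Taylor's formula: the induction hypothesis for
  \<open>partial i f\<close> bounds the partial derivatives near \<open>x\<close> by a power of
  \<open>card J * r\<close>, and the mean value estimate supplies one more factor.\<close>

lemma flat_bound:
  fixes f :: "vec \<Rightarrow> real" and r :: real
  assumes J: "finite J" and f: "smooth_on J S f"
    and Q: "\<And>y. \<lbrakk>y \<in> coord_space J; \<And>i. i \<in> J \<Longrightarrow> \<bar>y i - a i\<bar> < d\<rbrakk> \<Longrightarrow> y \<in> S"
    and bd: "\<And>is y. \<lbrakk>set is \<subseteq> J; length is = Suc k; y \<in> coord_space J; \<And>i. i \<in> J \<Longrightarrow> \<bar>y i - a i\<bar> < d\<rbrakk>
       \<Longrightarrow> \<bar>foldr partial is f y\<bar> \<le> 1"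
    and x: "x \<in> coord_space J" "\<And>i. i \<in> J \<Longrightarrow> \<bar>x i - a i\<bar> < d"
    and van: "\<And>is. \<lbrakk>set is \<subseteq> J; is \<noteq> []; length is \<le> k\<rbrakk> \<Longrightarrow> foldr partial is f x = 0"
    and y: "y \<in> coord_space J" "\<And>i. i \<in> J \<Longrightarrow> \<bar>y i - a i\<bar> < d"
    and xy: "\<And>i. i \<in> J \<Longrightarrow> \<bar>y i - x i\<bar> \<le> r" and r: "r \<ge> 0"
  shows "\<bar>f y - f x\<bar> \<le> (card J * r) ^ Suc k"
  using f bd van y xy
proof (induction k arbitrary: f y)
  case (0 f y)
  have f: "Ck (Suc 0) J S f" using 0(1) by (auto simp: smooth_on_def)
  have "\<bar>f y - f x\<bar> \<le> 1 * (card J * r)"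
  proof (rule box_mvt_bound[OF J f Q x 0(4,5,6)])
    show "\<bar>partial i f z\<bar> \<le> 1" if "i \<in> J" "z \<in> coord_space J" "\<And>j. j \<in> J \<Longrightarrow> \<bar>z j - a j\<bar> < d" for i z
      using 0(2)[of "[i]" z] that by simp
  qed auto
  then show ?case by simp
next
  case (Suc k f y)
  have f: "Ck (Suc 0) J S f" using Suc(2) by (auto simp: smooth_on_def)
  \<comment> \<open>\<open>foldr\<close> applies the last index first, so an iterated derivative of
    \<open>partial i f\<close> is one of \<open>f\<close> with \<open>i\<close> appended at the end
    of the list.\<close>
  have app: "foldr partial (is @ [i]) f = foldr partial is (partial i f)" for "is" i by simp
  have "\<bar>f y - f x\<bar> \<le> (card J * r) ^ Suc k * (card J * r)"
  proof (rule box_mvt_bound[OF J f Q x Suc(5,6,7)])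
    fix i z assume i: "i \<in> J" and z: "z \<in> coord_space J" "\<And>j. j \<in> J \<Longrightarrow> \<bar>z j - a j\<bar> < d"
      "\<And>j. j \<in> J \<Longrightarrow> \<bar>z j - x j\<bar> \<le> r"
    have "\<bar>partial i f z - partial i f x\<bar> \<le> (card J * r) ^ Suc k"
    proof (rule Suc.IH[OF smooth_on_partial[OF Suc(2) i] _ _ z])
      show "\<bar>foldr partial is (partial i f) y\<bar> \<le> 1"
        if "set is \<subseteq> J" "length is = Suc k" "y \<in> coord_space J" "\<And>i. i \<in> J \<Longrightarrow> \<bar>y i - a i\<bar> < d" for "is" y
        using Suc(3)[of "is @ [i]" y] that i unfolding app by simp
      show "foldr partial is (partial i f) x = 0" if "set is \<subseteq> J" "length is \<le> k" for "is"
        using Suc(4)[of "is @ [i]"] that i unfolding app by simp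
    qed
    moreover have "partial i f x = 0" using Suc(4)[of "[i]"] i by simp
    ultimately show "\<bar>partial i f z\<bar> \<le> (card J * r) ^ Suc k" by simp
  qed (use r in auto)
  then show ?case by (simp add: mult_ac)
qed

text \<open>By the Lindelof property countably many of the given neighbourhoods cover
  \<open>A\<close>.\<close>

lemma negligible_image_locally:
  fixes f :: "vec \<Rightarrow> real"
  assumes A: "A \<subseteq> coord_space J"
    and loc: "\<And>a. a \<in> A \<Longrightarrow> \<exists>W. open_in_coords J W \<and> a \<in> W \<and> negligible (f ` (A \<inter> W))"
  shows "negligible (f ` A)"
proof -
  define F where "F = {W. open_in_coords J W \<and> negligible (f ` (A \<inter> W))}"
  obtain F' where F': "F' \<subseteq> F" "countable F'" "\<Union>F' = \<Union>F"
    by (rule Lindelof_openin[of F "coord_space J"]) (auto simp: F_def)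
  have "negligible (\<Union>W\<in>F'. f ` (A \<inter> W))"
    using F' by (intro negligible_countable_Union) (auto simp: F_def)
  moreover have "f ` A \<subseteq> (\<Union>W\<in>F'. f ` (A \<inter> W))"
  proof
    fix t assume "t \<in> f ` A"
    then obtain a where a: "a \<in> A" "t = f a" by auto
    then obtain W where "W \<in> F" "a \<in> W" using loc by (auto simp: F_def)
    then have "a \<in> \<Union>F'" using F' by auto
    then show "t \<in> (\<Union>W\<in>F'. f ` (A \<inter> W))" using a by auto
  qed
  ultimately show ?thesis by (rule negligible_subset)
qed

text \<open>The case of Sard's theorem in which counting cubes is enough. With
  \<open>p = card J\<close>, flatness to order \<open>p\<close> confines the image of the points of
  \<open>B\<close> in a cube of side \<delta> to an interval of length O(\<delta>^(p+1)), while only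
  O(\<delta>^(-p)) cubes are needed. Smoothness of every order makes this available for any number
  of coordinates.\<close>

lemma negligible_flat_image:
  assumes J: "finite J" and S: "open_in_coords J S" and f: "smooth_on J S f" and B: "B \<subseteq> S"
    and flat: "\<And>x is. \<lbrakk>x \<in> B; set is \<subseteq> J; is \<noteq> []\<rbrakk> \<Longrightarrow> foldr partial is f x = 0"
  shows "negligible (f ` B)"
proof (rule negligible_image_locally)
  show "B \<subseteq> coord_space J" using B open_in_coords_subset[OF S] by auto
  fix a assume a: "a \<in> B"
  define p where "p = card J"
  \<comment> \<open>The derivatives of order \<open>p + 1\<close> vanish at \<open>a\<close>, hence
    are at most 1 in absolute value nearby; this is the bound that \<open>flat_bound\<close> asks
    for.\<close>
  define I where "I = {is. set is \<subseteq> J \<and> length is = Suc p}"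
  have finI: "finite I" unfolding I_def using J by (rule finite_lists_length_eq)
  define S' where "S' = S \<inter> (\<Inter>is\<in>I. {x \<in> S. foldr partial is f x \<in> {-1<..<1}})"
  have "open_in_coords J {x \<in> S. foldr partial is f x \<in> {-1<..<1}}" if "is \<in> I" for "is"
  proof (rule open_in_coords_Collect[OF S])
    have "smooth_on J S (foldr partial is f)"
      using that by (intro smooth_on_foldr_partial f) (auto simp: I_def)
    then show "continuous_on S (foldr partial is f)" unfolding smooth_on_def using Ck_continuous by blast
  qed auto
  then have "open_in_coords J S'"
    unfolding S'_def using finI S by (cases "I = {}") (auto intro!: openin_Int openin_INT)
  moreover have "foldr partial is f a = 0" if "is \<in> I" for "is"
    using that a by (intro flat) (auto simp: I_def)
  then have "a \<in> S'" using a B by (auto simp: S'_def)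
  ultimately obtain d where d: "d > 0"
    "\<And>y. y \<in> coord_space J \<Longrightarrow> (\<And>i. i \<in> J \<Longrightarrow> \<bar>y i - a i\<bar> < d) \<Longrightarrow> y \<in> S'"
    using open_in_coords_box[OF J] by blast
  define W where "W = {y \<in> coord_space J. \<forall>i\<in>J. \<bar>y i - a i\<bar> < d}"
  have W: "open_in_coords J W" unfolding W_def by (rule open_in_coords_cube[OF J J])
  have WJ: "y \<in> coord_space J" "\<And>i. i \<in> J \<Longrightarrow> \<bar>y i - a i\<bar> < d" if "y \<in> W" for y
    using that by (auto simp: W_def)
  have bound: "\<bar>f y - f x\<bar> \<le> (p * r) ^ Suc p"
    if x: "x \<in> B \<inter> W" and y: "y \<in> W" and xy: "\<And>i. i \<in> J \<Longrightarrow> \<bar>y i - x i\<bar> \<le> r" and r: "r \<ge> 0" for x y and r :: real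
    unfolding p_def
  proof (rule flat_bound[OF J f _ _ _ _ _ WJ[OF y] xy r])
    show "z \<in> S" if "z \<in> coord_space J" "\<And>i. i \<in> J \<Longrightarrow> \<bar>z i - a i\<bar> < d" for z
      using d(2)[OF that] by (auto simp: S'_def)
    show "\<bar>foldr partial is f z\<bar> \<le> 1"
      if "set is \<subseteq> J" "length is = Suc (card J)" "z \<in> coord_space J" "\<And>i. i \<in> J \<Longrightarrow> \<bar>z i - a i\<bar> < d" for "is" z
    proof -
      have "is \<in> I" using that by (simp add: I_def p_def)
      moreover have "z \<in> S'" by (rule d(2)[OF that(3,4)])
      ultimately show ?thesis by (auto simp: S'_def)
    qed
    show "x \<in> coord_space J" "\<And>i. i \<in> J \<Longrightarrow> \<bar>x i - a i\<bar> < d" using x WJ by auto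
    show "foldr partial is f x = 0" if "set is \<subseteq> J" "is \<noteq> []" for "is"
      using flat x that by auto
  qed
  have "negligible (f ` (B \<inter> W))"
    unfolding negligible_outer_le
  proof (intro allI impI)
    fix e :: real assume e: "e > 0"
    \<comment> \<open>The \<open>N ^ p\<close> intervals of length \<open>2 * \<rho>\<close> chosen
      below have total length \<open>K / N\<close>.\<close>
    define K where "K = 2 * (p * (2 * d)) ^ Suc p"
    obtain N :: nat where N: "N > 0" "K / N \<le> e"
    proof -
      obtain N :: nat where "N > max 1 (K / e)" using reals_Archimedean2 by blast
      then show ?thesis using e by (intro that[of N]) (auto simp: field_simps)
    qed
    define C where "C = J \<rightarrow>\<^sub>E {..<N}"
    \<comment> \<open>The cube has side \<open>2 * d\<close>, so rounding down the rescaled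
      coordinates sorts its points into \<open>N ^ p\<close> cells of side \<open>2 * d / N\<close>.
      For a cell without points of \<open>B\<close> the choice \<open>pt\<close> is arbitrary and
      only enlarges \<open>T\<close>.\<close>
    define cell where "cell s = {y \<in> W. \<forall>i\<in>J. nat \<lfloor>(y i - a i + d) * N / (2 * d)\<rfloor> = s i}" for s :: "nat \<Rightarrow> nat"
    define pt where "pt s = (SOME x. x \<in> B \<inter> cell s)" for s
    define \<rho> where "\<rho> = (p * (2 * d / N)) ^ Suc p"
    define T where "T = (\<Union>s\<in>C. {f (pt s) - \<rho>..f (pt s) + \<rho>})"
    have finC: "finite C" unfolding C_def using J by (intro finite_PiE) auto
    have cardC: "card C = N ^ p" unfolding C_def using J by (simp add: card_PiE p_def)
    have sub: "f ` (B \<inter> W) \<subseteq> T"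
    proof
      fix t assume "t \<in> f ` (B \<inter> W)"
      then obtain y where y: "y \<in> B" "y \<in> W" "t = f y" by auto
      define s where "s = restrict (\<lambda>i. nat \<lfloor>(y i - a i + d) * N / (2 * d)\<rfloor>) J"
      have frac: "0 < (z i - a i + d) * N / (2 * d)" "(z i - a i + d) * N / (2 * d) < N" if "z \<in> W" "i \<in> J" for z i
      proof -
        have v: "0 < z i - a i + d" "z i - a i + d < 2 * d" using WJ(2)[OF that] by linarith+
        show "0 < (z i - a i + d) * N / (2 * d)"
          using d(1) N(1) v(1) by (intro divide_pos_pos mult_pos_pos) auto
        have "(z i - a i + d) * N < 2 * d * N"
          using v(2) N(1) by (intro mult_strict_right_mono) auto
        then show "(z i - a i + d) * N / (2 * d) < N"
          using d(1) by (simp add: pos_divide_less_eq mult.commute)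
      qed
      have "s \<in> C"
        unfolding C_def s_def
      proof (rule restrict_PiE_iff[THEN iffD2], intro ballI)
        fix i assume "i \<in> J"
        from frac[OF y(2) this] show "nat \<lfloor>(y i - a i + d) * N / (2 * d)\<rfloor> \<in> {..<N}"
          by (simp add: nat_less_iff floor_less_iff)
      qed
      have "y \<in> B \<inter> cell s" using y by (auto simp: cell_def s_def)
      then have pt: "pt s \<in> B \<inter> cell s" unfolding pt_def by (rule someI[where P = "\<lambda>x. x \<in> B \<inter> cell s"])
      have "\<bar>y i - pt s i\<bar> \<le> 2 * d / N" if i: "i \<in> J" for i
      proof -
        let ?u = "(y i - a i + d) * N / (2 * d)" and ?v = "(pt s i - a i + d) * N / (2 * d)"
        have "nat \<lfloor>?v\<rfloor> = nat \<lfloor>?u\<rfloor>" using pt i by (auto simp: cell_def s_def)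
        moreover have "0 < ?v" "0 < ?u" using frac(1)[OF _ i] pt y by (auto simp: cell_def)
        ultimately have "\<lfloor>?v\<rfloor> = \<lfloor>?u\<rfloor>" by (simp add: nat_eq_iff2)
        then have "\<bar>?u - ?v\<bar> \<le> 1" by linarith
        moreover have "?u - ?v = (y i - pt s i) * (N / (2 * d))" using d(1) by (simp add: field_simps)
        ultimately have "\<bar>y i - pt s i\<bar> * (N / (2 * d)) \<le> 1" using d(1) by (simp add: abs_mult)
        then show ?thesis using d(1) N(1) by (simp add: field_simps)
      qed
      then have "\<bar>f y - f (pt s)\<bar> \<le> \<rho>"
        unfolding \<rho>_def using pt y d(1) by (intro bound) (auto simp: cell_def)
      then show "t \<in> T" unfolding T_def using \<open>s \<in> C\<close> y(3)
        by (intro UN_I[of s]) (auto simp: abs_le_iff)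
    qed
    have meas: "T \<in> lmeasurable" unfolding T_def using finC by (intro fmeasurable.finite_UN) auto
    have \<rho>: "\<rho> \<ge> 0" using d(1) by (simp add: \<rho>_def)
    have "measure lebesgue T \<le> (\<Sum>s\<in>C. measure lebesgue {f (pt s) - \<rho>..f (pt s) + \<rho>})"
      unfolding T_def by (rule measure_UNION_le[OF finC]) auto
    also have "\<dots> = N ^ p * (2 * \<rho>)" using \<rho> cardC by simp
    also have "\<dots> = K / N" unfolding \<rho>_def K_def using N(1) by (simp add: power_mult_distrib power_divide field_simps)
    also have "\<dots> \<le> e" by (rule N(2))
    finally show "\<exists>T. f ` (B \<inter> W) \<subseteq> T \<and> T \<in> lmeasurable \<and> measure lebesgue T \<le> e"
      using sub meas by blast
  qed
  moreover have "a \<in> W" using a B open_in_coords_subset[OF S] d(1) by (auto simp: W_def)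
  ultimately show "\<exists>W. open_in_coords J W \<and> a \<in> W \<and> negligible (f ` (B \<inter> W))" using W by blast
qed

text \<open>
  Induction on the number of coordinates.  Where some w, a constraint or an iterated partial derivative
  of f, vanishes but its gradient does not, A lies on the graph of an implicit function, and
  substituting the graph parametrisation keeps the multipliers.  At the remaining points f is flat.
\<close>

lemma sard_lagrange:
  assumes "finite J" "finite L" "open_in_coords J S" "smooth_on J S f"
    and "\<And>l. l \<in> L \<Longrightarrow> smooth_on J S (h l)" "A \<subseteq> S"
    and "\<And>a l. a \<in> A \<Longrightarrow> l \<in> L \<Longrightarrow> h l a = 0"
    and "\<And>a. a \<in> A \<Longrightarrow> \<exists>m. \<forall>i\<in>J. partial i f a = (\<Sum>l\<in>L. m l * partial i (h l) a)"
  shows "negligible (f ` A)"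
  using assms
proof (induction "card J" arbitrary: J S f h A rule: less_induct)
  case less
  note J = less(2) and S = less(4) and f = less(5) and h = less(6)
  have hyp: "negligible (f ` A')"
    if w: "smooth_on J S w" and i: "i \<in> J" and A': "A' \<subseteq> A"
      and z: "\<And>a. a \<in> A' \<Longrightarrow> w a = 0" "\<And>a. a \<in> A' \<Longrightarrow> partial i w a \<noteq> 0" for w i A'
  proof (rule negligible_image_locally)
    show "A' \<subseteq> coord_space J" using A' less(7) open_in_coords_subset[OF S] by auto
    fix a assume a: "a \<in> A'"
    have aS: "a \<in> S" using a A' less(7) by auto
    obtain T \<phi> W where T: "open_in_coords (J - {i}) T" and \<phi>: "smooth_on (J - {i}) T \<phi>"
      and TS: "\<forall>y\<in>T. y(i := \<phi> y) \<in> S" and W: "open_in_coords J W" "a \<in> W"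
      and WT: "\<forall>x\<in>W. w x = 0 \<longrightarrow> x(i := 0) \<in> T \<and> \<phi> (x(i := 0)) = x i"
      using implicit_graph[OF J S w aS i z(1)[OF a] z(2)[OF a]] by blast
    define G where "G y = y(i := \<phi> y)" for y
    \<comment> \<open>The part of the graph domain lying over \<open>A'\<close>. There the
      constraints and the multiplier relation are inherited, without any demand on the rest of the
      graph.\<close>
    define A2 where "A2 = {y \<in> T. G y \<in> A'}"
    have GT: "G ` T \<subseteq> S" using TS by (auto simp: G_def)
    have GCk: "Ck k (J - {i}) T (\<lambda>y. G y m)" for k m
      using \<phi> Ck_coord[OF T] by (cases "m = i") (auto simp: G_def smooth_on_def)
    have comp: "smooth_on (J - {i}) T (\<lambda>y. u (G y))" if "smooth_on J S u" for u
      using that unfolding smooth_on_def by (auto intro!: Ck_compose[OF J T S _ GCk GT])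
    have pcomp: "partial j (\<lambda>y. u (G y)) y = (\<Sum>m\<in>J. partial m u (G y) * partial j (\<lambda>z. G z m) y)"
      if "smooth_on J S u" "j \<in> J - {i}" "y \<in> T" for u j y
      using that unfolding smooth_on_def
      by (intro partial_eqI has_partial_compose[OF J T S _ GCk GT]) auto
    have "negligible ((\<lambda>y. f (G y)) ` A2)"
    proof (rule less(1)[where J = "J - {i}" and S = T and h = "\<lambda>l y. h l (G y)"])
      show "card (J - {i}) < card J" using J i by (rule card_Diff1_less)
      show "finite (J - {i})" using J by auto
      show "A2 \<subseteq> T" by (auto simp: A2_def)
      show "smooth_on (J - {i}) T (\<lambda>y. h l (G y))" if "l \<in> L" for l by (rule comp[OF h[OF that]])
      show "h l (G y) = 0" if "y \<in> A2" "l \<in> L" for y l using that A' less(8) by (auto simp: A2_def)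
      fix y assume y: "y \<in> A2"
      then obtain m where m: "\<forall>i\<in>J. partial i f (G y) = (\<Sum>l\<in>L. m l * partial i (h l) (G y))"
        using less(9)[of "G y"] A' by (auto simp: A2_def)
      have yT: "y \<in> T" using y by (simp add: A2_def)
      have "partial j (\<lambda>y. f (G y)) y = (\<Sum>l\<in>L. m l * partial j (\<lambda>y. h l (G y)) y)" if j: "j \<in> J - {i}" for j
      proof -
        have "partial j (\<lambda>y. f (G y)) y = (\<Sum>n\<in>J. (\<Sum>l\<in>L. m l * partial n (h l) (G y)) * partial j (\<lambda>z. G z n) y)"
          using m by (simp add: pcomp[OF f j yT])
        also have "\<dots> = (\<Sum>l\<in>L. m l * (\<Sum>n\<in>J. partial n (h l) (G y) * partial j (\<lambda>z. G z n) y))"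
          unfolding sum_distrib_right sum_distrib_left by (subst sum.swap) (simp add: mult_ac)
        also have "\<dots> = (\<Sum>l\<in>L. m l * partial j (\<lambda>y. h l (G y)) y)"
          by (intro sum.cong refl) (simp add: pcomp[OF h j yT])
        finally show ?thesis .
      qed
      then show "\<exists>m. \<forall>j\<in>J - {i}. partial j (\<lambda>y. f (G y)) y = (\<Sum>l\<in>L. m l * partial j (\<lambda>y. h l (G y)) y)" by blast
    qed (use T comp[OF f] less(3) in auto)
    moreover have "f ` (A' \<inter> W) \<subseteq> (\<lambda>y. f (G y)) ` A2"
    proof
      fix t assume "t \<in> f ` (A' \<inter> W)"
      then obtain x where x: "x \<in> A'" "x \<in> W" "t = f x" by auto
      have "x(i := 0) \<in> T" "\<phi> (x(i := 0)) = x i" using WT x z(1) by auto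
      then show "t \<in> (\<lambda>y. f (G y)) ` A2" using x by (intro image_eqI[of _ _ "x(i := 0)"]) (auto simp: A2_def G_def)
    qed
    ultimately have "negligible (f ` (A' \<inter> W))" by (rule negligible_subset)
    then show "\<exists>W. open_in_coords J W \<and> a \<in> W \<and> negligible (f ` (A' \<inter> W))" using W by blast
  qed
  define A1 where "A1 l i = {a \<in> A. partial i (h l) a \<noteq> 0}" for l i
  define A2 where "A2 is i = {a \<in> A. foldr partial is f a = 0 \<and> partial i (foldr partial is f) a \<noteq> 0}" for "is" i
  define A3 where "A3 = {a \<in> A. \<forall>is. set is \<subseteq> J \<longrightarrow> is \<noteq> [] \<longrightarrow> foldr partial is f a = 0}"
  \<comment> \<open>The empty list is left out: \<open>f\<close> itself need not vanish on
    \<open>A\<close>, so the scheme begins with derivatives of order 1.\<close>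
  define I where "I = {is. set is \<subseteq> J \<and> is \<noteq> []}"
  have "negligible (f ` A1 l i)" if "l \<in> L" "i \<in> J" for l i
    using that less(8) by (intro hyp[OF h[OF that(1)] that(2)]) (auto simp: A1_def)
  moreover have "negligible (f ` A2 is i)" if "is \<in> I" "i \<in> J" for "is" i
    using that by (intro hyp[OF smooth_on_foldr_partial[OF f, of "is"]]) (auto simp: A2_def I_def)
  moreover have "negligible (f ` A3)"
    using less(7) by (intro negligible_flat_image[OF J S f]) (auto simp: A3_def)
  ultimately have "negligible ((\<Union>(l, i)\<in>L \<times> J. f ` A1 l i) \<union> (\<Union>(is, i)\<in>I \<times> J. f ` A2 is i) \<union> f ` A3)"
    using less(3) J by (intro negligible_Un negligible_countable_Union) (auto intro: countable_finite)
  moreover have "a \<in> (\<Union>(l, i)\<in>L \<times> J. A1 l i) \<union> (\<Union>(is, i)\<in>I \<times> J. A2 is i) \<union> A3" if a: "a \<in> A" for a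
  proof (rule ccontr)
    assume n: "\<not> ?thesis"
    \<comment> \<open>Outside all \<open>A1\<close> the gradients of the constraints vanish, and the
      multiplier relation then kills the gradient of \<open>f\<close>. This is the base case;
      avoiding the sets \<open>A2\<close> raises the order of vanishing one derivative at a
      time.\<close>
    then have h0: "partial i (h l) a = 0" if "l \<in> L" "i \<in> J" for l i using that a by (auto simp: A1_def)
    obtain m where "\<forall>i\<in>J. partial i f a = (\<Sum>l\<in>L. m l * partial i (h l) a)" using less(9)[OF a] by blast
    then have f0: "partial i f a = 0" if "i \<in> J" for i using that h0 by simp
    have "foldr partial is f a = 0" if "is \<noteq> []" "set is \<subseteq> J" for "is"
      using that
    proof (induction "is")
      case (Cons i js)
      show ?case
      proof (cases "js = []")
        case False
        then show ?thesis using Cons n a by (auto simp: A2_def I_def)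
      qed (use f0 Cons in auto)
    qed simp
    then have "a \<in> A3" using a by (simp add: A3_def)
    then show False using n by blast
  qed
  then have "f ` A \<subseteq> (\<Union>(l, i)\<in>L \<times> J. f ` A1 l i) \<union> (\<Union>(is, i)\<in>I \<times> J. f ` A2 is i) \<union> f ` A3" by fastforce
  ultimately show ?case by (rule negligible_subset)
qed

section \<open>Generic solvability of the linearised lifting problem\<close>

text \<open>Gaussian elimination, one column of \<open>M\<close> at a time. The certificate of
  unsolvability is scaled to pair to 1 with \<open>b\<close>: such an equation is preserved under
  limits, unlike the condition of being nonzero, and so cuts out closed sets in
  \<open>obstruction_meager\<close>.\<close>

lemma fredholm_alternative:
  fixes M :: "'j \<Rightarrow> 'i \<Rightarrow> real" and b :: "'j \<Rightarrow> real"
  assumes "finite L" "finite I"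
  shows "(\<exists>\<xi>. \<forall>j\<in>L. (\<Sum>i\<in>I. M j i * \<xi> i) = b j) \<or>
    (\<exists>m. (\<forall>i\<in>I. (\<Sum>j\<in>L. m j * M j i) = 0) \<and> (\<Sum>j\<in>L. m j * b j) = 1)"
  using assms(2)
proof (induction I arbitrary: M b rule: finite_induct)
  case empty
  show ?case
  proof (cases "\<forall>j\<in>L. b j = 0")
    case False
    then obtain l where l: "l \<in> L" "b l \<noteq> 0" by blast
    have "(\<Sum>j\<in>L. (if j = l then 1 / b l else 0) * b j) = (\<Sum>j\<in>L. if j = l then 1 else 0)"
      by (intro sum.cong) (use l in auto)
    then show ?thesis using l assms(1)
      by (intro disjI2 exI[of _ "\<lambda>j. if j = l then 1 / b l else 0"]) simp
  qed simp
next
  case (insert c I)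
  show ?case
  proof (cases "\<forall>j\<in>L. M j c = 0")
    case True
    from insert.IH[of M b] show ?thesis
    proof
      assume "\<exists>\<xi>. \<forall>j\<in>L. (\<Sum>i\<in>I. M j i * \<xi> i) = b j"
      then show ?thesis using True insert.hyps by auto
    next
      assume "\<exists>m. (\<forall>i\<in>I. (\<Sum>j\<in>L. m j * M j i) = 0) \<and> (\<Sum>j\<in>L. m j * b j) = 1"
      then obtain m where "\<forall>i\<in>I. (\<Sum>j\<in>L. m j * M j i) = 0" "(\<Sum>j\<in>L. m j * b j) = 1" by blast
      then show ?thesis using True by (intro disjI2 exI[of _ m]) auto
    qed
  next
    case False
    then obtain l where l: "l \<in> L" "M l c \<noteq> 0" by blast
    \<comment> \<open>Row \<open>l\<close> is the pivot row. As \<open>q l = 1\<close>, subtracting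
      its multiples clears column \<open>c\<close> and also the pivot row itself, whose equation is
      recovered by back substitution for the unknown with index \<open>c\<close>.\<close>
    define q where "q j = M j c / M l c" for j
    define M' where "M' j i = M j i - q j * M l i" for j i
    define b' where "b' j = b j - q j * b l" for j
    from insert.IH[of M' b'] show ?thesis
    proof
      assume "\<exists>\<xi>. \<forall>j\<in>L. (\<Sum>i\<in>I. M' j i * \<xi> i) = b' j"
      then obtain \<xi> where \<xi>: "\<forall>j\<in>L. (\<Sum>i\<in>I. M' j i * \<xi> i) = b' j" by blast
      define \<eta> where "\<eta> = \<xi>(c := (b l - (\<Sum>i\<in>I. M l i * \<xi> i)) / M l c)"
      have s: "(\<Sum>i\<in>I. M j i * \<eta> i) = (\<Sum>i\<in>I. M j i * \<xi> i)" for j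
        using insert.hyps by (intro sum.cong) (auto simp: \<eta>_def)
      have "(\<Sum>i\<in>insert c I. M j i * \<eta> i) = b j" if j: "j \<in> L" for j
      proof -
        have "(\<Sum>i\<in>I. M j i * \<xi> i) - q j * (\<Sum>i\<in>I. M l i * \<xi> i) = b j - q j * b l"
          using \<xi> j by (simp add: M'_def b'_def left_diff_distrib sum_subtractf sum_distrib_left mult.assoc)
        moreover have "M j c * \<eta> c = q j * (b l - (\<Sum>i\<in>I. M l i * \<xi> i))"
          using l(2) by (simp add: \<eta>_def q_def)
        ultimately show ?thesis using insert.hyps by (simp add: s right_diff_distrib)
      qed
      then show ?thesis by blast
    next
      assume "\<exists>m. (\<forall>i\<in>I. (\<Sum>j\<in>L. m j * M' j i) = 0) \<and> (\<Sum>j\<in>L. m j * b' j) = 1"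
      then obtain m where m: "\<forall>i\<in>I. (\<Sum>j\<in>L. m j * M' j i) = 0" "(\<Sum>j\<in>L. m j * b' j) = 1" by blast
      define Q where "Q = (\<Sum>j\<in>L. m j * q j)"
      \<comment> \<open>The row operations transposed: subtracting \<open>q j\<close> times row
        \<open>l\<close> from every row \<open>j\<close> leaves the coefficient
        \<open>m l - Q\<close> on row \<open>l\<close> of the original system.\<close>
      define n where "n j = m j - (if j = l then Q else 0)" for j
      have n: "(\<Sum>j\<in>L. n j * v j) = (\<Sum>j\<in>L. m j * (v j - q j * v l))" for v :: "'j \<Rightarrow> real"
      proof -
        have "(\<Sum>j\<in>L. n j * v j) = (\<Sum>j\<in>L. m j * v j) - (\<Sum>j\<in>L. if j = l then Q * v j else 0)"
          unfolding sum_subtractf[symmetric] by (intro sum.cong) (auto simp: n_def left_diff_distrib)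
        also have "\<dots> = (\<Sum>j\<in>L. m j * v j) - Q * v l" using l assms(1) by simp
        also have "\<dots> = (\<Sum>j\<in>L. m j * (v j - q j * v l))"
          by (simp add: Q_def right_diff_distrib sum_subtractf sum_distrib_right mult.assoc)
        finally show ?thesis .
      qed
      have "(\<Sum>j\<in>L. n j * M j i) = 0" if "i \<in> insert c I" for i
      proof (cases "i = c")
        case True
        show ?thesis unfolding n True using l by (simp add: q_def)
      next
        case False
        then show ?thesis using m(1) that unfolding n by (auto simp: M'_def)
      qed
      moreover have "(\<Sum>j\<in>L. n j * b j) = 1" using m(2) unfolding n by (simp add: b'_def)
      ultimately show ?thesis by blast
    qed
  qed
qed

section \<open>Size of the set of bad parameters\<close>

lemma smooth_on_continuous: "smooth_on J S f \<Longrightarrow> X \<subseteq> S \<Longrightarrow> continuous_on X f"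
  unfolding smooth_on_def by (blast intro: continuous_on_subset Ck_continuous)

lemma compact_coord_cube: "compact {x \<in> coord_space J. \<forall>i\<in>J. \<bar>x i - a i\<bar> \<le> r}"
proof -
  define X where "X i = (if i \<in> J then {a i - r..a i + r} else {0::real})" for i
  have "compactin (product_topology (\<lambda>i. euclideanreal) UNIV) (Pi\<^sub>E UNIV X)"
    by (subst compactin_PiE) (auto simp: X_def)
  then have "compact (Pi\<^sub>E UNIV X)" by (simp add: euclidean_product_topology)
  moreover have "x \<in> Pi\<^sub>E UNIV X \<longleftrightarrow> x \<in> coord_space J \<and> (\<forall>i\<in>J. \<bar>x i - a i\<bar> \<le> r)" for x
  proof -
    have "(\<bar>x i - a i\<bar> \<le> r) = (x i \<in> {a i - r..a i + r})" for i by (auto simp: abs_le_iff)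
    then show ?thesis by (auto simp: X_def coord_space_def PiE_iff split: if_splits)
  qed
  then have "Pi\<^sub>E UNIV X = {x \<in> coord_space J. \<forall>i\<in>J. \<bar>x i - a i\<bar> \<le> r}" by blast
  ultimately show ?thesis by simp
qed

lemma closed_coord_space: "closed (coord_space J)"
proof -
  have "coord_space J = (\<Inter>i\<in>-J. {x. x i = 0})" by (auto simp: coord_space_def)
  moreover have "closed {x::vec. x i = 0}" for i
    by (intro closed_Collect_eq continuous_intros)
  ultimately show ?thesis by auto
qed

lemma compact_closedin_coords: "compact T \<Longrightarrow> T \<subseteq> coord_space J \<Longrightarrow> closedin (top_of_set (coord_space J)) T"
  by (metis compact_imp_closed closed_subset)

text \<open>\<open>sard_lagrange\<close> is applied in \<open>N + 1\<close> coordinates: the first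
  \<open>N\<close> hold the arrow in a chart, the last holds the value of the varying parameter and
  is also the function whose critical values are measured. The equation of \<open>F j\<close> with
  \<open>q j\<close> becomes the constraint \<open>h j\<close>. As \<open>q j\<close> enters
  \<open>h j\<close> negatively, a certificate \<open>m\<close> against lifting direction
  \<open>p\<close> says exactly that the numbers \<open>- m j\<close> are Lagrange
  multipliers.\<close>

lemma obstruction_slice_negligible:
  assumes L: "finite L" and Op: "open_in_coords {..<k} Op" and q: "\<And>j. j \<in> L \<Longrightarrow> smooth_on {..<k} Op (q j)"
    and W: "open_in_coords {..<N} W" and F: "\<And>j. j \<in> L \<Longrightarrow> smooth_on {..<N} W (F j)"
    and p: "p < k" and u: "u \<in> coord_space {..<k}"
  shows "negligible {t. u(p := t) \<in> Op \<and> (\<exists>g\<in>W. \<exists>m. (\<forall>j\<in>L. F j g = q j (u(p := t))) \<and>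
     (\<forall>i<N. (\<Sum>j\<in>L. m j * partial i (F j) g) = 0) \<and> (\<Sum>j\<in>L. m j * partial p (q j) (u(p := t))) = 1)}"
proof -
  define J where "J = {..N}"
  define S where "S = {x \<in> coord_space J. x(N := 0) \<in> W \<and> u(p := x N) \<in> Op}"
  define h where "h j x = F j (x(N := 0)) - q j (u(p := x N))" for j and x :: vec
  define A where "A = {x \<in> S. (\<forall>j\<in>L. h j x = 0) \<and> (\<exists>m. (\<forall>i<N. (\<Sum>j\<in>L. m j * partial i (F j) (x(N := 0))) = 0) \<and>
     (\<Sum>j\<in>L. m j * partial p (q j) (u(p := x N))) = 1)}"
  have J: "finite J" by (simp add: J_def)
  have c1: "continuous_on X (\<lambda>x::vec. x(N := 0))" for X
  proof (rule continuous_on_vecI)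
    show "continuous_on X (\<lambda>x. (x(N := 0)) j)" for j by (cases "j = N") (auto intro: continuous_intros)
  qed
  have c2: "continuous_on X (\<lambda>x::vec. u(p := x N))" for X
  proof (rule continuous_on_vecI)
    show "continuous_on X (\<lambda>x. (u(p := x N)) j)" for j by (cases "j = p") (auto intro: continuous_intros)
  qed
  obtain W' Op' where W': "open W'" "W = coord_space {..<N} \<inter> W'" and Op': "open Op'" "Op = coord_space {..<k} \<inter> Op'"
    using W Op by (auto simp: openin_open)
  have mem: "x(N := 0) \<in> coord_space {..<N}" "u(p := x N) \<in> coord_space {..<k}" if "x \<in> coord_space J" for x
    using that u p by (auto simp: coord_space_def J_def)
  have "S = coord_space J \<inter> ((\<lambda>x. x(N := 0)) -` W' \<inter> (\<lambda>x. u(p := x N)) -` Op')"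
    using mem by (auto simp: S_def W' Op')
  moreover have "open ((\<lambda>x::vec. x(N := 0)) -` W' \<inter> (\<lambda>x::vec. u(p := x N)) -` Op')"
    by (intro open_Int open_vimage W' Op' c1 c2)
  ultimately have S: "open_in_coords J S" by (metis openin_open_Int)
  have SJ: "x \<in> coord_space J" if "x \<in> S" for x using that by (simp add: S_def)
  have h: "smooth_on J S (h j)" if j: "j \<in> L" for j
    unfolding smooth_on_def h_def
  proof (intro allI Ck_diff[OF S])
    fix n
    show "Ck n J S (\<lambda>x. F j (x(N := 0)))"
    proof (rule Ck_compose[OF _ S W, where G = "\<lambda>x. x(N := 0)"])
      show "Ck n J S (\<lambda>x. (x(N := 0)) i)" if "i \<in> {..<N}" for i
        using Ck_coord[OF S, of n i] that by simp
    qed (use F[OF j] in \<open>auto simp: smooth_on_def S_def\<close>)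
    show "Ck n J S (\<lambda>x. q j (u(p := x N)))"
    proof (rule Ck_compose[OF _ S Op, where G = "\<lambda>x. u(p := x N)"])
      show "Ck n J S (\<lambda>x. (u(p := x N)) i)" if "i \<in> {..<k}" for i
        using Ck_coord[OF S, of n N] Ck_const[OF S] by (cases "i = p") auto
    qed (use q[OF j] in \<open>auto simp: smooth_on_def S_def\<close>)
  qed
  have F1: "Ck (Suc 0) {..<N} W (F j)" and q1: "Ck (Suc 0) {..<k} Op (q j)" if "j \<in> L" for j
    using F[OF that] q[OF that] by (auto simp: smooth_on_def)
  have ph1: "partial i (h j) x = partial i (F j) (x(N := 0))" if "j \<in> L" "i < N" "x \<in> S" for i j x
  proof (rule partial_eqI)
    have "((\<lambda>t. F j ((x(N := 0))(i := t))) has_real_derivative partial i (F j) (x(N := 0))) (at ((x(N := 0)) i))"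
      using that by (intro has_partial[OF F1]) (auto simp: S_def)
    then have "((\<lambda>t. F j ((x(N := 0))(i := t)) - q j (u(p := x N))) has_real_derivative partial i (F j) (x(N := 0)) - 0) (at (x i))"
      using that by (intro DERIV_diff) auto
    then show "((\<lambda>t. h j (x(i := t))) has_real_derivative partial i (F j) (x(N := 0))) (at (x i))"
      using that by (simp add: h_def fun_upd_twist)
  qed
  have ph2: "partial N (h j) x = - partial p (q j) (u(p := x N))" if "j \<in> L" "x \<in> S" for j x
  proof (rule partial_eqI)
    have "((\<lambda>t. q j ((u(p := x N))(p := t))) has_real_derivative partial p (q j) (u(p := x N))) (at ((u(p := x N)) p))"
      using that p by (intro has_partial[OF q1]) (auto simp: S_def)
    then have "((\<lambda>t. F j (x(N := 0)) - q j (u(p := t))) has_real_derivative 0 - partial p (q j) (u(p := x N))) (at (x N))"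
      by (intro DERIV_diff) auto
    then show "((\<lambda>t. h j (x(N := t))) has_real_derivative - partial p (q j) (u(p := x N))) (at (x N))"
      by (simp add: h_def)
  qed
  have pf: "partial i (\<lambda>x. x N) x = (if i = N then 1 else 0)" for i and x :: vec
    by (rule partial_eqI) (cases "i = N"; auto)
  have "negligible ((\<lambda>x. x N) ` A)"
  proof (rule sard_lagrange[OF J L S _ h])
    show "smooth_on J S (\<lambda>x. x N)" by (simp add: smooth_on_def Ck_coord[OF S])
    show "A \<subseteq> S" by (auto simp: A_def)
    show "h l a = 0" if "a \<in> A" "l \<in> L" for a l using that by (auto simp: A_def)
    fix a assume a: "a \<in> A"
    then obtain m where m: "\<forall>i<N. (\<Sum>j\<in>L. m j * partial i (F j) (a(N := 0))) = 0"
      "(\<Sum>j\<in>L. m j * partial p (q j) (u(p := a N))) = 1" by (auto simp: A_def)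
    have aS: "a \<in> S" using a by (auto simp: A_def)
    have "partial i (\<lambda>x. x N) a = (\<Sum>l\<in>L. - m l * partial i (h l) a)" if "i \<in> J" for i
    proof (cases "i = N")
      case True
      then show ?thesis using m(2) by (simp add: pf ph2[OF _ aS])
    next
      case False
      then have "i < N" using that by (auto simp: J_def)
      then show ?thesis using m(1) False by (simp add: pf ph1[OF _ _ aS] sum_negf)
    qed
    then show "\<exists>m. \<forall>i\<in>J. partial i (\<lambda>x. x N) a = (\<Sum>l\<in>L. m l * partial i (h l) a)"
      by (intro exI[of _ "\<lambda>l. - m l"]) blast
  qed
  then show ?thesis
  proof (rule negligible_subset, intro subsetI)
    fix t assume "t \<in> {t. u(p := t) \<in> Op \<and> (\<exists>g\<in>W. \<exists>m. (\<forall>j\<in>L. F j g = q j (u(p := t))) \<and>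
     (\<forall>i<N. (\<Sum>j\<in>L. m j * partial i (F j) g) = 0) \<and> (\<Sum>j\<in>L. m j * partial p (q j) (u(p := t))) = 1)}"
    then obtain g m where g: "u(p := t) \<in> Op" "g \<in> W" "\<forall>j\<in>L. F j g = q j (u(p := t))"
      "\<forall>i<N. (\<Sum>j\<in>L. m j * partial i (F j) g) = 0" "(\<Sum>j\<in>L. m j * partial p (q j) (u(p := t))) = 1" by blast
    have gJ: "g \<in> coord_space {..<N}" using g(2) W open_in_coords_subset by blast
    then have gN: "(g(N := t))(N := 0) = g" by (auto simp: coord_space_def)
    have "g(N := t) \<in> A"
      unfolding A_def S_def mem_Collect_eq h_def gN fun_upd_same using g gJ
      by (auto simp: coord_space_def J_def)
    then show "t \<in> (\<lambda>x. x N) ` A" by (intro image_eqI[of _ _ "g(N := t)"]) auto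
  qed
qed

text \<open>The parameters having a certificate bounded by \<open>R\<close> form the projection
  \<open>B p R\<close> of a compact zero set, hence a closed set. An interior point would put an
  interval in direction \<open>p\<close> into it, against the null slices. Certificates carry no a
  priori bound, which is why the family runs over all \<open>R\<close>.\<close>

lemma obstruction_meager:
  fixes L :: "nat set"
  assumes L: "finite L" and Op: "open_in_coords {..<k} Op" and q: "\<And>j. j \<in> L \<Longrightarrow> smooth_on {..<k} Op (q j)"
    and D: "compact D" "D \<subseteq> Op"
    and W: "open_in_coords {..<N} W" and F: "\<And>j. j \<in> L \<Longrightarrow> smooth_on {..<N} W (F j)"
    and C: "compact C" "C \<subseteq> W"
  shows "\<exists>\<G>. countable \<G> \<and>
    (\<forall>T\<in>\<G>. closedin (top_of_set (coord_space {..<k})) T \<and> top_of_set (coord_space {..<k}) interior_of T = {}) \<and>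
    (\<forall>u\<in>D - \<Union>\<G>. \<forall>g\<in>C. (\<forall>j\<in>L. F j g = q j u) \<longrightarrow>
       (\<forall>p<k. \<exists>\<xi>. \<forall>j\<in>L. (\<Sum>i<N. partial i (F j) g * \<xi> i) = partial p (q j) u))"
proof -
  \<comment> \<open>Multipliers are stored as points of \<open>coord_space L\<close>, where bounded
    closed cubes are compact.\<close>
  define \<Lambda> where "\<Lambda> R = {m \<in> coord_space L. \<forall>j\<in>L. \<bar>m j - 0\<bar> \<le> real R}" for R :: nat
  \<comment> \<open>All equations are gathered in one continuous function that vanishes iff they all
    hold, so that the solution set is a single closed preimage.\<close>
  define E where "E p = (\<lambda>(u, g, m). (\<Sum>j\<in>L. \<bar>F j g - q j u\<bar>) + (\<Sum>i<N. \<bar>\<Sum>j\<in>L. m j * partial i (F j) g\<bar>)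
     + \<bar>(\<Sum>j\<in>L. m j * partial p (q j) u) - 1\<bar>)" for p and m :: vec
  have E0: "E p (u, g, m) = 0 \<longleftrightarrow> (\<forall>j\<in>L. F j g = q j u) \<and> (\<forall>i<N. (\<Sum>j\<in>L. m j * partial i (F j) g) = 0) \<and>
      (\<Sum>j\<in>L. m j * partial p (q j) u) = 1" for p u g m
  proof -
    have "E p (u, g, m) = 0 \<longleftrightarrow> (\<Sum>j\<in>L. \<bar>F j g - q j u\<bar>) = 0 \<and> (\<Sum>i<N. \<bar>\<Sum>j\<in>L. m j * partial i (F j) g\<bar>) = 0
      \<and> \<bar>(\<Sum>j\<in>L. m j * partial p (q j) u) - 1\<bar> = 0"
    proof -
      have "0 \<le> (\<Sum>j\<in>L. \<bar>F j g - q j u\<bar>)" "0 \<le> (\<Sum>i<N. \<bar>\<Sum>j\<in>L. m j * partial i (F j) g\<bar>)"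
        by (auto intro: sum_nonneg)
      then show ?thesis by (simp add: E_def add_nonneg_eq_0_iff)
    qed
    also have "\<dots> \<longleftrightarrow> (\<forall>j\<in>L. F j g = q j u) \<and> (\<forall>i<N. (\<Sum>j\<in>L. m j * partial i (F j) g) = 0) \<and>
      (\<Sum>j\<in>L. m j * partial p (q j) u) = 1"
      using L by (simp add: sum_nonneg_eq_0_iff) auto
    finally show ?thesis .
  qed
  define B where "B p R = fst ` {x \<in> D \<times> C \<times> \<Lambda> R. E p x \<in> {0}}" for p R
  have cB: "compact (B p R)" if p: "p < k" for p R
  proof -
    have cE: "continuous_on (D \<times> C \<times> \<Lambda> R) (E p)"
    proof -
      have 1: "continuous_on (D \<times> C \<times> \<Lambda> R) (\<lambda>x. f (fst x))" if "smooth_on {..<k} Op f" for f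
        by (rule continuous_on_compose2[OF smooth_on_continuous[OF that D(2)] continuous_on_fst[OF continuous_on_id]]) auto
      have 2: "continuous_on (D \<times> C \<times> \<Lambda> R) (\<lambda>x. f (fst (snd x)))" if "smooth_on {..<N} W f" for f
        by (rule continuous_on_compose2[OF smooth_on_continuous[OF that C(2)]
              continuous_on_fst[OF continuous_on_snd[OF continuous_on_id]]]) auto
      have 3: "continuous_on (D \<times> C \<times> \<Lambda> R) (\<lambda>x. snd (snd x) j)" for j
        by (rule continuous_on_compose2[OF continuous_on_coord[of UNIV j]
              continuous_on_snd[OF continuous_on_snd[OF continuous_on_id]]]) auto
      show ?thesis
        unfolding E_def case_prod_beta
        by (intro continuous_on_add continuous_on_sum continuous_on_rabs continuous_on_diff continuous_on_mult
            continuous_on_const 1 2 3 q F smooth_on_partial) (use p in auto)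
    qed
    have "compact (D \<times> C \<times> \<Lambda> R)"
      unfolding \<Lambda>_def by (intro compact_Times D(1) C(1) compact_coord_cube[of L "\<lambda>_. 0"])
    moreover have "closedin (top_of_set (D \<times> C \<times> \<Lambda> R)) (D \<times> C \<times> \<Lambda> R \<inter> E p -` {0})"
      by (intro continuous_closedin_preimage cE) auto
    ultimately have "compact (D \<times> C \<times> \<Lambda> R \<inter> E p -` {0})" by (rule closedin_compact)
    moreover have "D \<times> C \<times> \<Lambda> R \<inter> E p -` {0} = {x \<in> D \<times> C \<times> \<Lambda> R. E p x \<in> {0}}" by auto
    ultimately show ?thesis unfolding B_def by (intro compact_continuous_image continuous_intros) simp
  qed
  have BD: "B p R \<subseteq> D" for p R by (auto simp: B_def)
  have OpV: "Op \<subseteq> coord_space {..<k}" by (rule open_in_coords_subset[OF Op])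
  have intB: "top_of_set (coord_space {..<k}) interior_of (B p R) = {}" if p: "p < k" for p R
  proof (rule ccontr)
    assume "top_of_set (coord_space {..<k}) interior_of (B p R) \<noteq> {}"
    then obtain U u where U: "open_in_coords {..<k} U" "U \<subseteq> B p R" "u \<in> U"
      by (auto simp: interior_of_def)
    have uV: "u \<in> coord_space {..<k}" using U(3) open_in_coords_subset[OF U(1)] by auto
    have "eventually (\<lambda>t. u(p := t) \<in> U) (nhds (u p))"
      by (rule eventually_upd_in[OF U(1,3)]) (use p in auto)
    then obtain T where T: "open T" "u p \<in> T" "\<forall>t\<in>T. u(p := t) \<in> U" unfolding eventually_nhds by blast
    have sub: "T \<subseteq> {t. u(p := t) \<in> Op \<and> (\<exists>g\<in>W. \<exists>m. (\<forall>j\<in>L. F j g = q j (u(p := t))) \<and>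
         (\<forall>i<N. (\<Sum>j\<in>L. m j * partial i (F j) g) = 0) \<and> (\<Sum>j\<in>L. m j * partial p (q j) (u(p := t))) = 1)}"
    proof
      fix t assume "t \<in> T"
      then have "u(p := t) \<in> B p R" using T U by auto
      then obtain g m where g: "u(p := t) \<in> D" "g \<in> C" "E p (u(p := t), g, m) = 0" by (auto simp: B_def)
      show "t \<in> {t. u(p := t) \<in> Op \<and> (\<exists>g\<in>W. \<exists>m. (\<forall>j\<in>L. F j g = q j (u(p := t))) \<and>
         (\<forall>i<N. (\<Sum>j\<in>L. m j * partial i (F j) g) = 0) \<and> (\<Sum>j\<in>L. m j * partial p (q j) (u(p := t))) = 1)}"
        using g D(2) C(2) unfolding E0 by blast
    qed
    have "negligible T"
      by (rule negligible_subset[OF obstruction_slice_negligible[OF L Op q W F p uV] sub])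
    then show False using open_not_negligible[OF T(1)] T(2) by auto
  qed
  define \<G> where "\<G> = (\<lambda>(p, R). B p R) ` ({..<k} \<times> UNIV)"
  have "\<exists>\<xi>. \<forall>j\<in>L. (\<Sum>i<N. partial i (F j) g * \<xi> i) = partial p (q j) u"
    if u: "u \<in> D - \<Union>\<G>" and g: "g \<in> C" "\<forall>j\<in>L. F j g = q j u" and p: "p < k" for u g p
  proof (rule ccontr)
    assume "\<not> ?thesis"
    then obtain m where m: "\<forall>i\<in>{..<N}. (\<Sum>j\<in>L. m j * partial i (F j) g) = 0" "(\<Sum>j\<in>L. m j * partial p (q j) u) = 1"
      using fredholm_alternative[OF L, of "{..<N}" "\<lambda>j i. partial i (F j) g" "\<lambda>j. partial p (q j) u"] by auto
    define n where "n j = (if j \<in> L then m j else 0)" for j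
    obtain R :: nat where R: "(\<Sum>j\<in>L. \<bar>m j\<bar>) \<le> R" using real_arch_simple by blast
    have "\<bar>m j\<bar> \<le> R" if "j \<in> L" for j
      using member_le_sum[OF that, of "\<lambda>j. \<bar>m j\<bar>"] L R by auto
    then have "n \<in> \<Lambda> R" by (auto simp: \<Lambda>_def n_def coord_space_def)
    moreover have "E p (u, g, n) = 0" unfolding E0 using g(2) m by (simp add: n_def)
    ultimately have "u \<in> B p R" unfolding B_def using u g(1) by (intro image_eqI[of _ _ "(u, g, n)"]) auto
    then show False using u p by (auto simp: \<G>_def)
  qed
  moreover have "countable \<G>" unfolding \<G>_def by auto
  moreover have "closedin (top_of_set (coord_space {..<k})) T \<and> top_of_set (coord_space {..<k}) interior_of T = {}" if T: "T \<in> \<G>" for T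
  proof -
    obtain p R where "p < k" "T = B p R" using T by (auto simp: \<G>_def)
    moreover have "B p R \<subseteq> coord_space {..<k}" using BD D(2) OpV by blast
    ultimately show ?thesis using compact_closedin_coords[OF cB] intB by auto
  qed
  ultimately show ?thesis by (intro exI[of _ \<G>]) (simp only: simp_thms Ball_def, blast)
qed

text \<open>\<open>coord_space J\<close> is closed in the completely metrizable space of all real
  sequences, hence completely metrizable itself.\<close>

lemma Baire_coords:
  assumes "countable \<G>"
    and "\<And>T. T \<in> \<G> \<Longrightarrow> closedin (top_of_set (coord_space J)) T \<and> top_of_set (coord_space J) interior_of T = {}"
    and U: "open_in_coords J U" "U \<noteq> {}"
  shows "\<exists>u\<in>U. u \<notin> \<Union>\<G>"
proof -
  have "completely_metrizable_space (top_of_set (coord_space J))"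
    by (intro completely_metrizable_space_closedin completely_metrizable_space_euclidean) (simp add: closed_coord_space)
  then have "top_of_set (coord_space J) interior_of \<Union>\<G> = {}"
    using assms(1,2) by (intro Baire_category_alt) auto
  then show ?thesis using U by (metis interior_of_maximal subsetI subset_empty)
qed

section \<open>Plots of manifolds\<close>

lemma Euclidean_space_eq: "Euclidean_space n = top_of_set (coord_space {..<n})"
  by (simp add: Euclidean_space_def euclidean_product_topology coord_space_def not_less)

lemma topspace_Euclidean: "topspace (Euclidean_space n) = coord_space {..<n}"
  by (simp add: Euclidean_space_eq)

lemma openin_Euclidean_space: "openin (Euclidean_space n) U \<longleftrightarrow> open_in_coords {..<n} U"
  by (simp add: Euclidean_space_eq)

lemma subtopology_Euclidean_space:
  "openin (Euclidean_space n) U \<Longrightarrow> subtopology (Euclidean_space n) U = top_of_set U"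
  unfolding Euclidean_space_eq by (metis openin_imp_subset subtopology_subtopology inf.absorb_iff2)

text \<open>Index lists and the recursion of \<open>Ck\<close> describe the same derivatives: a
  further innermost derivative in direction \<open>i\<close> corresponds to appending
  \<open>i\<close> to the list.\<close>

lemma smooth_fun_iff:
  assumes S: "openin (Euclidean_space n) S"
  shows "smooth_fun n S f \<longleftrightarrow> smooth_on {..<n} S f"
proof
  assume f: "smooth_fun n S f"
  have "Ck k {..<n} S f" for k
    using f
  proof (induction k arbitrary: f)
    case 0
    then show ?case unfolding smooth_fun_def using subtopology_Euclidean_space[OF S]
      by (auto dest: spec[of _ "[]"])
  next
    case (Suc k)
    have c: "continuous_on S f" "\<forall>i<n. \<forall>x\<in>S. (\<lambda>t. f (x(i := t))) field_differentiable at (x i)"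
      using Suc.prems unfolding smooth_fun_def subtopology_Euclidean_space[OF S]
      by (auto dest: spec[of _ "[]"])
    have "smooth_fun n S (partial i f)" if "i < n" for i
      unfolding smooth_fun_def
    proof (intro allI impI)
      fix js assume "set js \<subseteq> {..<n}"
      then have "set (js @ [i]) \<subseteq> {..<n}" using that by auto
      from Suc.prems[unfolded smooth_fun_def, rule_format, OF this]
      show "continuous_map (subtopology (Euclidean_space n) S) euclideanreal (foldr partial js (partial i f)) \<and>
        (\<forall>l<n. \<forall>x\<in>S. (\<lambda>t. foldr partial js (partial i f) (x(l := t))) field_differentiable at (x l))"
        by simp
    qed
    then show ?case using c Suc.IH by simp
  qed
  then show "smooth_on {..<n} S f" by (simp add: smooth_on_def)
next
  assume f: "smooth_on {..<n} S f"
  show "smooth_fun n S f"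
    unfolding smooth_fun_def subtopology_Euclidean_space[OF S]
  proof (intro allI impI)
    fix js assume "set js \<subseteq> {..<n}"
    then have "Ck (Suc 0) {..<n} S (foldr partial js f)"
      using smooth_on_foldr_partial[OF f, of js] unfolding smooth_on_def by blast
    then show "continuous_map (top_of_set S) euclideanreal (foldr partial js f) \<and>
        (\<forall>l<n. \<forall>x\<in>S. (\<lambda>t. foldr partial js f (x(l := t))) field_differentiable at (x l))"
      by simp
  qed
qed

lemma smooth_on_cong:
  assumes "open_in_coords J S" "\<And>x. x \<in> S \<Longrightarrow> f x = g x"
  shows "smooth_on J S f \<longleftrightarrow> smooth_on J S g"
  unfolding smooth_on_def using Ck_cong[OF assms] by simp

lemma smooth_on_subset: "smooth_on J S f \<Longrightarrow> S' \<subseteq> S \<Longrightarrow> smooth_on J S' f"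
  unfolding smooth_on_def using Ck_subset by blast

lemma smooth_on_compose:
  fixes G :: "vec \<Rightarrow> vec"
  assumes "finite J'" "open_in_coords J S" "open_in_coords J' T" "smooth_on J' T f"
    "\<And>j. j \<in> J' \<Longrightarrow> smooth_on J S (\<lambda>x. G x j)" "G ` S \<subseteq> T"
  shows "smooth_on J S (\<lambda>x. f (G x))"
  unfolding smooth_on_def
proof
  show "Ck k J S (\<lambda>x. f (G x))" for k
    by (rule Ck_compose[OF assms(1,2,3) _ _ assms(6)]) (use assms(4,5) in \<open>simp_all add: smooth_on_def\<close>)
qed

lemma smooth_on_local:
  assumes "\<And>x. x \<in> S \<Longrightarrow> \<exists>W. open_in_coords J W \<and> x \<in> W \<and> W \<subseteq> S \<and> smooth_on J W f"
  shows "smooth_on J S f"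
proof -
  have "Ck k J S f" if "\<And>x. x \<in> S \<Longrightarrow> \<exists>W. open_in_coords J W \<and> x \<in> W \<and> W \<subseteq> S \<and> Ck k J W f" for k
    using that
  proof (induction k arbitrary: f)
    case 0
    have "\<exists>T. open T \<and> x \<in> T \<and> continuous_on (S \<inter> T) f" if x: "x \<in> S" for x
    proof -
      obtain W where W: "open_in_coords J W" "x \<in> W" "W \<subseteq> S" "continuous_on W f" using 0[OF x] by auto
      then obtain T where "open T" "W = coord_space J \<inter> T" by (auto simp: openin_open)
      moreover have "S \<subseteq> coord_space J"
      proof
        fix y assume "y \<in> S"
        then show "y \<in> coord_space J" using 0 open_in_coords_subset by blast
      qed
      ultimately have "S \<inter> T = W" "open T" "x \<in> T" using W by auto
      then show ?thesis using W by metis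
    qed
    note loc = this
    have "continuous (at x within S) f" if x: "x \<in> S" for x
    proof -
      obtain T where T: "open T" "x \<in> T" "continuous_on (S \<inter> T) f" using loc[OF x] by blast
      have "at x within S = at x within (S \<inter> T)" by (rule at_within_nhd[OF T(2,1)]) auto
      then show ?thesis using T x by (simp add: continuous_on_eq_continuous_within continuous_within)
    qed
    then show ?case by (simp add: continuous_on_eq_continuous_within)
  next
    case (Suc k)
    have "Ck k J S f"
    proof (rule Suc.IH)
      fix x assume "x \<in> S"
      from Suc.prems[OF this] obtain W where W: "open_in_coords J W" "x \<in> W" "W \<subseteq> S" "Ck (Suc k) J W f" by blast
      then show "\<exists>W. open_in_coords J W \<and> x \<in> W \<and> W \<subseteq> S \<and> Ck k J W f"
        using Ck_Suc_imp[OF W(4)] by blast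
    qed
    then have c: "continuous_on S f" by (rule Ck_continuous)
    show ?case unfolding Ck.simps
    proof (intro conjI ballI c)
      fix i assume i: "i \<in> J"
      show "Ck k J S (partial i f)"
      proof (rule Suc.IH)
        fix x assume "x \<in> S"
        from Suc.prems[OF this] obtain W where W: "open_in_coords J W" "x \<in> W" "W \<subseteq> S" "Ck (Suc k) J W f" by blast
        then show "\<exists>W. open_in_coords J W \<and> x \<in> W \<and> W \<subseteq> S \<and> Ck k J W (partial i f)"
          using Ck_partial[OF W(4) i] by blast
      qed
      fix x assume "x \<in> S"
      then obtain W where "x \<in> W" "Ck (Suc k) J W f" using Suc.prems by blast
      then show "(\<lambda>t. f (x(i := t))) field_differentiable at (x i)" using i by simp
    qed
  qed
  then show ?thesis using assms unfolding smooth_on_def by meson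
qed

lemma smooth_map_euclidean_open_iff:
  assumes V: "openin (Euclidean_space m) V" and U: "openin (Euclidean_space n) U"
  shows "smooth_map (euclidean_open m V) (euclidean_open n U) f \<longleftrightarrow>
    f ` V \<subseteq> U \<and> (\<forall>j<n. smooth_on {..<m} V (\<lambda>x. f x j))"
proof -
  have UJ: "U \<subseteq> coord_space {..<n}" using U by (auto simp: openin_Euclidean_space dest: open_in_coords_subset)
  have loc: "smooth_fun m V (\<lambda>x. local_rep (V, m, \<lambda>x. x) (U, n, \<lambda>x. x) f x j) \<longleftrightarrow> smooth_on {..<m} V (\<lambda>x. f x j)" for j
  proof -
    have "inv_into V (\<lambda>x. x) x = x" if "x \<in> V" for x
      using inv_into_f_f[of "\<lambda>x. x" V x] that by auto
    then show ?thesis unfolding smooth_fun_iff[OF V]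
      using V by (intro smooth_on_cong) (auto simp: local_rep_def openin_Euclidean_space)
  qed
  show ?thesis
  proof
    assume f: "smooth_map (euclidean_open m V) (euclidean_open n U) f"
    then have fV: "f ` V \<subseteq> U"
      using V U by (auto simp: smooth_map_def euclidean_open_def subtopology_Euclidean_space)
    then have "{x \<in> V. f x \<in> U} = V" by auto
    then show "f ` V \<subseteq> U \<and> (\<forall>j<n. smooth_on {..<m} V (\<lambda>x. f x j))"
      using f fV loc by (simp add: smooth_map_def euclidean_open_def smooth_vfun_def)
  next
    assume f: "f ` V \<subseteq> U \<and> (\<forall>j<n. smooth_on {..<m} V (\<lambda>x. f x j))"
    then have "continuous_on V f"
      using UJ by (intro continuous_on_from_coords[of "{..<n}"]) (auto intro: smooth_on_continuous)
    moreover have "{x \<in> V. f x \<in> U} = V" using f by auto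
    ultimately show "smooth_map (euclidean_open m V) (euclidean_open n U) f"
      using f loc V U by (auto simp: smooth_map_def euclidean_open_def smooth_vfun_def subtopology_Euclidean_space)
  qed
qed

lemma openin_preimage_plot:
  assumes "openin (Euclidean_space m) V" "continuous_map (top_of_set V) X p" "openin X U"
  shows "openin (Euclidean_space m) {x \<in> V. p x \<in> U}"
proof -
  have "openin (top_of_set V) {x \<in> V. p x \<in> U}"
    using openin_continuous_map_preimage[OF assms(2,3)] by simp
  then show ?thesis using assms(1) by (simp add: openin_Euclidean_space) (metis openin_trans)
qed

lemma manifold_chart:
  assumes "manifold M" "(U, n, \<phi>) \<in> charts M"
  shows "openin (mtop M) U" "openin (Euclidean_space n) (\<phi> ` U)" "inj_on \<phi> U"
    "continuous_map (subtopology (mtop M) U) (top_of_set (\<phi> ` U)) \<phi>"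
    "continuous_map (top_of_set (\<phi> ` U)) (mtop M) (inv_into U \<phi>)"
proof -
  have 1: "openin (mtop M) U \<and> openin (Euclidean_space n) (\<phi> ` U) \<and>
      homeomorphic_map (subtopology (mtop M) U) (subtopology (Euclidean_space n) (\<phi> ` U)) \<phi>"
    using assms unfolding manifold_def by fast
  then show U: "openin (mtop M) U" and pU: "openin (Euclidean_space n) (\<phi> ` U)" by auto
  have h: "homeomorphic_map (subtopology (mtop M) U) (top_of_set (\<phi> ` U)) \<phi>"
    using 1 by (simp add: subtopology_Euclidean_space[OF pU])
  have tU: "topspace (subtopology (mtop M) U) = U" using openin_subset[OF U] by auto
  show inj: "inj_on \<phi> U" using homeomorphic_imp_injective_map[OF h] tU by simp
  show "continuous_map (subtopology (mtop M) U) (top_of_set (\<phi> ` U)) \<phi>"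
    using homeomorphic_imp_continuous_map[OF h] .
  obtain g where g: "homeomorphic_maps (subtopology (mtop M) U) (top_of_set (\<phi> ` U)) \<phi> g"
    using h by (auto simp: homeomorphic_map_maps)
  have "continuous_map (top_of_set (\<phi> ` U)) (subtopology (mtop M) U) (inv_into U \<phi>)"
  proof (rule continuous_map_eq)
    show "continuous_map (top_of_set (\<phi> ` U)) (subtopology (mtop M) U) g"
      using g by (simp add: homeomorphic_maps_def)
    fix y assume "y \<in> topspace (top_of_set (\<phi> ` U))"
    then obtain x where "x \<in> U" "y = \<phi> x" by auto
    then show "g y = inv_into U \<phi> y" using g inj tU by (auto simp: homeomorphic_maps_def)
  qed
  then show "continuous_map (top_of_set (\<phi> ` U)) (mtop M) (inv_into U \<phi>)"
    using continuous_map_in_subtopology by blast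
qed

lemma smooth_map_from_euclidean_iff:
  assumes M: "manifold M" and V: "openin (Euclidean_space m) V"
  shows "smooth_map (euclidean_open m V) M p \<longleftrightarrow> continuous_map (top_of_set V) (mtop M) p \<and>
    (\<forall>(U, n, \<phi>)\<in>charts M. \<forall>j<n. smooth_on {..<m} {x \<in> V. p x \<in> U} (\<lambda>x. \<phi> (p x) j))"
proof -
  have "smooth_fun m {x \<in> V. p x \<in> U} (\<lambda>x. local_rep (V, m, \<lambda>x. x) (U, n, \<phi>) p x j) \<longleftrightarrow>
      smooth_on {..<m} {x \<in> V. p x \<in> U} (\<lambda>x. \<phi> (p x) j)"
    if p: "continuous_map (top_of_set V) (mtop M) p" and c: "(U, n, \<phi>) \<in> charts M" for U n \<phi> j
  proof -
    have op: "openin (Euclidean_space m) {x \<in> V. p x \<in> U}"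
      by (rule openin_preimage_plot[OF V p manifold_chart(1)[OF M c]])
    have "inv_into V (\<lambda>x. x) x = x" if "x \<in> V" for x
      using inv_into_f_f[of "\<lambda>x. x" V x] that by auto
    then show ?thesis unfolding smooth_fun_iff[OF op]
      using op by (intro smooth_on_cong) (auto simp: local_rep_def openin_Euclidean_space)
  qed
  then show ?thesis
    unfolding smooth_map_def euclidean_open_def smooth_vfun_def
    by (auto simp: subtopology_Euclidean_space[OF V])
qed

lemma manifold_plots_iff:
  assumes M: "manifold M"
  shows "(m, V, p) \<in> plots (manifold_dspace M) \<longleftrightarrow> openin (Euclidean_space m) V \<and> p \<in> extensional V \<and>
    continuous_map (top_of_set V) (mtop M) p \<and>
    (\<forall>(U, n, \<phi>)\<in>charts M. \<forall>j<n. smooth_on {..<m} {x \<in> V. p x \<in> U} (\<lambda>x. \<phi> (p x) j))"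
proof (cases "openin (Euclidean_space m) V")
  case True
  show ?thesis
    using smooth_map_from_euclidean_iff[OF M True, of p]
    by (auto simp: manifold_dspace_def parametrisations_def PiE_def continuous_map_def)
qed (auto simp: manifold_dspace_def parametrisations_def)

lemma manifold_plotI:
  assumes M: "manifold M" and V: "openin (Euclidean_space m) V" and p: "continuous_map (top_of_set V) (mtop M) p"
    and sm: "\<And>U n \<phi> j. (U, n, \<phi>) \<in> charts M \<Longrightarrow> j < n \<Longrightarrow> smooth_on {..<m} {x \<in> V. p x \<in> U} (\<lambda>x. \<phi> (p x) j)"
  shows "(m, V, restrict p V) \<in> plots (manifold_dspace M)"
  unfolding manifold_plots_iff[OF M]
proof (intro conjI V)
  show "continuous_map (top_of_set V) (mtop M) (restrict p V)"
    using p by (rule continuous_map_eq) auto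
  show "\<forall>(U, n, \<phi>)\<in>charts M. \<forall>j<n. smooth_on {..<m} {x \<in> V. restrict p V x \<in> U} (\<lambda>x. \<phi> (restrict p V x) j)"
  proof clarify
    fix U n \<phi> j assume c: "(U, n, \<phi>) \<in> charts M" "j < n"
    have "{x \<in> V. restrict p V x \<in> U} = {x \<in> V. p x \<in> U}" by auto
    moreover have "open_in_coords {..<m} {x \<in> V. p x \<in> U}"
      using openin_preimage_plot[OF V p manifold_chart(1)[OF M c(1)]] by (simp add: openin_Euclidean_space)
    ultimately show "smooth_on {..<m} {x \<in> V. restrict p V x \<in> U} (\<lambda>x. \<phi> (restrict p V x) j)"
      using sm[OF c] smooth_on_cong[of "{..<m}" "{x \<in> V. p x \<in> U}" "\<lambda>x. \<phi> (p x) j" "\<lambda>x. \<phi> (restrict p V x) j"]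
      by simp
  qed
qed auto

lemma manifold_plot_comp:
  assumes M: "manifold M" and p: "(n, U, p) \<in> plots (manifold_dspace M)" and V: "openin (Euclidean_space m) V"
    and f: "smooth_map (euclidean_open m V) (euclidean_open n U) f"
  shows "(m, V, restrict (p \<circ> f) V) \<in> plots (manifold_dspace M)"
proof -
  have U: "openin (Euclidean_space n) U" and cp: "continuous_map (top_of_set U) (mtop M) p"
    and sp: "\<And>W l \<phi> j. (W, l, \<phi>) \<in> charts M \<Longrightarrow> j < l \<Longrightarrow> smooth_on {..<n} {x \<in> U. p x \<in> W} (\<lambda>x. \<phi> (p x) j)"
    using p unfolding manifold_plots_iff[OF M] by auto
  have fV: "f ` V \<subseteq> U" and sf: "\<And>j. j < n \<Longrightarrow> smooth_on {..<m} V (\<lambda>x. f x j)"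
    using f unfolding smooth_map_euclidean_open_iff[OF V U] by auto
  have cf: "continuous_map (top_of_set V) (top_of_set U) f"
    using f by (simp add: smooth_map_def euclidean_open_def subtopology_Euclidean_space U V)
  have c: "continuous_map (top_of_set V) (mtop M) (p \<circ> f)"
    by (rule continuous_map_compose[OF cf cp])
  show ?thesis
  proof (rule manifold_plotI[OF M V c])
    fix W l \<phi> j assume ch: "(W, l, \<phi>) \<in> charts M" "j < l"
    have "openin (Euclidean_space m) {x \<in> V. (p \<circ> f) x \<in> W}" "openin (Euclidean_space n) {x \<in> U. p x \<in> W}"
      by (rule openin_preimage_plot[OF V c manifold_chart(1)[OF M ch(1)]],
          rule openin_preimage_plot[OF U cp manifold_chart(1)[OF M ch(1)]])
    then have op: "open_in_coords {..<m} {x \<in> V. (p \<circ> f) x \<in> W}" "open_in_coords {..<n} {x \<in> U. p x \<in> W}"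
      by (simp_all add: openin_Euclidean_space)
    have "smooth_on {..<m} {x \<in> V. (p \<circ> f) x \<in> W} (\<lambda>x. \<phi> (p (f x)) j)"
      by (rule smooth_on_compose[OF _ op sp[OF ch], where G = f])
        (use fV in \<open>auto intro!: smooth_on_subset[OF sf]\<close>)
    then show "smooth_on {..<m} {x \<in> V. (p \<circ> f) x \<in> W} (\<lambda>x. \<phi> ((p \<circ> f) x) j)" by simp
  qed
qed

text \<open>Read in another chart, the inverse of a chart is a transition map. These plots make
  local coordinates available to forms that are given on plots.\<close>

lemma chart_plot:
  assumes M: "manifold M" and c: "(U, n, \<phi>) \<in> charts M"
  shows "(n, \<phi> ` U, restrict (inv_into U \<phi>) (\<phi> ` U)) \<in> plots (manifold_dspace M)"
proof (rule manifold_plotI[OF M manifold_chart(2)[OF M c] manifold_chart(5)[OF M c]])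
  fix V l \<psi> j assume d: "(V, l, \<psi>) \<in> charts M" "j < l"
  have eq: "{x \<in> \<phi> ` U. inv_into U \<phi> x \<in> V} = \<phi> ` (U \<inter> V)"
    using manifold_chart(3)[OF M c] by auto
  have op: "openin (Euclidean_space n) (\<phi> ` (U \<inter> V))"
    unfolding eq[symmetric]
    by (rule openin_preimage_plot[OF manifold_chart(2)[OF M c] manifold_chart(5)[OF M c] manifold_chart(1)[OF M d(1)]])
  have "smooth_vfun n l (\<phi> ` (U \<inter> V)) (local_rep (U, n, \<phi>) (V, l, \<psi>) (\<lambda>x. x))"
    using M c d(1) unfolding manifold_def by fast
  then have "smooth_fun n (\<phi> ` (U \<inter> V)) (\<lambda>x. \<psi> (inv_into U \<phi> x) j)"
    using d(2) by (simp add: smooth_vfun_def local_rep_def comp_def)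
  then show "smooth_on {..<n} {x \<in> \<phi> ` U. inv_into U \<phi> x \<in> V} (\<lambda>x. \<psi> (inv_into U \<phi> x) j)"
    unfolding eq smooth_fun_iff[OF op] .
qed

text \<open>Near a parameter the plot is routed through a chart of \<open>M\<close> around its
  value; in coordinates the composite is the local representative of \<open>f\<close> after the
  coordinate expression of the plot.\<close>

lemma smooth_map_plot:
  assumes M: "manifold M" and N: "manifold N" and f: "smooth_map M N f"
    and p: "(m, V, p) \<in> plots (manifold_dspace M)"
  shows "(m, V, restrict (f \<circ> p) V) \<in> plots (manifold_dspace N)"
proof -
  have V: "openin (Euclidean_space m) V" and cp: "continuous_map (top_of_set V) (mtop M) p"
    and sp: "\<And>W l \<phi> j. (W, l, \<phi>) \<in> charts M \<Longrightarrow> j < l \<Longrightarrow> smooth_on {..<m} {x \<in> V. p x \<in> W} (\<lambda>x. \<phi> (p x) j)"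
    using p unfolding manifold_plots_iff[OF M] by auto
  have cf: "continuous_map (mtop M) (mtop N) f" using f by (simp add: smooth_map_def)
  have c: "continuous_map (top_of_set V) (mtop N) (f \<circ> p)"
    by (rule continuous_map_compose[OF cp cf])
  show ?thesis
  proof (rule manifold_plotI[OF N V c], rule smooth_on_local)
    fix W l \<psi> j x assume d: "(W, l, \<psi>) \<in> charts N" "j < l" and x: "x \<in> {x \<in> V. (f \<circ> p) x \<in> W}"
    have "p x \<in> topspace (mtop M)" using cp x by (auto simp: continuous_map_def)
    then obtain U n \<phi> where ch: "(U, n, \<phi>) \<in> charts M" "p x \<in> U"
      using M unfolding manifold_def by fast
    note mc = manifold_chart[OF M ch(1)]
    define Z where "Z = {x \<in> V. p x \<in> {y \<in> U. f y \<in> W}}"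
    have "openin (mtop M) {y \<in> topspace (mtop M). f y \<in> W}"
      by (rule openin_continuous_map_preimage[OF cf manifold_chart(1)[OF N d(1)]])
    then have "openin (mtop M) (U \<inter> {y \<in> topspace (mtop M). f y \<in> W})" using mc(1) by blast
    moreover have "U \<inter> {y \<in> topspace (mtop M). f y \<in> W} = {y \<in> U. f y \<in> W}"
      using openin_subset[OF mc(1)] by auto
    ultimately have oU: "openin (mtop M) {y \<in> U. f y \<in> W}" by simp
    have Z: "openin (Euclidean_space m) Z"
      unfolding Z_def by (rule openin_preimage_plot[OF V cp oU])
    have "{y \<in> \<phi> ` U. inv_into U \<phi> y \<in> {y \<in> U. f y \<in> W}} = \<phi> ` {y \<in> U. f y \<in> W}"
      using mc(3) by auto
    then have op: "openin (Euclidean_space n) (\<phi> ` {y \<in> U. f y \<in> W})"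
      using openin_preimage_plot[OF mc(2,5) oU] by simp
    have "smooth_vfun n l (\<phi> ` {x \<in> U. f x \<in> W}) (local_rep (U, n, \<phi>) (W, l, \<psi>) f)"
      using f ch(1) d(1) unfolding smooth_map_def by fast
    then have sm: "smooth_on {..<n} (\<phi> ` {x \<in> U. f x \<in> W}) (\<lambda>x. \<psi> (f (inv_into U \<phi> x)) j)"
      using d(2) by (simp add: smooth_vfun_def local_rep_def comp_def smooth_fun_iff[OF op])
    have "smooth_on {..<m} Z (\<lambda>x. \<psi> (f (inv_into U \<phi> (\<phi> (p x)))) j)"
    proof (rule smooth_on_compose[OF _ _ _ sm, where G = "\<lambda>x. \<phi> (p x)"])
      show "smooth_on {..<m} Z (\<lambda>x. \<phi> (p x) i)" if "i \<in> {..<n}" for i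
        by (rule smooth_on_subset[OF sp[OF ch(1)]]) (use that in \<open>auto simp: Z_def\<close>)
    qed (use Z op in \<open>auto simp: openin_Euclidean_space Z_def\<close>)
    moreover have "inv_into U \<phi> (\<phi> (p x)) = p x" if "x \<in> Z" for x
      using that mc(3) by (simp add: Z_def)
    moreover have oZ: "open_in_coords {..<m} Z" using Z by (simp add: openin_Euclidean_space)
    ultimately have "smooth_on {..<m} Z (\<lambda>x. \<psi> ((f \<circ> p) x) j)"
      using smooth_on_cong[OF oZ, of "\<lambda>x. \<psi> (f (inv_into U \<phi> (\<phi> (p x)))) j" "\<lambda>x. \<psi> ((f \<circ> p) x) j"] by simp
    moreover have "x \<in> Z" "Z \<subseteq> {x \<in> V. (f \<circ> p) x \<in> W}" using x ch(2) by (auto simp: Z_def)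
    ultimately show "\<exists>Z. open_in_coords {..<m} Z \<and> x \<in> Z \<and> Z \<subseteq> {x \<in> V. (f \<circ> p) x \<in> W} \<and>
       smooth_on {..<m} Z (\<lambda>x. \<psi> ((f \<circ> p) x) j)" using oZ by blast
  qed
qed

section \<open>Agreement of pullbacks along plots with the same orbits\<close>

lemma dforms_eform: "\<alpha> \<in> dforms k X \<Longrightarrow> (n, U, p) \<in> plots X \<Longrightarrow> \<alpha> (n, U, p) \<in> eforms k n U"
  unfolding dforms_def by fast

lemma dforms_pullback_apply:
  assumes "\<alpha> \<in> dforms k X" "(n, U, p) \<in> plots X" "openin (Euclidean_space m) V"
    "smooth_map (euclidean_open m V) (euclidean_open n U) f"
  shows "\<alpha> (m, V, restrict (p \<circ> f) V) = eform_pullback m V f (\<alpha> (n, U, p))"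
  using assms unfolding dforms_def by fast

lemma dforms_eval:
  assumes "\<alpha> \<in> dforms k X" "(n, U, p) \<in> plots X" "openin (Euclidean_space m) V"
    "smooth_map (euclidean_open m V) (euclidean_open n U) f" "y \<in> V" "set ws \<subseteq> coord_space {..<m}"
  shows "\<alpha> (m, V, restrict (p \<circ> f) V) y ws = \<alpha> (n, U, p) (f y) (map (tangent_map m f y) ws)"
  using assms(5,6) by (simp add: dforms_pullback_apply[OF assms(1-4)] eform_pullback_def topspace_Euclidean)

lemma eforms_zero:
  "\<omega> \<in> eforms k n U \<Longrightarrow> x \<notin> U \<or> length ws \<noteq> k \<or> \<not> set ws \<subseteq> coord_space {..<n} \<Longrightarrow> \<omega> x ws = 0"
  unfolding eforms_def topspace_Euclidean by auto

lemma partial_coord: "partial i (\<lambda>x. x j) x = (if i = j then 1 else 0)"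
  by (rule partial_eqI) (cases "i = j"; auto)

lemma tangent_map_ident:
  assumes "w \<in> coord_space {..<n}"
  shows "tangent_map n (\<lambda>x. x) u w = w"
proof
  fix j
  have "(\<Sum>i<n. partial i (\<lambda>z. z j) u * w i) = (\<Sum>i<n. if i = j then w i else 0)"
    by (intro sum.cong) (auto simp: partial_coord)
  then show "tangent_map n (\<lambda>x. x) u w j = w j"
    using assms by (auto simp: tangent_map_def coord_space_def)
qed

lemma smooth_map_inclusion:
  assumes "openin (Euclidean_space n) U" "openin (Euclidean_space n) V" "V \<subseteq> U"
  shows "smooth_map (euclidean_open n V) (euclidean_open n U) (\<lambda>x. x)"
  unfolding smooth_map_euclidean_open_iff[OF assms(2,1)] smooth_on_def
  using assms by (auto simp: openin_Euclidean_space intro: Ck_coord)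

text \<open>Naturality along the inclusion of \<open>V\<close>, whose tangent map is the
  identity.\<close>

lemma dforms_restrict_eval:
  assumes \<alpha>: "\<alpha> \<in> dforms k X" and p: "(n, U, p) \<in> plots X" and U: "openin (Euclidean_space n) U"
    and V: "openin (Euclidean_space n) V" "V \<subseteq> U" and u: "u \<in> V" and ws: "set ws \<subseteq> coord_space {..<n}"
  shows "\<alpha> (n, V, restrict p V) u ws = \<alpha> (n, U, p) u ws"
proof -
  have "map (tangent_map n (\<lambda>x. x) u) ws = map (\<lambda>w. w) ws"
    by (rule map_cong[OF refl]) (use ws tangent_map_ident in auto)
  then show ?thesis
    using dforms_eval[OF \<alpha> p V(1) smooth_map_inclusion[OF U V] u ws] by (simp add: comp_def)
qed

lemma tangent_map_in_coords:
  assumes V: "open_in_coords {..<m} V" "u \<in> V" and f: "\<And>z. z \<in> V \<Longrightarrow> f z \<in> coord_space {..<n}"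
  shows "tangent_map m f u w \<in> coord_space {..<n}"
proof -
  have "partial i (\<lambda>z. f z j) u = 0" if "i < m" "\<not> j < n" for i j
  proof -
    have "partial i (\<lambda>z. f z j) u = partial i (\<lambda>z. 0) u"
      by (rule partial_cong[OF V(1) _ V(2)]) (use f that in \<open>auto simp: coord_space_def\<close>)
    also have "\<dots> = 0" by (simp add: partial_def)
    finally show ?thesis .
  qed
  then show ?thesis by (auto simp: coord_space_def tangent_map_def)
qed

text \<open>Near \<open>u\<close> the plot factors through the inverse chart, so naturality
  expresses its value by the point \<open>r u\<close> and the pushed-forward vectors alone. The
  second claim keeps these vectors inside the space of the chart, so that comparing components below
  \<open>n\<close> is enough later.\<close>

lemma manifold_dform_eval_chart:
  assumes M: "manifold M" and \<alpha>: "\<alpha> \<in> dforms k (manifold_dspace M)" and r: "(m, V, r) \<in> plots (manifold_dspace M)"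
    and c: "(U, n, \<phi>) \<in> charts M" and u: "u \<in> V" "r u \<in> U" and ws: "set ws \<subseteq> coord_space {..<m}"
  shows "\<alpha> (m, V, r) u ws = \<alpha> (n, \<phi> ` U, restrict (inv_into U \<phi>) (\<phi> ` U)) (\<phi> (r u)) (map (tangent_map m (\<lambda>x. \<phi> (r x)) u) ws)"
    and "tangent_map m (\<lambda>x. \<phi> (r x)) u w \<in> coord_space {..<n}"
proof -
  note mc = manifold_chart[OF M c]
  define V' where "V' = {x \<in> V. r x \<in> U}"
  have V: "openin (Euclidean_space m) V" and cr: "continuous_map (top_of_set V) (mtop M) r"
    and sr: "\<And>j. j < n \<Longrightarrow> smooth_on {..<m} V' (\<lambda>x. \<phi> (r x) j)"
    using r c unfolding manifold_plots_iff[OF M] V'_def by auto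
  have V': "openin (Euclidean_space m) V'" unfolding V'_def by (rule openin_preimage_plot[OF V cr mc(1)])
  have sm: "smooth_map (euclidean_open m V') (euclidean_open n (\<phi> ` U)) (\<lambda>x. \<phi> (r x))"
    unfolding smooth_map_euclidean_open_iff[OF V' mc(2)] using sr by (auto simp: V'_def)
  have "restrict (restrict (inv_into U \<phi>) (\<phi> ` U) \<circ> (\<lambda>x. \<phi> (r x))) V' = restrict r V'"
    using mc(3) by (auto simp: V'_def restrict_def)
  then have "\<alpha> (m, V', restrict r V') u ws =
      \<alpha> (n, \<phi> ` U, restrict (inv_into U \<phi>) (\<phi> ` U)) (\<phi> (r u)) (map (tangent_map m (\<lambda>x. \<phi> (r x)) u) ws)"
    using dforms_eval[OF \<alpha> chart_plot[OF M c] V' sm _ ws] u by (simp add: V'_def)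
  moreover have "\<alpha> (m, V', restrict r V') u ws = \<alpha> (m, V, r) u ws"
    by (rule dforms_restrict_eval[OF \<alpha> r V V' _ _ ws]) (use u in \<open>auto simp: V'_def\<close>)
  ultimately show "\<alpha> (m, V, r) u ws = \<alpha> (n, \<phi> ` U, restrict (inv_into U \<phi>) (\<phi> ` U)) (\<phi> (r u)) (map (tangent_map m (\<lambda>x. \<phi> (r x)) u) ws)"
    by simp
  have "\<phi> (r z) \<in> coord_space {..<n}" if "z \<in> V'" for z
    using that mc(2) by (auto simp: V'_def openin_Euclidean_space dest: open_in_coords_subset)
  then show "tangent_map m (\<lambda>x. \<phi> (r x)) u w \<in> coord_space {..<n}"
    by (intro tangent_map_in_coords[of _ V']) (use V' u in \<open>auto simp: V'_def openin_Euclidean_space\<close>)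
qed

text \<open>Both sides reduce to the same chart plot at the same point on the same vectors. The
  lemma moves a value along \<open>r\<close> to the plot \<open>s\<close>, which will be source or
  target composed with an inverse chart of the arrows.\<close>

lemma manifold_dform_eval_lift:
  assumes M: "manifold M" and \<alpha>: "\<alpha> \<in> dforms k (manifold_dspace M)"
    and r: "(m, V, r) \<in> plots (manifold_dspace M)" and s: "(N, W, s) \<in> plots (manifold_dspace M)"
    and u: "u \<in> V" and c: "c \<in> W" and eq: "s c = r u" and ch: "(U, n, \<phi>) \<in> charts M" "r u \<in> U"
    and ws: "set ws \<subseteq> coord_space {..<m}"
    and lift: "\<And>w. w \<in> set ws \<Longrightarrow> \<xi> w \<in> coord_space {..<N}"
      "\<And>w j. w \<in> set ws \<Longrightarrow> j < n \<Longrightarrow> tangent_map N (\<lambda>x. \<phi> (s x)) c (\<xi> w) j = tangent_map m (\<lambda>x. \<phi> (r x)) u w j"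
  shows "\<alpha> (m, V, r) u ws = \<alpha> (N, W, s) c (map \<xi> ws)"
proof -
  have sc: "s c \<in> U" using eq ch by simp
  have \<xi>s: "set (map \<xi> ws) \<subseteq> coord_space {..<N}" using lift(1) by auto
  have "tangent_map N (\<lambda>x. \<phi> (s x)) c (\<xi> w) = tangent_map m (\<lambda>x. \<phi> (r x)) u w" if "w \<in> set ws" for w
  proof
    fix j
    show "tangent_map N (\<lambda>x. \<phi> (s x)) c (\<xi> w) j = tangent_map m (\<lambda>x. \<phi> (r x)) u w j"
    proof (cases "j < n")
      case False
      then show ?thesis
        using manifold_dform_eval_chart(2)[OF M \<alpha> r ch(1) u ch(2) ws, of w]
          manifold_dform_eval_chart(2)[OF M \<alpha> s ch(1) c sc \<xi>s, of "\<xi> w"]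
        by (simp add: coord_space_def)
    qed (rule lift(2)[OF that])
  qed
  then show ?thesis
    unfolding manifold_dform_eval_chart(1)[OF M \<alpha> r ch(1) u ch(2) ws]
      manifold_dform_eval_chart(1)[OF M \<alpha> s ch(1) c sc \<xi>s] eq by (simp cong: map_cong)
qed

section \<open>Comparison of two plots through good arrows\<close>

definition unit_vec :: "nat \<Rightarrow> vec" where
  "unit_vec p = (\<lambda>j. if j = p then 1 else 0)"

lemma tangent_map_unit_vec: "p < m \<Longrightarrow> tangent_map m f u (unit_vec p) j = partial p (\<lambda>z. f z j) u"
proof -
  assume p: "p < m"
  have "(\<Sum>i<m. partial i (\<lambda>z. f z j) u * unit_vec p i) = (\<Sum>i<m. if i = p then partial i (\<lambda>z. f z j) u else 0)"
    by (intro sum.cong) (auto simp: unit_vec_def)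
  then show ?thesis using p by (simp add: tangent_map_def)
qed

lemma inj_unit_vec: "unit_vec p = unit_vec p' \<longleftrightarrow> p = p'"
proof
  assume "unit_vec p = unit_vec p'"
  then have "unit_vec p p = unit_vec p' p" by simp
  then show "p = p'" by (simp add: unit_vec_def split: if_splits)
qed simp

text \<open>Supplies the compact pieces of the space of arrows: \<open>C\<close> is a closed cube of
  half the admissible size about the image of \<open>g\<close>, and \<open>Og\<close> is the
  preimage of the open cube of the same size.\<close>

lemma chart_cube:
  assumes A: "manifold A" and Q: "openin (mtop A) Q" and g: "g \<in> Q"
  shows "\<exists>U N \<kappa> C Og. (U, N, \<kappa>) \<in> charts A \<and> g \<in> Og \<and> openin (mtop A) Og \<and> Og \<subseteq> U \<inter> Q \<and> compact C \<and>
    C \<subseteq> \<kappa> ` (U \<inter> Q) \<and> \<kappa> ` Og \<subseteq> C \<and> openin (Euclidean_space N) (\<kappa> ` (U \<inter> Q))"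
proof -
  have "g \<in> topspace (mtop A)" using openin_subset[OF Q] g by auto
  then obtain U N \<kappa> where ch: "(U, N, \<kappa>) \<in> charts A" "g \<in> U"
    using A unfolding manifold_def by fast
  note mc = manifold_chart[OF A ch(1)]
  have "{x \<in> \<kappa> ` U. inv_into U \<kappa> x \<in> Q} = \<kappa> ` (U \<inter> Q)" using mc(3) by auto
  then have op: "openin (Euclidean_space N) (\<kappa> ` (U \<inter> Q))"
    using openin_preimage_plot[OF mc(2,5) Q] by simp
  then obtain e where e: "e > 0"
    "\<And>y. y \<in> coord_space {..<N} \<Longrightarrow> (\<And>i. i \<in> {..<N} \<Longrightarrow> \<bar>y i - \<kappa> g i\<bar> < e) \<Longrightarrow> y \<in> \<kappa> ` (U \<inter> Q)"
    using open_in_coords_box[of "{..<N}" "\<kappa> ` (U \<inter> Q)" "\<kappa> g"] ch g by (auto simp: openin_Euclidean_space)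
  define C where "C = {x \<in> coord_space {..<N}. \<forall>i\<in>{..<N}. \<bar>x i - \<kappa> g i\<bar> \<le> e / 2}"
  define B where "B = {x \<in> coord_space {..<N}. \<forall>i\<in>{..<N}. \<bar>x i - \<kappa> g i\<bar> < e / 2}"
  define Og where "Og = {h \<in> topspace (subtopology (mtop A) U). \<kappa> h \<in> \<kappa> ` U \<inter> B} \<inter> Q"
  have CQ: "C \<subseteq> \<kappa> ` (U \<inter> Q)"
  proof
    fix x assume x: "x \<in> C"
    have "\<bar>x i - \<kappa> g i\<bar> < e" if "i \<in> {..<N}" for i
      using x that e(1) unfolding C_def by (smt (verit) field_sum_of_halves mem_Collect_eq)
    then show "x \<in> \<kappa> ` (U \<inter> Q)" using x by (intro e(2)) (auto simp: C_def)
  qed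
  have BC: "B \<subseteq> C" by (auto simp: B_def C_def less_imp_le)
  have "open_in_coords {..<N} B" unfolding B_def by (rule open_in_coords_cube) auto
  then have "openin (top_of_set (\<kappa> ` U)) (\<kappa> ` U \<inter> B)"
    using mc(2) open_in_coords_subset[of "{..<N}" "\<kappa> ` U"] unfolding openin_Euclidean_space
    by (metis Int_lower1 openin_Int openin_subset_trans)
  then have "openin (subtopology (mtop A) U) {h \<in> topspace (subtopology (mtop A) U). \<kappa> h \<in> \<kappa> ` U \<inter> B}"
    by (rule openin_continuous_map_preimage[OF mc(4)])
  then have oO: "openin (mtop A) Og"
    unfolding Og_def using mc(1) Q by (intro openin_Int) (auto simp: openin_open_subtopology)
  have gV: "\<kappa> g \<in> coord_space {..<N}"
    using op ch g by (auto simp: openin_Euclidean_space dest!: open_in_coords_subset)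
  have tU: "topspace (subtopology (mtop A) U) = U" using openin_subset[OF mc(1)] by auto
  have "g \<in> Og" using ch g gV e(1) tU by (auto simp: Og_def B_def)
  moreover have "Og \<subseteq> U \<inter> Q" using tU by (auto simp: Og_def)
  moreover have "\<kappa> ` Og \<subseteq> C" using BC by (auto simp: Og_def)
  moreover have "compact C" unfolding C_def by (rule compact_coord_cube)
  ultimately show ?thesis using ch(1) oO CQ op by blast
qed

text \<open>Off the exceptional sets, any arrow in \<open>Og\<close> from \<open>r1 u\<close> to
  \<open>r2 u\<close> admits lifts of all unit vectors through source and target simultaneously. The
  value along \<open>r1\<close> is then that of the source pullback on the lifts, the value along
  \<open>r2\<close> that of the target pullback, and the two pullbacks coincide by
  hypothesis.\<close>

lemma local_agreement:
  fixes r1 r2 :: "vec \<Rightarrow> 'o" and s t :: "'m \<Rightarrow> 'o"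
  assumes M: "manifold M" and A: "manifold A" and s: "smooth_map A M s" and t: "smooth_map A M t"
    and \<alpha>: "\<alpha> \<in> dforms k (manifold_dspace M)"
    and st: "\<And>n U p. (n, U, p) \<in> plots (manifold_dspace A) \<Longrightarrow> \<alpha> (n, U, restrict (s \<circ> p) U) = \<alpha> (n, U, restrict (t \<circ> p) U)"
    and r1: "(k, V, r1) \<in> plots (manifold_dspace M)" and r2: "(k, V, r2) \<in> plots (manifold_dspace M)"
    and c1: "(U1, m1, \<phi>1) \<in> charts M" and c2: "(U2, m2, \<phi>2) \<in> charts M"
    and D: "compact D" "D \<subseteq> {y \<in> V. r1 y \<in> U1 \<and> r2 y \<in> U2}"
    and g: "g \<in> topspace (mtop A)" "s g \<in> U1" "t g \<in> U2"
  shows "\<exists>Og \<G>. g \<in> Og \<and> openin (mtop A) Og \<and> countable \<G> \<and>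
    (\<forall>T\<in>\<G>. closedin (top_of_set (coord_space {..<k})) T \<and> top_of_set (coord_space {..<k}) interior_of T = {}) \<and>
    (\<forall>u\<in>D - \<Union>\<G>. \<forall>h\<in>Og. s h = r1 u \<and> t h = r2 u \<longrightarrow>
       \<alpha> (k, V, r1) u (map unit_vec [0..<k]) = \<alpha> (k, V, r2) u (map unit_vec [0..<k]))"
proof -
  note mc1 = manifold_chart[OF M c1] and mc2 = manifold_chart[OF M c2]
  have V: "openin (Euclidean_space k) V" and cr1: "continuous_map (top_of_set V) (mtop M) r1"
    and cr2: "continuous_map (top_of_set V) (mtop M) r2"
    and sr1: "\<And>j. j < m1 \<Longrightarrow> smooth_on {..<k} {x \<in> V. r1 x \<in> U1} (\<lambda>x. \<phi>1 (r1 x) j)"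
    and sr2: "\<And>j. j < m2 \<Longrightarrow> smooth_on {..<k} {x \<in> V. r2 x \<in> U2} (\<lambda>x. \<phi>2 (r2 x) j)"
    using r1 r2 c1 c2 unfolding manifold_plots_iff[OF M] by auto
  define Op where "Op = {y \<in> V. r1 y \<in> U1} \<inter> {y \<in> V. r2 y \<in> U2}"
  have Op: "open_in_coords {..<k} Op"
    unfolding Op_def openin_Euclidean_space[symmetric]
    by (intro openin_Int openin_preimage_plot[OF V cr1 mc1(1)] openin_preimage_plot[OF V cr2 mc2(1)])
  \<comment> \<open>Source and target coordinates are stacked into one system of
    \<open>m1 + m2\<close> equations, so that a solution is a common lift for both maps.\<close>
  define q where "q j x = (if j < m1 then \<phi>1 (r1 x) j else \<phi>2 (r2 x) (j - m1))" for j x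
  have q: "smooth_on {..<k} Op (q j)" if "j \<in> {..<m1 + m2}" for j
  proof (cases "j < m1")
    case True
    then show ?thesis unfolding q_def using smooth_on_subset[OF sr1[OF True], of Op] by (simp add: Op_def)
  next
    case False
    then have "j - m1 < m2" using that by auto
    then show ?thesis unfolding q_def using False smooth_on_subset[OF sr2, of "j - m1" Op] by (simp add: Op_def)
  qed
  have cs: "continuous_map (mtop A) (mtop M) s" and ct: "continuous_map (mtop A) (mtop M) t"
    using s t by (auto simp: smooth_map_def)
  define Q where "Q = {h \<in> topspace (mtop A). s h \<in> U1} \<inter> {h \<in> topspace (mtop A). t h \<in> U2}"
  have Q: "openin (mtop A) Q"
    unfolding Q_def by (intro openin_Int openin_continuous_map_preimage[OF cs mc1(1)]
        openin_continuous_map_preimage[OF ct mc2(1)])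
  have "g \<in> Q" using g by (simp add: Q_def)
  from chart_cube[OF A Q this] obtain Ug N \<kappa> C Og where ch: "(Ug, N, \<kappa>) \<in> charts A" and Og: "g \<in> Og" "openin (mtop A) Og"
      "Og \<subseteq> Ug \<inter> Q" and C: "compact C" "C \<subseteq> \<kappa> ` (Ug \<inter> Q)" "\<kappa> ` Og \<subseteq> C"
      and W: "openin (Euclidean_space N) (\<kappa> ` (Ug \<inter> Q))" by blast
  note mg = manifold_chart[OF A ch]
  define ci where "ci = restrict (inv_into Ug \<kappa>) (\<kappa> ` Ug)"
  define rs where "rs = restrict (s \<circ> ci) (\<kappa> ` Ug)"
  define rt where "rt = restrict (t \<circ> ci) (\<kappa> ` Ug)"
  have ci: "(N, \<kappa> ` Ug, ci) \<in> plots (manifold_dspace A)" unfolding ci_def by (rule chart_plot[OF A ch])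
  have prs: "(N, \<kappa> ` Ug, rs) \<in> plots (manifold_dspace M)" unfolding rs_def by (rule smooth_map_plot[OF A M s ci])
  have prt: "(N, \<kappa> ` Ug, rt) \<in> plots (manifold_dspace M)" unfolding rt_def by (rule smooth_map_plot[OF A M t ci])
  have eqst: "\<alpha> (N, \<kappa> ` Ug, rs) = \<alpha> (N, \<kappa> ` Ug, rt)" unfolding rs_def rt_def by (rule st[OF ci])
  have rsx: "rs (\<kappa> h) = s h" "rt (\<kappa> h) = t h" if "h \<in> Ug" for h
    using that mg(3) by (auto simp: rs_def rt_def ci_def)
  have srs: "\<And>j. j < m1 \<Longrightarrow> smooth_on {..<N} {x \<in> \<kappa> ` Ug. rs x \<in> U1} (\<lambda>x. \<phi>1 (rs x) j)"
    and srt: "\<And>j. j < m2 \<Longrightarrow> smooth_on {..<N} {x \<in> \<kappa> ` Ug. rt x \<in> U2} (\<lambda>x. \<phi>2 (rt x) j)"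
    using prs prt c1 c2 unfolding manifold_plots_iff[OF M] by auto
  define F where "F j x = (if j < m1 then \<phi>1 (rs x) j else \<phi>2 (rt x) (j - m1))" for j x
  have WQ: "\<kappa> ` (Ug \<inter> Q) \<subseteq> {x \<in> \<kappa> ` Ug. rs x \<in> U1}" "\<kappa> ` (Ug \<inter> Q) \<subseteq> {x \<in> \<kappa> ` Ug. rt x \<in> U2}"
    using rsx by (auto simp: Q_def)
  have F: "smooth_on {..<N} (\<kappa> ` (Ug \<inter> Q)) (F j)" if "j \<in> {..<m1 + m2}" for j
  proof (cases "j < m1")
    case True
    then show ?thesis unfolding F_def using smooth_on_subset[OF srs[OF True] WQ(1)] by simp
  next
    case False
    then have "j - m1 < m2" using that by auto
    then show ?thesis unfolding F_def using False smooth_on_subset[OF srt WQ(2), of "j - m1"] by simp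
  qed
  have DOp: "D \<subseteq> Op" using D(2) by (auto simp: Op_def)
  have "\<exists>\<G>. countable \<G> \<and>
     (\<forall>T\<in>\<G>. closedin (top_of_set (coord_space {..<k})) T \<and> top_of_set (coord_space {..<k}) interior_of T = {}) \<and>
     (\<forall>u\<in>D - \<Union>\<G>. \<forall>g\<in>C. (\<forall>j\<in>{..<m1 + m2}. F j g = q j u) \<longrightarrow>
       (\<forall>p<k. \<exists>\<xi>. \<forall>j\<in>{..<m1 + m2}. (\<Sum>i<N. partial i (F j) g * \<xi> i) = partial p (q j) u))"
    by (rule obstruction_meager[OF _ Op q D(1) DOp W[unfolded openin_Euclidean_space] F C(1,2)]) simp
  then obtain \<G> where \<G>: "countable \<G> \<and>
     (\<forall>T\<in>\<G>. closedin (top_of_set (coord_space {..<k})) T \<and> top_of_set (coord_space {..<k}) interior_of T = {}) \<and>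
     (\<forall>u\<in>D - \<Union>\<G>. \<forall>g\<in>C. (\<forall>j\<in>{..<m1 + m2}. F j g = q j u) \<longrightarrow>
       (\<forall>p<k. \<exists>\<xi>. \<forall>j\<in>{..<m1 + m2}. (\<Sum>i<N. partial i (F j) g * \<xi> i) = partial p (q j) u))" ..
  have "\<alpha> (k, V, r1) u (map unit_vec [0..<k]) = \<alpha> (k, V, r2) u (map unit_vec [0..<k])"
    if u: "u \<in> D - \<Union>\<G>" and h: "h \<in> Og" "s h = r1 u" "t h = r2 u" for u h
  proof -
    let ?es = "map unit_vec [0..<k]"
    have hU: "h \<in> Ug" "\<kappa> h \<in> C" using h(1) Og C by auto
    have uV: "u \<in> V" "r1 u \<in> U1" "r2 u \<in> U2" using u DOp by (auto simp: Op_def)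
    have cW: "\<kappa> h \<in> \<kappa> ` Ug" using hU by auto
    have "F j (\<kappa> h) = q j u" for j using hU h rsx by (simp add: F_def q_def)
    then have "\<forall>p<k. \<exists>\<xi>. \<forall>j\<in>{..<m1 + m2}. (\<Sum>i<N. partial i (F j) (\<kappa> h) * \<xi> i) = partial p (q j) u"
      using bspec[OF bspec[OF conjunct2[OF conjunct2[OF \<G>]] u] hU(2)] by simp
    then obtain \<xi> where \<xi>: "\<And>p j. p < k \<Longrightarrow> j < m1 + m2 \<Longrightarrow> (\<Sum>i<N. partial i (F j) (\<kappa> h) * \<xi> p i) = partial p (q j) u"
      by (metis lessThan_iff)
    \<comment> \<open>The lifts come indexed by directions, whereas
      \<open>manifold_dform_eval_lift\<close> wants a function of the vector, so the index is
      recovered from the unit vector. Entries from \<open>N\<close> on are set to 0 to obtain a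
      point of the coordinate space.\<close>
    define \<eta> where "\<eta> w = (\<lambda>i. if i < N then \<xi> (THE p. w = unit_vec p) i else 0)" for w
    have \<eta>: "\<eta> (unit_vec p) = (\<lambda>i. if i < N then \<xi> p i else 0)" for p
    proof -
      have the: "(THE p'. unit_vec p = unit_vec p') = p" by (simp add: inj_unit_vec)
      show ?thesis unfolding \<eta>_def the ..
    qed
    have T: "tangent_map N f (\<kappa> h) (\<eta> (unit_vec p)) j = (\<Sum>i<N. partial i (\<lambda>z. f z j) (\<kappa> h) * \<xi> p i)" for f p j
      unfolding tangent_map_def \<eta> by (intro sum.cong) auto
    have es: "set ?es \<subseteq> coord_space {..<k}" by (auto simp: unit_vec_def coord_space_def)
    have 1: "\<alpha> (k, V, r1) u ?es = \<alpha> (N, \<kappa> ` Ug, rs) (\<kappa> h) (map \<eta> ?es)"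
    proof (rule manifold_dform_eval_lift[OF M \<alpha> r1 prs uV(1) cW _ c1 uV(2) es])
      show "rs (\<kappa> h) = r1 u" using rsx hU h by simp
      show "\<eta> w \<in> coord_space {..<N}" for w by (simp add: \<eta>_def coord_space_def)
      fix w j assume w: "w \<in> set ?es" and j: "j < m1"
      then obtain p where p: "p < k" "w = unit_vec p" by auto
      have Fj: "F j = (\<lambda>z. \<phi>1 (rs z) j)" and qj: "q j = (\<lambda>z. \<phi>1 (r1 z) j)" using j by (auto simp: F_def q_def)
      show "tangent_map N (\<lambda>x. \<phi>1 (rs x)) (\<kappa> h) (\<eta> w) j = tangent_map k (\<lambda>x. \<phi>1 (r1 x)) u w j"
        using \<xi>[OF p(1), of j] j unfolding p(2) T tangent_map_unit_vec[OF p(1)] Fj qj by simp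
    qed
    have 2: "\<alpha> (k, V, r2) u ?es = \<alpha> (N, \<kappa> ` Ug, rt) (\<kappa> h) (map \<eta> ?es)"
    proof (rule manifold_dform_eval_lift[OF M \<alpha> r2 prt uV(1) cW _ c2 uV(3) es])
      show "rt (\<kappa> h) = r2 u" using rsx hU h by simp
      show "\<eta> w \<in> coord_space {..<N}" for w by (simp add: \<eta>_def coord_space_def)
      fix w j assume w: "w \<in> set ?es" and j: "j < m2"
      then obtain p where p: "p < k" "w = unit_vec p" by auto
      have Fj: "F (j + m1) = (\<lambda>z. \<phi>2 (rt z) j)" and qj: "q (j + m1) = (\<lambda>z. \<phi>2 (r2 z) j)" by (auto simp: F_def q_def)
      show "tangent_map N (\<lambda>x. \<phi>2 (rt x)) (\<kappa> h) (\<eta> w) j = tangent_map k (\<lambda>x. \<phi>2 (r2 x)) u w j"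
        using \<xi>[OF p(1), of "j + m1"] j unfolding p(2) T tangent_map_unit_vec[OF p(1)] Fj qj by simp
    qed
    show ?thesis unfolding 1 2 eqst ..
  qed
  then show ?thesis using Og(1,2) \<G> by (intro exI[of _ Og] exI[of _ \<G>]) simp
qed

text \<open>Disagreement at \<open>y\<close> would be an open condition, so one good parameter close
  enough to \<open>y\<close> refutes it. Properness serves twice: the arrows from
  \<open>r1 y\<close> to \<open>r2 y\<close> form a compact set, and closedness of
  \<open>(s, t)\<close> confines the arrows over nearby parameters to a chosen neighbourhood of that
  set.\<close>

lemma agreement_on_unit_vecs:
  fixes r1 r2 :: "vec \<Rightarrow> 'o" and s t :: "'m \<Rightarrow> 'o"
  assumes M: "manifold M" and A: "manifold A" and s: "smooth_map A M s" and t: "smooth_map A M t"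
    and pr: "proper_map (mtop A) (prod_topology (mtop M) (mtop M)) (\<lambda>g. (s g, t g))"
    and \<alpha>: "\<alpha> \<in> dforms k (manifold_dspace M)"
    and st: "\<And>n U p. (n, U, p) \<in> plots (manifold_dspace A) \<Longrightarrow> \<alpha> (n, U, restrict (s \<circ> p) U) = \<alpha> (n, U, restrict (t \<circ> p) U)"
    and r1: "(k, V, r1) \<in> plots (manifold_dspace M)" and r2: "(k, V, r2) \<in> plots (manifold_dspace M)"
    and orb: "\<And>v. v \<in> V \<Longrightarrow> \<exists>g\<in>topspace (mtop A). s g = r1 v \<and> t g = r2 v"
    and y: "y \<in> V"
  shows "\<alpha> (k, V, r1) y (map unit_vec [0..<k]) = \<alpha> (k, V, r2) y (map unit_vec [0..<k])"
proof (rule ccontr)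
  let ?es = "map unit_vec [0..<k]"
  assume neq: "\<alpha> (k, V, r1) y ?es \<noteq> \<alpha> (k, V, r2) y ?es"
  have V: "openin (Euclidean_space k) V" and cr1: "continuous_map (top_of_set V) (mtop M) r1"
    and cr2: "continuous_map (top_of_set V) (mtop M) r2"
    using r1 r2 unfolding manifold_plots_iff[OF M] by auto
  have Vk: "open_in_coords {..<k} V" using V by (simp add: openin_Euclidean_space)
  have es: "length ?es = k" "set ?es \<subseteq> topspace (Euclidean_space k)"
    by (auto simp: unit_vec_def coord_space_def topspace_Euclidean)
  have cont: "continuous_on V (\<lambda>x. \<alpha> (k, V, r) x ?es)" if "(k, V, r) \<in> plots (manifold_dspace M)" for r
  proof -
    have "smooth_fun k V (\<lambda>x. \<alpha> (k, V, r) x ?es)"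
      using dforms_eform[OF \<alpha> that] es unfolding eforms_def by blast
    then show ?thesis unfolding smooth_fun_iff[OF V] by (rule smooth_on_continuous) simp
  qed
  define V0 where "V0 = {x \<in> V. \<alpha> (k, V, r1) x ?es - \<alpha> (k, V, r2) x ?es \<in> - {0}}"
  have V0: "open_in_coords {..<k} V0"
    unfolding V0_def by (intro open_in_coords_Collect[OF Vk] continuous_on_diff cont r1 r2) auto
  have rM: "r1 v \<in> topspace (mtop M)" "r2 v \<in> topspace (mtop M)" if "v \<in> V" for v
    using cr1 cr2 that by (auto simp: continuous_map_def)
  obtain U1 m1 \<phi>1 where c1: "(U1, m1, \<phi>1) \<in> charts M" "r1 y \<in> U1"
    using M rM(1)[OF y] unfolding manifold_def by fast
  obtain U2 m2 \<phi>2 where c2: "(U2, m2, \<phi>2) \<in> charts M" "r2 y \<in> U2"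
    using M rM(2)[OF y] unfolding manifold_def by fast
  note mc1 = manifold_chart[OF M c1(1)] and mc2 = manifold_chart[OF M c2(1)]
  define Op where "Op = V0 \<inter> ({y \<in> V. r1 y \<in> U1} \<inter> {y \<in> V. r2 y \<in> U2})"
  have Op: "open_in_coords {..<k} Op"
    unfolding Op_def openin_Euclidean_space[symmetric]
    by (intro openin_Int V0[folded openin_Euclidean_space] openin_preimage_plot[OF V cr1 mc1(1)] openin_preimage_plot[OF V cr2 mc2(1)])
  have yOp: "y \<in> Op" using y neq c1 c2 by (auto simp: Op_def V0_def)
  obtain e where e: "e > 0" "\<And>x. x \<in> coord_space {..<k} \<Longrightarrow> (\<And>i. i \<in> {..<k} \<Longrightarrow> \<bar>x i - y i\<bar> < e) \<Longrightarrow> x \<in> Op"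
    using open_in_coords_box[OF _ Op yOp] by auto
  define D where "D = {x \<in> coord_space {..<k}. \<forall>i\<in>{..<k}. \<bar>x i - y i\<bar> \<le> e / 2}"
  define B where "B = {x \<in> coord_space {..<k}. \<forall>i\<in>{..<k}. \<bar>x i - y i\<bar> < e / 2}"
  have D: "compact D" unfolding D_def by (rule compact_coord_cube)
  have B: "open_in_coords {..<k} B" unfolding B_def by (rule open_in_coords_cube) auto
  have BD: "B \<subseteq> D" by (auto simp: B_def D_def less_imp_le)
  have DOp: "D \<subseteq> Op"
  proof
    fix x assume x: "x \<in> D"
    have "\<bar>x i - y i\<bar> < e" if "i \<in> {..<k}" for i
      using x that e(1) unfolding D_def by (smt (verit) field_sum_of_halves mem_Collect_eq)
    then show "x \<in> Op" using x by (intro e(2)) (auto simp: D_def)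
  qed
  have yB: "y \<in> B" using y e(1) open_in_coords_subset[OF Vk] by (auto simp: B_def)
  have DU: "D \<subseteq> {y \<in> V. r1 y \<in> U1 \<and> r2 y \<in> U2}" using DOp by (auto simp: Op_def)
  define K where "K = {g \<in> topspace (mtop A). (s g, t g) = (r1 y, r2 y)}"
  have K: "compactin (mtop A) K"
    unfolding K_def using pr rM[OF y] by (auto simp: proper_map_def)
  define P where "P g Og \<G> \<longleftrightarrow> g \<in> Og \<and> openin (mtop A) Og \<and> countable \<G> \<and>
    (\<forall>T\<in>\<G>. closedin (top_of_set (coord_space {..<k})) T \<and> top_of_set (coord_space {..<k}) interior_of T = {}) \<and>
    (\<forall>u\<in>D - \<Union>\<G>. \<forall>h\<in>Og. s h = r1 u \<and> t h = r2 u \<longrightarrow> \<alpha> (k, V, r1) u ?es = \<alpha> (k, V, r2) u ?es)" for g Og \<G>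
  have "\<exists>Og \<G>. P g Og \<G>" if "g \<in> K" for g
    unfolding P_def
    by (rule local_agreement[OF M A s t \<alpha> st r1 r2 c1(1) c2(1) D DU]) (use that c1 c2 in \<open>auto simp: K_def\<close>)
  then have "\<forall>g\<in>K. \<exists>Og. \<exists>\<G>. P g Og \<G>" by blast
  from bchoice[OF this] obtain Og where "\<forall>g\<in>K. \<exists>\<G>. P g (Og g) \<G>" ..
  from bchoice[OF this] obtain \<G> where "\<forall>g\<in>K. P g (Og g) (\<G> g)" ..
  then have P: "P g (Og g) (\<G> g)" if "g \<in> K" for g using that by blast
  have O: "g \<in> Og g" "openin (mtop A) (Og g)" if "g \<in> K" for g
    using P[OF that] by (simp_all add: P_def)
  have G: "countable (\<G> g)"
    "\<And>T. T \<in> \<G> g \<Longrightarrow> closedin (top_of_set (coord_space {..<k})) T \<and> top_of_set (coord_space {..<k}) interior_of T = {}"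
    if "g \<in> K" for g
    using P[OF that] by (simp_all add: P_def)
  have agree: "\<alpha> (k, V, r1) u ?es = \<alpha> (k, V, r2) u ?es"
    if "g \<in> K" "u \<in> D - \<Union>(\<G> g)" "h \<in> Og g" "s h = r1 u" "t h = r2 u" for g u h
    using P[OF that(1)] that(2-) unfolding P_def by blast
  have "(\<forall>U\<in>Og ` K. openin (mtop A) U) \<and> K \<subseteq> \<Union>(Og ` K)" using O by auto
  then have "\<exists>\<F>. finite \<F> \<and> \<F> \<subseteq> Og ` K \<and> K \<subseteq> \<Union>\<F>"
    using K unfolding compactin_def by simp
  then obtain K0 where K0: "finite K0" "K0 \<subseteq> K" "K \<subseteq> \<Union>(Og ` K0)" by (metis finite_subset_image)
  \<comment> \<open>Arrows outside the finite cover have a closed image that misses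
    \<open>(r1 y, r2 y)\<close>. Hence for \<open>u\<close> in the open set \<open>U\<close> below,
    every arrow from \<open>r1 u\<close> to \<open>r2 u\<close> lies in the cover.\<close>
  define Z where "Z = topspace (mtop A) - \<Union>(Og ` K0)"
  have "closedin (mtop A) Z" unfolding Z_def using O(2) K0(2) by (intro closedin_diff) auto
  then have cl: "closedin (prod_topology (mtop M) (mtop M)) ((\<lambda>g. (s g, t g)) ` Z)"
    using pr by (auto simp: proper_map_def closed_map_def)
  define N where "N = topspace (prod_topology (mtop M) (mtop M)) - (\<lambda>g. (s g, t g)) ` Z"
  have N: "openin (prod_topology (mtop M) (mtop M)) N" unfolding N_def using cl by blast
  have crr: "continuous_map (top_of_set V) (prod_topology (mtop M) (mtop M)) (\<lambda>v. (r1 v, r2 v))"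
    using cr1 cr2 by (simp add: continuous_map_pairedI)
  define U where "U = B \<inter> {v \<in> V. (r1 v, r2 v) \<in> N}"
  have U: "open_in_coords {..<k} U"
    unfolding U_def using openin_preimage_plot[OF V crr N] by (intro openin_Int B) (simp add: openin_Euclidean_space)
  have "(r1 y, r2 y) \<notin> (\<lambda>g. (s g, t g)) ` Z" using K0(3) by (auto simp: Z_def K_def)
  then have "y \<in> U" using yB y rM[OF y] by (simp add: U_def N_def)
  then have Une: "U \<noteq> {}" by auto
  have "\<exists>u\<in>U. u \<notin> \<Union>(\<Union>(\<G> ` K0))"
  proof (rule Baire_coords[OF _ _ U Une])
    show "countable (\<Union>(\<G> ` K0))"
      using K0(1) G(1) subsetD[OF K0(2)] by (intro countable_UN) (auto intro: countable_finite)
    fix T assume "T \<in> \<Union>(\<G> ` K0)"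
    then obtain g where "g \<in> K0" "T \<in> \<G> g" by auto
    then show "closedin (top_of_set (coord_space {..<k})) T \<and> top_of_set (coord_space {..<k}) interior_of T = {}"
      using G(2)[OF subsetD[OF K0(2)]] by simp
  qed
  then obtain u where u: "u \<in> U" "u \<notin> \<Union>(\<Union>(\<G> ` K0))" by blast
  have uD: "u \<in> D" "u \<in> V" using u BD by (auto simp: U_def)
  obtain h where h: "h \<in> topspace (mtop A)" "s h = r1 u" "t h = r2 u" using orb[OF uD(2)] by blast
  have "(r1 u, r2 u) \<notin> (\<lambda>g. (s g, t g)) ` Z" using u(1) by (auto simp: U_def N_def)
  moreover have "(r1 u, r2 u) \<in> (\<lambda>g. (s g, t g)) ` Z" if "h \<in> Z"
    by (rule image_eqI[OF _ that]) (simp add: h)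
  ultimately have "h \<notin> Z" by blast
  then obtain g where "g \<in> K0" "h \<in> Og g" using h by (auto simp: Z_def)
  then have "\<alpha> (k, V, r1) u ?es = \<alpha> (k, V, r2) u ?es" using u uD h K0 by (intro agree[of g]) auto
  then show False using uD DOp by (auto simp: Op_def V0_def)
qed

text \<open>The affine map sending 0 to \<open>u\<close>, with the vectors \<open>ws\<close> as the
  images of the unit vectors under its derivative, pulls the question back to unit vectors on a
  domain of dimension \<open>k\<close>, also when the vectors are linearly dependent. The pulled
  back plots are still joined by arrows.\<close>

lemma agreement:
  fixes q1 q2 :: "vec \<Rightarrow> 'o" and s t :: "'m \<Rightarrow> 'o"
  assumes M: "manifold M" and A: "manifold A" and s: "smooth_map A M s" and t: "smooth_map A M t"
    and pr: "proper_map (mtop A) (prod_topology (mtop M) (mtop M)) (\<lambda>g. (s g, t g))"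
    and \<alpha>: "\<alpha> \<in> dforms k (manifold_dspace M)"
    and st: "\<And>n U p. (n, U, p) \<in> plots (manifold_dspace A) \<Longrightarrow> \<alpha> (n, U, restrict (s \<circ> p) U) = \<alpha> (n, U, restrict (t \<circ> p) U)"
    and q1: "(n, U, q1) \<in> plots (manifold_dspace M)" and q2: "(n, U, q2) \<in> plots (manifold_dspace M)"
    and orb: "\<And>v. v \<in> U \<Longrightarrow> \<exists>g\<in>topspace (mtop A). s g = q1 v \<and> t g = q2 v"
    and u: "u \<in> U" and ws: "length ws = k" "set ws \<subseteq> coord_space {..<n}"
  shows "\<alpha> (n, U, q1) u ws = \<alpha> (n, U, q2) u ws"
proof -
  have U: "openin (Euclidean_space n) U" using q1 unfolding manifold_plots_iff[OF M] by auto
  have uJ: "u \<in> coord_space {..<n}" using u U open_in_coords_subset by (auto simp: openin_Euclidean_space)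
  have wsn: "ws ! i \<in> coord_space {..<n}" if "i < k" for i using ws that by auto
  define f where "f y = (\<lambda>j. u j + (\<Sum>i<k. y i * (ws ! i) j))" for y :: vec
  have fJ: "f y \<in> coord_space {..<n}" for y
    using uJ wsn by (auto simp: f_def coord_space_def)
  define V where "V = {y \<in> coord_space {..<k}. f y \<in> U}"
  have top: "open_in_coords {..<k} (coord_space {..<k})" by simp
  have fCk: "Ck l {..<k} (coord_space {..<k}) (\<lambda>y. f y j)" for l j
    unfolding f_def
    by (intro Ck_add[OF top] Ck_sum[OF top] Ck_mult[OF top] Ck_const[OF top] Ck_coord[OF top])
  have "continuous_on (coord_space {..<k}) f"
    by (rule continuous_on_vecI) (use fCk Ck_continuous in blast)
  moreover obtain U' where U': "open U'" "U = coord_space {..<n} \<inter> U'"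
    using U by (auto simp: openin_Euclidean_space openin_open)
  ultimately have "openin (top_of_set (coord_space {..<k})) (coord_space {..<k} \<inter> f -` U')"
    by (simp add: continuous_openin_preimage_gen)
  moreover have "V = coord_space {..<k} \<inter> f -` U'" using fJ by (auto simp: V_def U')
  ultimately have V: "openin (Euclidean_space k) V" by (simp add: openin_Euclidean_space)
  have sm: "smooth_map (euclidean_open k V) (euclidean_open n U) f"
    unfolding smooth_map_euclidean_open_iff[OF V U] smooth_on_def
    by (auto simp: V_def intro: Ck_subset[OF fCk])
  have f0: "f (\<lambda>_. 0) = u" by (auto simp: f_def)
  have V0: "(\<lambda>_. 0) \<in> V" using f0 u by (auto simp: V_def coord_space_def)
  have es: "set (map unit_vec [0..<k]) \<subseteq> coord_space {..<k}" by (auto simp: unit_vec_def coord_space_def)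
  have "tangent_map k f (\<lambda>_. 0) (unit_vec p) = ws ! p" if p: "p < k" for p
  proof
    fix j
    have "((\<lambda>t. f ((\<lambda>_. 0)(p := t)) j) has_real_derivative (ws ! p) j) (at 0)"
    proof -
      have "f ((\<lambda>_. 0)(p := t)) j = u j + t * (ws ! p) j" for t
      proof -
        have "(\<Sum>i<k. ((\<lambda>_. 0)(p := t)) i * (ws ! i) j) = (\<Sum>i<k. if i = p then t * (ws ! i) j else 0)"
          by (intro sum.cong) auto
        then show ?thesis using p by (simp add: f_def)
      qed
      then show ?thesis by (auto intro!: derivative_eq_intros)
    qed
    then show "tangent_map k f (\<lambda>_. 0) (unit_vec p) j = (ws ! p) j"
      unfolding tangent_map_unit_vec[OF p] by (intro partial_eqI) simp
  qed
  then have T: "map (tangent_map k f (\<lambda>_. 0)) (map unit_vec [0..<k]) = ws"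
    using ws(1) by (intro nth_equalityI) auto
  have "\<alpha> (k, V, restrict (q \<circ> f) V) (\<lambda>_. 0) (map unit_vec [0..<k]) = \<alpha> (n, U, q) u ws"
    if "(n, U, q) \<in> plots (manifold_dspace M)" for q
    using dforms_eval[OF \<alpha> that V sm V0 es] unfolding T f0 .
  moreover have "\<alpha> (k, V, restrict (q1 \<circ> f) V) (\<lambda>_. 0) (map unit_vec [0..<k]) = \<alpha> (k, V, restrict (q2 \<circ> f) V) (\<lambda>_. 0) (map unit_vec [0..<k])"
  proof (rule agreement_on_unit_vecs[OF M A s t pr \<alpha> st manifold_plot_comp[OF M q1 V sm] manifold_plot_comp[OF M q2 V sm] _ V0])
    fix v assume "v \<in> V"
    then show "\<exists>g\<in>topspace (mtop A). s g = restrict (q1 \<circ> f) V v \<and> t g = restrict (q2 \<circ> f) V v"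
      using orb[of "f v"] by (simp add: V_def)
  qed
  ultimately show ?thesis using q1 q2 by simp
qed

section \<open>Descent of forms to the orbit space\<close>

text \<open>The gluing axiom holds because continuity and smoothness in charts are both local;
  composition is \<open>manifold_plot_comp\<close>.\<close>

lemma diffeology_manifold_dspace:
  assumes M: "manifold M"
  shows "diffeology (manifold_dspace M)"
proof (rule diffeologyI)
  show "plots (manifold_dspace M) \<subseteq> parametrisations (points (manifold_dspace M))"
    by (auto simp: manifold_dspace_def)
next
  fix n U x assume U: "openin (Euclidean_space n) U" and x: "x \<in> points (manifold_dspace M)"
  show "(n, U, \<lambda>u\<in>U. x) \<in> plots (manifold_dspace M)"
  proof (rule manifold_plotI[OF M U])
    show c: "continuous_map (top_of_set U) (mtop M) (\<lambda>u. x)"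
      using x by (simp add: manifold_dspace_def)
    fix W l \<phi> j assume "(W, l, \<phi>) \<in> charts M" "j < (l::nat)"
    then show "smooth_on {..<n} {u \<in> U. x \<in> W} (\<lambda>u. \<phi> x j)"
      using openin_preimage_plot[OF U c manifold_chart(1)[OF M]]
      by (auto simp: smooth_on_def openin_Euclidean_space intro!: Ck_const)
  qed
next
  fix n U p
  assume p: "(n, U, p) \<in> parametrisations (points (manifold_dspace M))"
    and loc: "\<forall>u\<in>U. \<exists>V. openin (Euclidean_space n) V \<and> u \<in> V \<and> V \<subseteq> U \<and>
                (n, V, restrict p V) \<in> plots (manifold_dspace M)"
  have U: "openin (Euclidean_space n) U" and pU: "p \<in> U \<rightarrow>\<^sub>E topspace (mtop M)"
    using p by (auto simp: parametrisations_def manifold_dspace_def)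
  have c: "continuous_map (top_of_set U) (mtop M) p"
    unfolding continuous_map_def
  proof (intro conjI allI impI)
    show "p \<in> topspace (top_of_set U) \<rightarrow> topspace (mtop M)" using pU by auto
    fix W assume W: "openin (mtop M) W"
    have "openin (Euclidean_space n) {x \<in> U. p x \<in> W}"
    proof (subst openin_subopen, intro ballI)
      fix x assume x: "x \<in> {x \<in> U. p x \<in> W}"
      then obtain V where V: "openin (Euclidean_space n) V" "x \<in> V" "V \<subseteq> U" "(n, V, restrict p V) \<in> plots (manifold_dspace M)"
        using loc by blast
      have cV: "continuous_map (top_of_set V) (mtop M) (restrict p V)"
        using V(4) unfolding manifold_plots_iff[OF M] by blast
      have "openin (Euclidean_space n) {x \<in> V. restrict p V x \<in> W}"
        by (rule openin_preimage_plot[OF V(1) cV W])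
      moreover have "x \<in> {x \<in> V. restrict p V x \<in> W}" "{x \<in> V. restrict p V x \<in> W} \<subseteq> {x \<in> U. p x \<in> W}"
        using x V by auto
      ultimately show "\<exists>T. openin (Euclidean_space n) T \<and> x \<in> T \<and> T \<subseteq> {x \<in> U. p x \<in> W}" by blast
    qed
    then show "openin (top_of_set U) {x \<in> topspace (top_of_set U). p x \<in> W}"
      unfolding openin_Euclidean_space using open_in_coords_subset[OF U[unfolded openin_Euclidean_space]]
      by (metis (no_types, lifting) Collect_subset Euclidean_space_eq U openin_imp_subset openin_subset_trans topspace_euclidean_subtopology Collect_cong)
  qed
  have "(n, U, restrict p U) \<in> plots (manifold_dspace M)"
  proof (rule manifold_plotI[OF M U c], rule smooth_on_local)
    fix W l \<phi> j x assume ch: "(W, l, \<phi>) \<in> charts M" "j < l" and x: "x \<in> {x \<in> U. p x \<in> W}"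
    then obtain V where V: "openin (Euclidean_space n) V" "x \<in> V" "V \<subseteq> U" "(n, V, restrict p V) \<in> plots (manifold_dspace M)"
      using loc by blast
    define Z where "Z = {x \<in> V. restrict p V x \<in> W}"
    have cV: "continuous_map (top_of_set V) (mtop M) (restrict p V)"
      and sV: "smooth_on {..<n} Z (\<lambda>x. \<phi> (restrict p V x) j)"
      using V(4) ch unfolding manifold_plots_iff[OF M] Z_def by fast+
    have Z: "open_in_coords {..<n} Z"
      unfolding Z_def openin_Euclidean_space[symmetric] by (rule openin_preimage_plot[OF V(1) cV manifold_chart(1)[OF M ch(1)]])
    have "smooth_on {..<n} Z (\<lambda>x. \<phi> (p x) j)"
      by (rule smooth_on_cong[OF Z, THEN iffD1, OF _ sV]) (simp add: Z_def)
    moreover have "x \<in> Z" "Z \<subseteq> {x \<in> U. p x \<in> W}" using x V by (auto simp: Z_def)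
    ultimately show "\<exists>Z. open_in_coords {..<n} Z \<and> x \<in> Z \<and> Z \<subseteq> {x \<in> U. p x \<in> W} \<and> smooth_on {..<n} Z (\<lambda>x. \<phi> (p x) j)"
      using Z by blast
  qed
  moreover have "restrict p U = p" using pU by (simp add: PiE_def extensional_restrict)
  ultimately show "(n, U, p) \<in> plots (manifold_dspace M)" by simp
next
  show "(m, V, restrict (p \<circ> f) V) \<in> plots (manifold_dspace M)"
    if "(n, U, p) \<in> plots (manifold_dspace M)" "openin (Euclidean_space m) V"
      "smooth_map (euclidean_open m V) (euclidean_open n U) f" for n U p m V f
    by (rule manifold_plot_comp[OF M that])
qed

lemma plots_open: "diffeology X \<Longrightarrow> (n, U, p) \<in> plots X \<Longrightarrow> openin (Euclidean_space n) U"
  unfolding diffeology_def parametrisations_def by auto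

lemma zero_in_dforms:
  assumes X: "diffeology X"
  shows "0 \<in> dforms k X"
proof -
  have "smooth_fun n U (\<lambda>x. 0)" if "openin (Euclidean_space n) U" for n U
    unfolding smooth_fun_iff[OF that] smooth_on_def using that by (simp add: openin_Euclidean_space Ck_const)
  then have "(\<lambda>x vs. 0) \<in> eforms k n U" if "(n, U, p) \<in> plots X" for n U p
    using plots_open[OF X that] by (auto simp: eforms_def alternating_multilinear_def)
  then show ?thesis
    by (auto simp: dforms_def eform_pullback_def zero_fun_def fun_eq_iff)
qed

section \<open>The pullback from the orbit space to the objects\<close>

context lie_groupoid
begin

lemma diffeology_obj_space: "diffeology (obj_space G)"
  by (rule diffeology_manifold_dspace[OF manifold_objs])

lemma diffeology_orbit_space: "diffeology (orbit_space G)"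
  unfolding orbit_space_def by (rule diffeology_quotient_dspace[OF diffeology_obj_space])

lemma orbit_eq_iff:
  assumes "x \<in> Obj G" "y \<in> Obj G"
  shows "orbit G x = orbit G y \<longleftrightarrow> (\<exists>g\<in>Arr G. src G g = x \<and> tgt G g = y)"
  using eq_equiv_class_iff[OF equiv_orbit_rel assms] unfolding orbit_eq_Image by (auto simp: orbit_rel_def)

lemma obj_plot_in: "(n, U, q) \<in> plots (obj_space G) \<Longrightarrow> u \<in> U \<Longrightarrow> q u \<in> Obj G"
  by (auto simp: manifold_dspace_def parametrisations_def)

lemma orbit_plot:
  assumes q: "(n, U, q) \<in> plots (obj_space G)"
  shows "(n, U, restrict (orbit G \<circ> q) U) \<in> plots (orbit_space G)"
proof -
  have U: "openin (Euclidean_space n) U" by (rule plots_open[OF diffeology_obj_space q])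
  have "orbit G (q u) \<in> points (obj_space G) // orbit_rel G" if "u \<in> U" for u
    unfolding orbit_eq_Image using obj_plot_in[OF q that] by (intro quotientI) (simp add: manifold_dspace_def)
  moreover have "\<forall>u\<in>U. \<exists>V q'. openin (Euclidean_space n) V \<and> u \<in> V \<and> V \<subseteq> U \<and> (n, V, q') \<in> plots (obj_space G) \<and>
      (\<forall>v\<in>V. restrict (orbit G \<circ> q) U v = orbit_rel G `` {q' v})"
    using q U by (intro ballI exI[of _ U] exI[of _ q]) (auto simp: orbit_eq_Image)
  ultimately show ?thesis
    using U by (auto simp: orbit_space_def quotient_dspace_def parametrisations_def)
qed

text \<open>The base point enters only through \<open>u \<in> V\<close>, so a lift at one point is a
  lift at every point of its domain.\<close>

definition local_lift :: "'o set param \<Rightarrow> vec \<Rightarrow> vec set \<Rightarrow> (vec \<Rightarrow> 'o) \<Rightarrow> bool" where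
  "local_lift = (\<lambda>(n, U, p) u V q. openin (Euclidean_space n) V \<and> u \<in> V \<and> V \<subseteq> U \<and>
     (n, V, q) \<in> plots (obj_space G) \<and> (\<forall>v\<in>V. p v = orbit G (q v)))"

lemma local_lift_exists:
  "(n, U, p) \<in> plots (orbit_space G) \<Longrightarrow> u \<in> U \<Longrightarrow> \<exists>V q. local_lift (n, U, p) u V q"
  unfolding orbit_space_def quotient_dspace_def local_lift_def by (simp add: orbit_eq_Image)

text \<open>Every plot of the orbit space lifts locally to a plot of objects, and on such a piece
  the value of \<open>\<beta>\<close> is a value of its pullback;
  \<open>dforms_restrict_eval\<close> allows the passage to the piece.\<close>

lemma orbit_form_zero:
  assumes \<beta>: "\<beta> \<in> dforms k (orbit_space G)" and z: "dform_pullback (obj_space G) (orbit G) \<beta> = 0"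
  shows "\<beta> = 0"
proof
  fix P :: "'o set param"
  obtain n U p where P: "P = (n, U, p)" by (metis prod_cases3)
  show "\<beta> P = 0 P"
  proof (cases "P \<in> plots (orbit_space G)")
    case False
    then have "\<beta> P = 0" using \<beta> unfolding dforms_def by blast
    then show ?thesis by (simp add: zero_fun_def)
  next
    case True
    then have p: "(n, U, p) \<in> plots (orbit_space G)" by (simp add: P)
    have U: "openin (Euclidean_space n) U" by (rule plots_open[OF diffeology_orbit_space p])
    have "\<beta> (n, U, p) u ws = 0" for u ws
    proof (cases "u \<in> U \<and> set ws \<subseteq> coord_space {..<n}")
      case False
      then show ?thesis using eforms_zero[OF dforms_eform[OF \<beta> p]] by blast
    next
      case True
      then obtain V q where "local_lift (n, U, p) u V q" using local_lift_exists[OF p] by blast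
      then have V: "openin (Euclidean_space n) V" "u \<in> V" "V \<subseteq> U" "(n, V, q) \<in> plots (obj_space G)"
        "\<forall>v\<in>V. p v = orbit G (q v)" by (auto simp: local_lift_def)
      have "dform_pullback (obj_space G) (orbit G) \<beta> (n, V, q) = \<beta> (n, V, restrict (orbit G \<circ> q) V)"
        using V(4) by (simp add: dform_pullback_def)
      moreover have "restrict (orbit G \<circ> q) V = restrict p V" using V(5) by (auto simp: restrict_def fun_eq_iff)
      ultimately have "\<beta> (n, V, restrict p V) = 0" using z by (simp add: zero_fun_def)
      then show ?thesis
        using dforms_restrict_eval[OF \<beta> p U V(1,3,2)] True by (simp add: zero_fun_def)
    qed
    then show ?thesis by (auto simp: P zero_fun_def fun_eq_iff)
  qed
qed

lemma pullback_in_dforms: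
  assumes \<beta>: "\<beta> \<in> dforms k (orbit_space G)"
  shows "dform_pullback (obj_space G) (orbit G) \<beta> \<in> dforms k (obj_space G)"
proof -
  let ?\<alpha> = "dform_pullback (obj_space G) (orbit G) \<beta>"
  have e: "?\<alpha> (n, U, q) \<in> eforms k n U" if "(n, U, q) \<in> plots (obj_space G)" for n U q
    using that dforms_eform[OF \<beta> orbit_plot[OF that]] by (simp add: dform_pullback_def)
  have n: "?\<alpha> (m, V, restrict (q \<circ> f) V) = eform_pullback m V f (?\<alpha> (n, U, q))"
    if q: "(n, U, q) \<in> plots (obj_space G)" and V: "openin (Euclidean_space m) V"
      and f: "smooth_map (euclidean_open m V) (euclidean_open n U) f" for n U q m V f
  proof -
    have "f ` V \<subseteq> U"
      using f smooth_map_euclidean_open_iff[OF V plots_open[OF diffeology_obj_space q]] by blast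
    then have "restrict (orbit G \<circ> restrict (q \<circ> f) V) V = restrict (restrict (orbit G \<circ> q) U \<circ> f) V"
      by (auto simp: restrict_def fun_eq_iff)
    then show ?thesis
      using manifold_plot_comp[OF manifold_objs q V f] q dforms_pullback_apply[OF \<beta> orbit_plot[OF q] V f]
      by (simp add: dform_pullback_def)
  qed
  have "?\<alpha> P = 0" if "P \<notin> plots (obj_space G)" for P
    using that by (cases P) (simp add: dform_pullback_def)
  then show ?thesis unfolding dforms_def using e n by auto
qed

lemma src_tgt_plot:
  assumes "(n, U, p) \<in> plots (arr_space G)"
  shows "(n, U, restrict (src G \<circ> p) U) \<in> plots (obj_space G)" "(n, U, restrict (tgt G \<circ> p) U) \<in> plots (obj_space G)"
  using submersion_src submersion_tgt assms manifold_arrs manifold_objs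
  by (auto simp: submersion_def intro: smooth_map_plot)

text \<open>Source and target of an arrow lie in one orbit, so both composites with
  \<open>orbit G\<close> are the same plot of the orbit space.\<close>

lemma pullback_in_kernel:
  assumes \<beta>: "\<beta> \<in> dforms k (orbit_space G)"
  defines "\<alpha> \<equiv> dform_pullback (obj_space G) (orbit G) \<beta>"
  shows "dform_pullback (arr_space G) (src G) \<alpha> - dform_pullback (arr_space G) (tgt G) \<alpha> = 0"
proof -
  have "dform_pullback (arr_space G) (src G) \<alpha> P = dform_pullback (arr_space G) (tgt G) \<alpha> P" for P
  proof (cases P)
    case (fields n U p)
    show ?thesis
    proof (cases "(n, U, p) \<in> plots (arr_space G)")
      case True
      have "restrict (orbit G \<circ> restrict (src G \<circ> p) U) U = restrict (orbit G \<circ> restrict (tgt G \<circ> p) U) U"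
      proof
        fix u
        have "orbit G (src G (p u)) = orbit G (tgt G (p u))" if "u \<in> U"
        proof -
          have "p u \<in> Arr G" using True that by (auto simp: manifold_dspace_def parametrisations_def)
          then show ?thesis using src_in tgt_in by (subst orbit_eq_iff) auto
        qed
        then show "restrict (orbit G \<circ> restrict (src G \<circ> p) U) U u = restrict (orbit G \<circ> restrict (tgt G \<circ> p) U) U u"
          by simp
      qed
      then show ?thesis using True src_tgt_plot[OF True] by (simp add: fields dform_pullback_def \<alpha>_def)
    qed (simp add: fields dform_pullback_def)
  qed
  then show ?thesis by (simp add: fun_eq_iff zero_fun_def fun_diff_def)
qed

text \<open>A local lift is chosen anew at every point, so neither smoothness nor naturality can be
  read off; both follow once \<open>lift_independent\<close> shows that any other lift gives the
  same value. Off the plots and off \<open>U\<close> the value is 0, the normalisation of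
  forms.\<close>

definition descend :: "'o dform \<Rightarrow> 'o set dform" where
  "descend \<alpha> = (\<lambda>(n, U, p) u ws. if (n, U, p) \<in> plots (orbit_space G) \<and> u \<in> U
     then (case SOME Vq. local_lift (n, U, p) u (fst Vq) (snd Vq) of (V, q) \<Rightarrow> \<alpha> (n, V, q) u ws) else 0)"

context
  fixes k :: nat and \<alpha> :: "'o dform"
  assumes proper: "proper_groupoid G" and \<alpha>: "\<alpha> \<in> dforms k (obj_space G)"
    and ker: "dform_pullback (arr_space G) (src G) \<alpha> - dform_pullback (arr_space G) (tgt G) \<alpha> = 0"
begin

text \<open>This is where properness and the kernel condition act: on the common domain the two
  lifts meet the same orbits, so \<open>agreement\<close> applies. Arguments of the wrong shape give
  0 on both sides.\<close>

lemma lift_independent: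
  assumes l1: "local_lift (n, U, p) u V1 q1" and l2: "local_lift (n, U, p) u V2 q2"
  shows "\<alpha> (n, V1, q1) u ws = \<alpha> (n, V2, q2) u ws"
proof -
  have V: "openin (Euclidean_space n) V1" "openin (Euclidean_space n) V2" "u \<in> V1" "u \<in> V2"
    and q: "(n, V1, q1) \<in> plots (obj_space G)" "(n, V2, q2) \<in> plots (obj_space G)"
    and eq: "\<And>v. v \<in> V1 \<inter> V2 \<Longrightarrow> orbit G (q1 v) = orbit G (q2 v)"
    using l1 l2 by (auto simp: local_lift_def)
  show ?thesis
  proof (cases "length ws = k \<and> set ws \<subseteq> coord_space {..<n}")
    case False
    then show ?thesis using eforms_zero[OF dforms_eform[OF \<alpha> q(1)]] eforms_zero[OF dforms_eform[OF \<alpha> q(2)]] by metis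
  next
    case True
    let ?V = "V1 \<inter> V2"
    have oV: "openin (Euclidean_space n) ?V" using V by blast
    have sm: "smooth_map (arrs G) (objs G) (src G)" "smooth_map (arrs G) (objs G) (tgt G)"
      using submersion_src submersion_tgt by (auto simp: submersion_def)
    have r: "(n, ?V, restrict q1 ?V) \<in> plots (obj_space G)" "(n, ?V, restrict q2 ?V) \<in> plots (obj_space G)"
      using manifold_plot_comp[OF manifold_objs q(1) oV smooth_map_inclusion[OF V(1) oV]]
        manifold_plot_comp[OF manifold_objs q(2) oV smooth_map_inclusion[OF V(2) oV]] by (simp_all add: comp_def)
    have "\<alpha> (n, ?V, restrict q1 ?V) u ws = \<alpha> (n, ?V, restrict q2 ?V) u ws"
    proof (rule agreement[OF manifold_objs manifold_arrs sm proper[unfolded proper_groupoid_def] \<alpha> _ r])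
      fix m W c assume c: "(m, W, c) \<in> plots (arr_space G)"
      have "dform_pullback (arr_space G) (src G) \<alpha> (m, W, c) - dform_pullback (arr_space G) (tgt G) \<alpha> (m, W, c) = 0"
        using fun_cong[OF ker, of "(m, W, c)"] by (simp add: fun_diff_def zero_fun_def)
      then show "\<alpha> (m, W, restrict (src G \<circ> c) W) = \<alpha> (m, W, restrict (tgt G \<circ> c) W)"
        using c by (simp add: dform_pullback_def)
    next
      fix v assume v: "v \<in> ?V"
      have "q1 v \<in> Obj G" "q2 v \<in> Obj G" using v obj_plot_in q by auto
      then show "\<exists>g\<in>Arr G. src G g = restrict q1 ?V v \<and> tgt G g = restrict q2 ?V v"
        using eq[OF v] v orbit_eq_iff[of "q1 v" "q2 v"] by simp
    qed (use V True in auto)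
    then show ?thesis
      using dforms_restrict_eval[OF \<alpha> q(1) V(1) oV, of u ws] dforms_restrict_eval[OF \<alpha> q(2) V(2) oV, of u ws] V True
      by simp
  qed
qed

lemma descend_eq:
  assumes "(n, U, p) \<in> plots (orbit_space G)" "local_lift (n, U, p) u V q"
  shows "descend \<alpha> (n, U, p) u ws = \<alpha> (n, V, q) u ws"
proof -
  define Vq where "Vq = (SOME Vq. local_lift (n, U, p) u (fst Vq) (snd Vq))"
  have "local_lift (n, U, p) u (fst (V, q)) (snd (V, q))" using assms(2) by simp
  then have "local_lift (n, U, p) u (fst Vq) (snd Vq)" unfolding Vq_def by (rule someI)
  from lift_independent[OF this assms(2)] have "\<alpha> (n, fst Vq, snd Vq) u ws = \<alpha> (n, V, q) u ws" .
  moreover have "u \<in> U" using assms(2) by (auto simp: local_lift_def)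
  ultimately show ?thesis
    using assms(1) by (simp add: descend_def Vq_def case_prod_beta)
qed

lemma descend_in_dforms: "descend \<alpha> \<in> dforms k (orbit_space G)"
proof -
  have e: "descend \<alpha> (n, U, p) \<in> eforms k n U" if p: "(n, U, p) \<in> plots (orbit_space G)" for n U p
  proof -
    have U: "openin (Euclidean_space n) U" by (rule plots_open[OF diffeology_orbit_space p])
    \<comment> \<open>One lift serves on its whole domain, so near \<open>x\<close> the descended
      form is a single form \<open>\<alpha> (n, V, q)\<close> and inherits its properties.\<close>
    have ex: "\<exists>V q. local_lift (n, U, p) x V q \<and> (\<forall>v\<in>V. descend \<alpha> (n, U, p) v = \<alpha> (n, V, q) v) \<and> \<alpha> (n, V, q) \<in> eforms k n V"
      if x: "x \<in> U" for x
    proof -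
      obtain V q where l: "local_lift (n, U, p) x V q" using local_lift_exists[OF p x] by blast
      have "descend \<alpha> (n, U, p) v = \<alpha> (n, V, q) v" if "v \<in> V" for v
      proof
        have "local_lift (n, U, p) v V q" using l that by (simp add: local_lift_def)
        then show "descend \<alpha> (n, U, p) v ws = \<alpha> (n, V, q) v ws" for ws by (rule descend_eq[OF p])
      qed
      moreover have "\<alpha> (n, V, q) \<in> eforms k n V" using l by (intro dforms_eform[OF \<alpha>]) (simp add: local_lift_def)
      ultimately show ?thesis using l by blast
    qed
    have 1: "descend \<alpha> (n, U, p) x vs = 0" if "\<not> (x \<in> U \<and> length vs = k \<and> set vs \<subseteq> topspace (Euclidean_space n))" for x vs
    proof (cases "x \<in> U")
      case True
      obtain V q where "local_lift (n, U, p) x V q" "\<forall>v\<in>V. descend \<alpha> (n, U, p) v = \<alpha> (n, V, q) v" "\<alpha> (n, V, q) \<in> eforms k n V"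
        using ex[OF True] by blast
      then show ?thesis using that True eforms_zero[of "\<alpha> (n, V, q)" k n V x vs]
        by (auto simp: local_lift_def topspace_Euclidean)
    qed (simp add: descend_def)
    have 2: "alternating_multilinear k n (descend \<alpha> (n, U, p) x)" if x: "x \<in> U" for x
    proof -
      obtain V q where "local_lift (n, U, p) x V q" "\<forall>v\<in>V. descend \<alpha> (n, U, p) v = \<alpha> (n, V, q) v" "\<alpha> (n, V, q) \<in> eforms k n V"
        using ex[OF x] by blast
      then show ?thesis by (simp add: local_lift_def eforms_def)
    qed
    have 3: "smooth_fun n U (\<lambda>x. descend \<alpha> (n, U, p) x vs)" if vs: "length vs = k \<and> set vs \<subseteq> topspace (Euclidean_space n)" for vs
      unfolding smooth_fun_iff[OF U]
    proof (rule smooth_on_local)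
      fix x assume x: "x \<in> U"
      obtain V q where l: "local_lift (n, U, p) x V q" "\<forall>v\<in>V. descend \<alpha> (n, U, p) v = \<alpha> (n, V, q) v" "\<alpha> (n, V, q) \<in> eforms k n V"
        using ex[OF x] by blast
      have V: "openin (Euclidean_space n) V" "x \<in> V" "V \<subseteq> U" using l(1) by (auto simp: local_lift_def)
      have "smooth_fun n V (\<lambda>x. \<alpha> (n, V, q) x vs)" using l(3) vs by (simp add: eforms_def)
      then have "smooth_on {..<n} V (\<lambda>x. \<alpha> (n, V, q) x vs)" by (simp add: smooth_fun_iff[OF V(1)])
      then have "smooth_on {..<n} V (\<lambda>x. descend \<alpha> (n, U, p) x vs)"
        by (rule smooth_on_cong[THEN iffD1, rotated 2]) (use V l(2) in \<open>auto simp: openin_Euclidean_space\<close>)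
      then show "\<exists>W. open_in_coords {..<n} W \<and> x \<in> W \<and> W \<subseteq> U \<and> smooth_on {..<n} W (\<lambda>x. descend \<alpha> (n, U, p) x vs)"
        using V by (auto simp: openin_Euclidean_space)
    qed
    show ?thesis unfolding eforms_def using 1 2 3 by simp
  qed
  have nat: "descend \<alpha> (m, V, restrict (p \<circ> f) V) = eform_pullback m V f (descend \<alpha> (n, U, p))"
    if p: "(n, U, p) \<in> plots (orbit_space G)" and V: "openin (Euclidean_space m) V"
      and f: "smooth_map (euclidean_open m V) (euclidean_open n U) f" for n U p m V f
  proof (intro ext)
    fix y ws
    have U: "openin (Euclidean_space n) U" by (rule plots_open[OF diffeology_orbit_space p])
    have fV: "f ` V \<subseteq> U" using f smooth_map_euclidean_open_iff[OF V U] by blast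
    have pf: "(m, V, restrict (p \<circ> f) V) \<in> plots (orbit_space G)"
      by (rule diffeology_compD[OF diffeology_orbit_space p V f])
    show "descend \<alpha> (m, V, restrict (p \<circ> f) V) y ws = eform_pullback m V f (descend \<alpha> (n, U, p)) y ws"
    proof (cases "y \<in> V \<and> set ws \<subseteq> coord_space {..<m}")
      case False
      then have "descend \<alpha> (m, V, restrict (p \<circ> f) V) y ws = 0"
        using eforms_zero[OF e[OF pf]] by blast
      then show ?thesis using False by (auto simp: eform_pullback_def topspace_Euclidean)
    next
      case True
      then obtain V0 q0 where l: "local_lift (n, U, p) (f y) V0 q0" using local_lift_exists[OF p, of "f y"] fV by auto
      then have V0: "openin (Euclidean_space n) V0" "f y \<in> V0" "V0 \<subseteq> U" "(n, V0, q0) \<in> plots (obj_space G)"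
        "\<forall>v\<in>V0. p v = orbit G (q0 v)" by (auto simp: local_lift_def)
      \<comment> \<open>The lift of \<open>p\<close> near \<open>f y\<close>, composed with
        \<open>f\<close>, lifts \<open>p \<circ> f\<close> near \<open>y\<close>; naturality of
        \<open>\<alpha>\<close> along \<open>f\<close> then carries over to the descended
        form.\<close>
      define W where "W = {z \<in> V. f z \<in> V0}"
      have cf: "continuous_map (top_of_set V) (Euclidean_space n) f"
        using f by (simp add: smooth_map_def euclidean_open_def subtopology_Euclidean_space[OF V] continuous_map_in_subtopology)
      have W: "openin (Euclidean_space m) W" unfolding W_def by (rule openin_preimage_plot[OF V cf V0(1)])
      have fW: "smooth_map (euclidean_open m W) (euclidean_open n V0) f"
        by (rule smooth_map_euclidean_open_restrict[OF f V W]) (use V0(3) in \<open>auto simp: W_def\<close>)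
      have "local_lift (m, V, restrict (p \<circ> f) V) y W (restrict (q0 \<circ> f) W)"
        unfolding local_lift_def using W V0 True manifold_plot_comp[OF manifold_objs V0(4) W fW] by (auto simp: W_def)
      then have "descend \<alpha> (m, V, restrict (p \<circ> f) V) y ws = \<alpha> (m, W, restrict (q0 \<circ> f) W) y ws"
        by (rule descend_eq[OF pf])
      also have "\<dots> = \<alpha> (n, V0, q0) (f y) (map (tangent_map m f y) ws)"
        by (rule dforms_eval[OF \<alpha> V0(4) W fW]) (use True V0 in \<open>auto simp: W_def\<close>)
      also have "\<dots> = descend \<alpha> (n, U, p) (f y) (map (tangent_map m f y) ws)"
        by (rule descend_eq[OF p l, symmetric])
      finally show ?thesis using True by (simp add: eform_pullback_def topspace_Euclidean)
    qed
  qed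
  have "descend \<alpha> P = 0" if "P \<notin> plots (orbit_space G)" for P
    using that by (cases P) (auto simp: descend_def fun_eq_iff zero_fun_def)
  then show ?thesis unfolding dforms_def using e nat by auto
qed

text \<open>A plot of objects is itself a local lift of its composite with
  \<open>orbit G\<close>.\<close>

lemma pullback_descend: "dform_pullback (obj_space G) (orbit G) (descend \<alpha>) = \<alpha>"
proof
  fix P :: "'o param"
  obtain n U q where P: "P = (n, U, q)" by (metis prod_cases3)
  show "dform_pullback (obj_space G) (orbit G) (descend \<alpha>) P = \<alpha> P"
  proof (cases "(n, U, q) \<in> plots (obj_space G)")
    case False
    then show ?thesis using \<alpha> by (auto simp: P dform_pullback_def dforms_def)
  next
    case True
    have "descend \<alpha> (n, U, restrict (orbit G \<circ> q) U) u ws = \<alpha> (n, U, q) u ws" for u ws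
    proof (cases "u \<in> U")
      case u: True
      have "local_lift (n, U, restrict (orbit G \<circ> q) U) u U q"
        using u True plots_open[OF diffeology_obj_space True] by (simp add: local_lift_def)
      then show ?thesis by (rule descend_eq[OF orbit_plot[OF True]])
    next
      case False
      then show ?thesis using eforms_zero[OF dforms_eform[OF \<alpha> True]] by (simp add: descend_def)
    qed
    then show ?thesis using True by (simp add: P dform_pullback_def fun_eq_iff)
  qed
qed

end

end

theorem corollary1p3:
  fixes G :: "('o, 'm) groupoid"
  assumes "lie_groupoid G"
  shows "(\<forall>k. {\<beta> \<in> dforms k (orbit_space G). dform_pullback (obj_space G) (orbit G) \<beta> = 0} = {0}) \<and>
    (proper_groupoid G \<longrightarrow>
      (\<forall>k. {\<alpha> \<in> dforms k (obj_space G).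
              dform_pullback (arr_space G) (src G) \<alpha> - dform_pullback (arr_space G) (tgt G) \<alpha> = 0}
          = dform_pullback (obj_space G) (orbit G) ` dforms k (orbit_space G)))"
proof -
  interpret lie_groupoid G by fact
  have "dform_pullback (obj_space G) (orbit G) 0 = 0"
    by (auto simp: dform_pullback_def fun_eq_iff zero_fun_def)
  then have 1: "{\<beta> \<in> dforms k (orbit_space G). dform_pullback (obj_space G) (orbit G) \<beta> = 0} = {0}" for k
    using orbit_form_zero zero_in_dforms[OF diffeology_orbit_space] by blast
  have 2: "{\<alpha> \<in> dforms k (obj_space G).
              dform_pullback (arr_space G) (src G) \<alpha> - dform_pullback (arr_space G) (tgt G) \<alpha> = 0}
          = dform_pullback (obj_space G) (orbit G) ` dforms k (orbit_space G)" if "proper_groupoid G" for k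
  proof (intro equalityI subsetI)
    fix \<alpha> assume "\<alpha> \<in> {\<alpha> \<in> dforms k (obj_space G).
              dform_pullback (arr_space G) (src G) \<alpha> - dform_pullback (arr_space G) (tgt G) \<alpha> = 0}"
    then show "\<alpha> \<in> dform_pullback (obj_space G) (orbit G) ` dforms k (orbit_space G)"
      using descend_in_dforms[OF that] pullback_descend[OF that] by (intro image_eqI[of _ _ "descend \<alpha>"]) auto
  next
    fix \<alpha> assume "\<alpha> \<in> dform_pullback (obj_space G) (orbit G) ` dforms k (orbit_space G)"
    then show "\<alpha> \<in> {\<alpha> \<in> dforms k (obj_space G).
              dform_pullback (arr_space G) (src G) \<alpha> - dform_pullback (arr_space G) (tgt G) \<alpha> = 0}"
      using pullback_in_dforms pullback_in_kernel by auto
  qed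
  show ?thesis by (intro conjI allI impI 1 2)
qed

end
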